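(* Let $N\in\mathbb{N}$, $T>0$, let $a_2,a_{1,1},\dots,a_{1,N},a_0\in C([0,T];\mathbb{C})$ and consider $$P(t,D_x,D_t)=D_t-a_2(t)\Delta_x+\sum_{j=1}^N a_{1,j}(t)D_{x_j}+a_0(t).$$ Assume that $\operatorname{Im}(a_2)(t)\le0$ and $\operatorname{Im}(a_{1,j})(t)=0$ for every $j\in\{1,\dots,N\}$ and $t\in[0,T]$. Then the Cauchy problem $Pu(t,x)=f(t,x)$, $u(0,x)=g(x)$, $t\in[0,T]$, $x\in\mathbb{T}^N$, is well-posed in $H^r$.
   Context: $\mathbb{T}^N=\mathbb{R}^N/2\pi\mathbb{Z}^N$, $D_t=\frac1i\partial_t$, $D_{x_j}=\frac1i\partial_{x_j}$, $\Delta_x=\sum_j\partial_{x_j}^2$. For a distribution $u$ on $\mathbb{T}^N$ its Fourier coefficients are $\widehat u(\xi)=\langle u,e^{-ix\xi}\rangle$, $\xi\in\mathbb{Z}^N$, normalized so that $u=\sum_\xi\widehat u(\xi)e^{ix\xi}$. For $r\in\mathbb{R}$, $H^r(\mathbb{T}^N)$ is the set of distributions with $\|u\|_{H^r}^2=\sum_{\xi}|\widehat u(\xi)|^2(1+|\xi|)^{2r}<\infty$. $C([0,T];X)$ denotes the continuous maps $[0,T]\to X$. Solutions. $u\in C([0,T];H^\rho(\mathbb{T}^N))$ (some $\rho\in\mathbb{R}$) solves the Cauchy problem if $u(0)=g$ and $Pu=f$ holds with $D_tu$ understood as the weak derivative in $t$ on $(0,T)$: $\langle D_tu,\varphi\rangle=\int_0^T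 u(t)(-D_t\varphi(t))\,dt$ for $\varphi\in C_c^\infty((0,T))$. Well-posedness. The Cauchy problem is well-posed in $H^r$ if for every $r\in\mathbb{R}$, $f\in C([0,T];H^r(\mathbb{T}^N))$ and $g\in H^r(\mathbb{T}^N)$ there is a unique solution $u\in C([0,T];H^r(\mathbb{T}^N))$. *)

theory Defs
  imports "HOL-Analysis.Analysis"
begin

section \<open>Smooth functions and test functions\<close>

definition dir_deriv :: "'a \<Rightarrow> ('a::euclidean_space \<Rightarrow> complex) \<Rightarrow> 'a \<Rightarrow> complex" where
  "dir_deriv e f x = frechet_derivative f (at x) e"

text \<open>Multi-indices are written as lists of basis vectors. Differentiability of every
  iterated partial derivative gives continuity of all of them, hence \<open>C\<^sup>\<infinity>\<close>.\<close>

definition smooth :: "('a::euclidean_space \<Rightarrow> complex) \<Rightarrow> bool" where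
  "smooth f \<longleftrightarrow> (\<forall>es. set es \<subseteq> Basis \<longrightarrow> (\<forall>x. foldr dir_deriv es f differentiable (at x)))"

text \<open>\<open>C\<^sup>\<infinity>\<close> functions on the torus, as functions on Euclidean space that are
  \<open>2\<pi>\<close>-periodic in every coordinate.\<close>

definition torus_test :: "(real^'n \<Rightarrow> complex) set" where
  "torus_test = {\<psi>. smooth \<psi> \<and> (\<forall>x j. \<psi> (x + axis j (2 * pi)) = \<psi> x)}"

text \<open>\<open>C\<^sub>c\<^sup>\<infinity>((0,T))\<close>, each function being extended by zero to the real line.\<close>

definition time_test :: "real \<Rightarrow> (real \<Rightarrow> complex) set" where
  "time_test T = {\<phi>. smooth \<phi> \<and> (\<exists>K. compact K \<and> K \<subseteq> {0<..<T} \<and> (\<forall>t. t \<notin> K \<longrightarrow> \<phi> t = 0))}"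

section \<open>Distributions and Sobolev spaces on the torus\<close>

definition Ck_norm :: "nat \<Rightarrow> (real^'n \<Rightarrow> complex) \<Rightarrow> real" where
  "Ck_norm k \<psi> =
     (\<Sum>es | set es \<subseteq> Basis \<and> length es \<le> k. SUP x. norm (foldr dir_deriv es \<psi> x))"

text \<open>A distribution is a continuous linear functional on the test functions. It is made total
  by the value 0 outside the test functions, so that equality of functionals is equality of
  distributions.\<close>

type_synonym 'n functional = "((real, 'n) vec \<Rightarrow> complex) \<Rightarrow> complex"

definition distributions :: "'n::finite functional set" where
  "distributions = {u.
     (\<forall>\<psi>\<in>torus_test. \<forall>\<theta>\<in>torus_test. u (\<lambda>x. \<psi> x + \<theta> x) = u \<psi> + u \<theta>) \<and>
     (\<forall>c. \<forall>\<psi>\<in>torus_test. u (\<lambda>x. c * \<psi> x) = c * u \<psi>) \<and>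
     (\<exists>C k. \<forall>\<psi>\<in>torus_test. norm (u \<psi>) \<le> C * Ck_norm k \<psi>) \<and>
     (\<forall>\<psi>. \<psi> \<notin> torus_test \<longrightarrow> u \<psi> = 0)}"

definition freq :: "int^'n::finite \<Rightarrow> real^'n" where
  "freq \<xi> = (\<chi> j. real_of_int (\<xi> $ j))"

text \<open>With this normalization a function \<open>h\<close> is identified with the functional
  \<open>\<psi> \<mapsto> (2\<pi>)\<^sup>-\<^sup>N \<integral> h \<psi>\<close>, so that \<open>u\<close> is the sum of its Fourier series.\<close>

definition fourier :: "'n::finite functional \<Rightarrow> int^'n \<Rightarrow> complex" where
  "fourier u \<xi> = u (\<lambda>x. exp (- \<i> * complex_of_real (x \<bullet> freq \<xi>)))"

definition sobolev :: "real \<Rightarrow> 'n::finite functional set" where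
  "sobolev r = {u \<in> distributions.
     (\<lambda>\<xi>. (norm (fourier u \<xi>))\<^sup>2 * (1 + norm (freq \<xi>)) powr (2 * r)) summable_on UNIV}"

definition sobolev_norm :: "real \<Rightarrow> 'n::finite functional \<Rightarrow> real" where
  "sobolev_norm r u =
     sqrt (\<Sum>\<^sub>\<infinity>\<xi>. (norm (fourier u \<xi>))\<^sup>2 * (1 + norm (freq \<xi>)) powr (2 * r))"

text \<open>\<open>C([0,T];H\<^sup>r)\<close>; values outside \<open>[0,T]\<close> are irrelevant.\<close>

definition C_sobolev :: "real \<Rightarrow> real \<Rightarrow> (real \<Rightarrow> 'n::finite functional) set" where
  "C_sobolev T r = {u. (\<forall>t\<in>{0..T}. u t \<in> sobolev r) \<and>
     (\<forall>t\<in>{0..T}. ((\<lambda>s. sobolev_norm r (\<lambda>\<psi>. u s \<psi> - u t \<psi>)) \<longlongrightarrow> 0) (at t within {0..T}))}"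

section \<open>The Cauchy problem\<close>

definition dist_deriv :: "'n::finite \<Rightarrow> 'n functional \<Rightarrow> 'n functional" where
  "dist_deriv j u \<psi> = (if \<psi> \<in> torus_test then - u (dir_deriv (axis j 1) \<psi>) else 0)"

definition dist_D :: "'n::finite \<Rightarrow> 'n functional \<Rightarrow> 'n functional" where
  "dist_D j u \<psi> = (1 / \<i>) * dist_deriv j u \<psi>"

definition dist_laplace :: "'n::finite functional \<Rightarrow> 'n functional" where
  "dist_laplace u \<psi> = (\<Sum>j\<in>UNIV. dist_deriv j (dist_deriv j u) \<psi>)"

definition spatial_op ::
  "(real \<Rightarrow> complex) \<Rightarrow> ('n::finite \<Rightarrow> real \<Rightarrow> complex) \<Rightarrow> (real \<Rightarrow> complex)
    \<Rightarrow> (real \<Rightarrow> 'n functional) \<Rightarrow> real \<Rightarrow> 'n functional" where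
  "spatial_op a2 a1 a0 u t \<psi> =
     - a2 t * dist_laplace (u t) \<psi> + (\<Sum>j\<in>UNIV. a1 j t * dist_D j (u t) \<psi>) + a0 t * u t \<psi>"

text \<open>Distributions on \<open>(0,T)\<close> with values in the distributions on the torus are maps sending
  \<open>\<phi>\<close> in \<open>C\<^sub>c\<^sup>\<infinity>((0,T))\<close> to a functional. The integral over \<open>[0,T]\<close> of a
  distribution-valued function is taken by testing with \<open>\<psi>\<close>; for integrands continuous into some
  \<open>H\<^sup>\<rho>\<close> this is the \<open>H\<^sup>\<rho>\<close>-valued Riemann integral.\<close>

definition time_dist :: "real \<Rightarrow> (real \<Rightarrow> 'n::finite functional) \<Rightarrow> (real \<Rightarrow> complex) \<Rightarrow> 'n functional" where
  "time_dist T U \<phi> \<psi> = integral {0..T} (\<lambda>t. U t \<psi> * \<phi> t)"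

definition weak_Dt :: "real \<Rightarrow> (real \<Rightarrow> 'n::finite functional) \<Rightarrow> (real \<Rightarrow> complex) \<Rightarrow> 'n functional" where
  "weak_Dt T u \<phi> = time_dist T u (\<lambda>t. - ((1 / \<i>) * dir_deriv 1 \<phi> t))"

definition P_op ::
  "real \<Rightarrow> (real \<Rightarrow> complex) \<Rightarrow> ('n::finite \<Rightarrow> real \<Rightarrow> complex) \<Rightarrow> (real \<Rightarrow> complex)
    \<Rightarrow> (real \<Rightarrow> 'n functional) \<Rightarrow> (real \<Rightarrow> complex) \<Rightarrow> 'n functional" where
  "P_op T a2 a1 a0 u \<phi> \<psi> = weak_Dt T u \<phi> \<psi> + time_dist T (spatial_op a2 a1 a0 u) \<phi> \<psi>"

definition solves_Cauchy ::
  "real \<Rightarrow> (real \<Rightarrow> complex) \<Rightarrow> ('n::finite \<Rightarrow> real \<Rightarrow> complex) \<Rightarrow> (real \<Rightarrow> complex)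
    \<Rightarrow> (real \<Rightarrow> 'n functional) \<Rightarrow> 'n functional \<Rightarrow> (real \<Rightarrow> 'n functional) \<Rightarrow> bool" where
  "solves_Cauchy T a2 a1 a0 f g u \<longleftrightarrow>
     (\<exists>\<rho>. u \<in> C_sobolev T \<rho>) \<and> u 0 = g \<and>
     (\<forall>\<phi>\<in>time_test T. P_op T a2 a1 a0 u \<phi> = time_dist T f \<phi>)"

definition well_posed_Hr ::
  "real \<Rightarrow> (real \<Rightarrow> complex) \<Rightarrow> ('n::finite \<Rightarrow> real \<Rightarrow> complex) \<Rightarrow> (real \<Rightarrow> complex) \<Rightarrow> bool" where
  "well_posed_Hr T a2 a1 a0 \<longleftrightarrow>
     (\<forall>r. \<forall>f\<in>C_sobolev T r. \<forall>g\<in>sobolev r.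
        \<exists>u\<in>C_sobolev T r. solves_Cauchy T a2 a1 a0 f g u \<and>
          (\<forall>v\<in>C_sobolev T r. solves_Cauchy T a2 a1 a0 f g v \<longrightarrow> (\<forall>t\<in>{0..T}. v t = u t)))"

end

theory Submission
  imports Defs
begin

text \<open>The Fourier transform in \<open>x\<close> turns \<open>P u = f\<close> into the scalar equations
  \<open>D\<^sub>t v + \<mu>\<^sub>\<xi> v = f\<^sub>\<xi>\<close> with \<open>\<mu>\<^sub>\<xi> = a\<^sub>2 \<bar>\<xi>\<bar>\<^sup>2 + \<Sum>j. a\<^sub>1\<^sub>,\<^sub>j \<xi>\<^sub>j + a\<^sub>0\<close>. The sign conditions make \<open>Im \<mu>\<^sub>\<xi>\<close> bounded
  above uniformly in \<open>\<xi>\<close>, so the variation-of-constants solutions obey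
  \<open>\<bar>v(t)\<bar> \<le> C (\<bar>g\<^sub>\<xi>\<bar> + \<integral> \<bar>f\<^sub>\<xi>\<bar>)\<close> with \<open>C\<close> independent of \<open>\<xi>\<close>. By Cauchy-Schwarz in time this is a summable majorant of the
  \<open>H\<^sup>r\<close> series, uniform in \<open>t\<close>, which gives both membership in \<open>H\<^sup>r\<close> and continuity in \<open>t\<close>. Conversely every
  distribution is the sum of its Fourier series, because the Fourier series of a test function
  converges in every \<open>C\<^sup>k\<close>, and a weak solution has classical Fourier coefficients by the lemma of
  du Bois-Reymond, so uniqueness reduces to that of the scalar equations.\<close>

section \<open>Smooth functions\<close>

text \<open>The equation is tested with every \<psi>, whereas the scalar equations only see the
  characters. \<open>solves_iff\<close> bridges this gap once, and existence and uniqueness both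
  rest on it. Passing from characters to all \<psi> costs two orders of growth in \<xi>, from the
  Laplacian, which is harmless because the Fourier coefficients of a test function decay faster than
  any power. The estimate of the solution avoids the size of \<open>mu\<close> altogether: from v' =
  -i mu v + i f only Re (-i mu) = Im mu enters the exponential. An imaginary part of a first order
  coefficient would add a term linear in \<xi> of either sign, hence the assumption that it
  vanishes. That the Fourier series of \<psi> sums to \<psi> and not to another function rests on
  the uniqueness of Fourier coefficients of continuous periodic functions, proved with peaking
  kernels. Smoothness speaks of all iterated partial derivatives. For concrete functions it is
  obtained from a class of differentiable functions closed under differentiation, never from a
  formula for the iterated derivatives.\<close>

lemma dir_deriv_eq:
  assumes "(f has_derivative D) (at x)"
  shows "dir_deriv e f x = D e"
  using frechet_derivative_at[OF assms] by (simp add: dir_deriv_def)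

lemma has_derivative_frechet:
  assumes "f differentiable (at x)"
  shows "(f has_derivative (\<lambda>e. dir_deriv e f x)) (at x)"
  using assms by (simp add: dir_deriv_def[abs_def] frechet_derivative_works)

text \<open>The smooth functions are the largest class of differentiable functions stable under
  partial derivatives, so an invariant class \<open>S\<close> replaces any computation of iterated
  derivatives.\<close>

lemma smooth_coinduct:
  assumes "f \<in> S"
    and diff: "\<And>f x. f \<in> S \<Longrightarrow> f differentiable (at x)"
    and deriv: "\<And>f e. f \<in> S \<Longrightarrow> e \<in> Basis \<Longrightarrow> dir_deriv e f \<in> S"
  shows "smooth f"
proof -
  have "foldr dir_deriv es f \<in> S" if "set es \<subseteq> Basis" for es
    using that by (induction es) (auto simp: assms(1) deriv)
  then show ?thesis
    unfolding smooth_def using diff by blast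
qed

lemma smooth_imp_differentiable: "smooth f \<Longrightarrow> f differentiable (at x)"
  unfolding smooth_def by (metis empty_subsetI foldr.simps(1) id_apply list.set(1))

lemma smooth_imp_continuous_on: "smooth f \<Longrightarrow> continuous_on A f"
  by (meson differentiable_at_imp_differentiable_on differentiable_imp_continuous_on smooth_imp_differentiable)

lemma smooth_dir_deriv:
  assumes "smooth f" "e \<in> Basis"
  shows "smooth (dir_deriv e f)"
  unfolding smooth_def
proof (intro allI impI)
  fix es x assume "set es \<subseteq> (Basis :: 'a set)"
  \<comment> \<open>\<open>foldr\<close> applies the last entry of the list first, so the additional
    derivative is appended at the end.\<close>
  then have "foldr dir_deriv (es @ [e]) f differentiable (at x)"
    using assms unfolding smooth_def by (metis Un_subset_iff empty_set insert_subset list.simps(15) set_append bot.extremum)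
  then show "foldr dir_deriv es (dir_deriv e f) differentiable (at x)"
    by simp
qed

lemma smooth_foldr_dir_deriv:
  assumes "smooth f" "set es \<subseteq> Basis"
  shows "smooth (foldr dir_deriv es f)"
  using assms(2) by (induction es) (auto simp: assms(1) smooth_dir_deriv)

lemma dir_deriv_add:
  assumes "f differentiable (at x)" "g differentiable (at x)"
  shows "dir_deriv e (\<lambda>x. f x + g x) x = dir_deriv e f x + dir_deriv e g x"
  by (rule dir_deriv_eq) (intro derivative_intros has_derivative_frechet assms)

lemma dir_deriv_cmult:
  assumes "f differentiable (at x)"
  shows "dir_deriv e (\<lambda>x. c * f x) x = c * dir_deriv e f x"
  using dir_deriv_eq[OF has_derivative_mult[OF has_derivative_const has_derivative_frechet[OF assms]]]
  by simp

lemma dir_deriv_mult: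
  assumes "f differentiable (at x)" "g differentiable (at x)"
  shows "dir_deriv e (\<lambda>x. f x * g x) x = f x * dir_deriv e g x + dir_deriv e f x * g x"
  by (rule dir_deriv_eq) (intro has_derivative_mult has_derivative_frechet assms)

text \<open>The product rule leaves the set of products of smooth functions, but not the set of sums of
  such products, to which coinduction applies.\<close>

inductive_set product_sums :: "('a::euclidean_space \<Rightarrow> complex) set" where
  prod: "smooth f \<Longrightarrow> smooth g \<Longrightarrow> (\<lambda>x. f x * g x) \<in> product_sums"
| add: "p \<in> product_sums \<Longrightarrow> q \<in> product_sums \<Longrightarrow> (\<lambda>x. p x + q x) \<in> product_sums"

lemma smooth_product_sums:
  assumes "f \<in> product_sums"
  shows "smooth f"
proof (rule smooth_coinduct[OF assms])
  show diff: "f differentiable (at x)" if "f \<in> product_sums" for f :: "'a \<Rightarrow> complex" and x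
    using that
    by induction (simp_all add: smooth_imp_differentiable)
  show "dir_deriv e f \<in> product_sums" if "f \<in> product_sums" "e \<in> Basis" for f :: "'a \<Rightarrow> complex" and e
    using that
  proof induction
    case (prod f g)
    then have "dir_deriv e (\<lambda>x. f x * g x) = (\<lambda>x. f x * dir_deriv e g x + dir_deriv e f x * g x)"
      by (simp add: fun_eq_iff dir_deriv_mult smooth_imp_differentiable)
    then show ?case
      using prod by (simp add: product_sums.intros smooth_dir_deriv)
  next
    case (add p q)
    then have "dir_deriv e (\<lambda>x. p x + q x) = (\<lambda>x. dir_deriv e p x + dir_deriv e q x)"
      by (simp add: fun_eq_iff dir_deriv_add diff)
    then show ?case
      using add by (simp add: product_sums.intros)
  qed
qed

lemma smooth_mult: "smooth f \<Longrightarrow> smooth g \<Longrightarrow> smooth (\<lambda>x. f x * g x)"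
  by (rule smooth_product_sums, rule product_sums.prod)

lemma dir_deriv_const [simp]: "dir_deriv e (\<lambda>x. c) = (\<lambda>x. 0)"
  by (simp add: fun_eq_iff dir_deriv_eq[OF has_derivative_const])

lemma smooth_const: "smooth (\<lambda>x. c)"
  by (rule smooth_coinduct[where S = "range (\<lambda>c x. c)"]) auto

lemma smooth_cmult: "smooth f \<Longrightarrow> smooth (\<lambda>x. c * f x)"
  by (intro smooth_mult smooth_const)

lemma smooth_add:
  assumes "smooth f" "smooth g"
  shows "smooth (\<lambda>x. f x + g x)"
  \<comment> \<open>Each summand becomes a product with the constant 1, and the sum is then a member
    of \<open>product_sums\<close>.\<close>
  using smooth_product_sums[OF product_sums.add[OF product_sums.prod[OF assms(1) smooth_const]
      product_sums.prod[OF assms(2) smooth_const]], of 1 1]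
  by simp

lemma smooth_sum: "(\<And>i. i \<in> I \<Longrightarrow> smooth (f i)) \<Longrightarrow> smooth (\<lambda>x. \<Sum>i\<in>I. f i x)"
  by (induction I rule: infinite_finite_induct) (simp_all add: smooth_const smooth_add)

lemma foldr_dir_deriv_add:
  assumes "smooth f" "smooth g" "set es \<subseteq> Basis"
  shows "foldr dir_deriv es (\<lambda>x. f x + g x) = (\<lambda>x. foldr dir_deriv es f x + foldr dir_deriv es g x)"
  using assms(3)
proof (induction es)
  case (Cons e es)
  then have "foldr dir_deriv es (\<lambda>x. f x + g x) = (\<lambda>x. foldr dir_deriv es f x + foldr dir_deriv es g x)"
    by simp
  with Cons.prems show ?case
    by (simp add: dir_deriv_add assms smooth_imp_differentiable smooth_foldr_dir_deriv fun_eq_iff[of "dir_deriv e _"])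
qed simp

lemma foldr_dir_deriv_cmult:
  assumes "smooth f" "set es \<subseteq> Basis"
  shows "foldr dir_deriv es (\<lambda>x. c * f x) = (\<lambda>x. c * foldr dir_deriv es f x)"
  using assms(2)
proof (induction es)
  case (Cons e es)
  then have "foldr dir_deriv es (\<lambda>x. c * f x) = (\<lambda>x. c * foldr dir_deriv es f x)"
    by simp
  with Cons.prems show ?case
    by (simp add: dir_deriv_cmult assms smooth_imp_differentiable smooth_foldr_dir_deriv fun_eq_iff[of "dir_deriv e _"])
qed simp

lemma foldr_dir_deriv_zero: "foldr dir_deriv es (\<lambda>x. 0) = (\<lambda>x. 0)"
  by (induction es) auto

lemma foldr_dir_deriv_sum:
  assumes "\<And>i. i \<in> I \<Longrightarrow> smooth (f i)" "set es \<subseteq> Basis"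
  shows "foldr dir_deriv es (\<lambda>x. \<Sum>i\<in>I. f i x) = (\<lambda>x. \<Sum>i\<in>I. foldr dir_deriv es (f i) x)"
  using assms(1)
  by (induction I rule: infinite_finite_induct)
    (simp_all add: foldr_dir_deriv_zero foldr_dir_deriv_add smooth_sum assms(2))

section \<open>Test functions on the torus\<close>

lemma torus_testD: "\<psi> \<in> torus_test \<Longrightarrow> smooth \<psi>"
  by (simp add: torus_test_def)

lemma torus_test_periodic: "\<psi> \<in> torus_test \<Longrightarrow> \<psi> (x + axis j (2 * pi)) = \<psi> x"
  by (simp add: torus_test_def)

lemma torus_test_add: "\<psi> \<in> torus_test \<Longrightarrow> \<theta> \<in> torus_test \<Longrightarrow> (\<lambda>x. \<psi> x + \<theta> x) \<in> torus_test"
  by (simp add: torus_test_def smooth_add)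

lemma torus_test_mult: "\<psi> \<in> torus_test \<Longrightarrow> \<theta> \<in> torus_test \<Longrightarrow> (\<lambda>x. \<psi> x * \<theta> x) \<in> torus_test"
  by (simp add: torus_test_def smooth_mult)

lemma torus_test_cmult: "\<psi> \<in> torus_test \<Longrightarrow> (\<lambda>x. c * \<psi> x) \<in> torus_test"
  by (simp add: torus_test_def smooth_cmult)

lemma torus_test_sum:
  "(\<And>i. i \<in> I \<Longrightarrow> f i \<in> torus_test) \<Longrightarrow> (\<lambda>x. \<Sum>i\<in>I. f i x) \<in> torus_test"
  by (simp add: torus_test_def smooth_sum)

lemma torus_test_dir_deriv:
  assumes "\<psi> \<in> torus_test" "e \<in> Basis"
  shows "dir_deriv e \<psi> \<in> torus_test"
proof -
  have "dir_deriv e \<psi> (x + axis j (2 * pi)) = dir_deriv e \<psi> x" for x j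
  proof -
    have "(\<psi> has_derivative (\<lambda>e. dir_deriv e \<psi> (x + axis j (2 * pi)))) (at (x + axis j (2 * pi)))"
      by (intro has_derivative_frechet smooth_imp_differentiable torus_testD assms)
    then have "((\<lambda>x. \<psi> (x + axis j (2 * pi))) has_derivative (\<lambda>e. dir_deriv e \<psi> (x + axis j (2 * pi)))) (at x)"
      by (rule has_derivative_compose[OF has_derivative_add_const[OF has_derivative_ident]])
    \<comment> \<open>By periodicity the translated function is \<psi> itself, so its derivative at
      the shifted point is also a derivative of \<psi> at \<open>x\<close>.\<close>
    then have "(\<psi> has_derivative (\<lambda>e. dir_deriv e \<psi> (x + axis j (2 * pi)))) (at x)"
      unfolding torus_test_periodic[OF assms(1)] .
    from dir_deriv_eq[OF this] show ?thesis by simp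
  qed
  then show ?thesis
    using assms by (simp add: torus_test_def smooth_dir_deriv)
qed

lemma torus_test_foldr_dir_deriv:
  "\<psi> \<in> torus_test \<Longrightarrow> set es \<subseteq> Basis \<Longrightarrow> foldr dir_deriv es \<psi> \<in> torus_test"
  by (induction es) (auto simp: torus_test_dir_deriv)

text \<open>The sign in the exponent is the one of \<open>fourier\<close>, so that a Fourier
  coefficient of a distribution is its value at a character. Test functions are expanded in this
  same family.\<close>

definition character :: "int^'n::finite \<Rightarrow> real^'n \<Rightarrow> complex" where
  "character \<xi> x = exp (- \<i> * complex_of_real (x \<bullet> freq \<xi>))"

lemma character_0 [simp]: "character 0 x = 1"
  by (simp add: character_def freq_def inner_vec_def)

lemma freq_nth [simp]: "freq \<xi> $ j = real_of_int (\<xi> $ j)"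
  by (simp add: freq_def)

lemma freq_add: "freq (\<xi> + \<eta>) = freq \<xi> + freq \<eta>"
  by (simp add: freq_def vec_eq_iff)

lemma freq_uminus: "freq (- \<xi>) = - freq \<xi>"
  by (simp add: freq_def vec_eq_iff)

lemma character_add: "character (\<xi> + \<eta>) x = character \<xi> x * character \<eta> x"
  by (simp add: character_def freq_add inner_add_right algebra_simps exp_add[symmetric])

lemma norm_character [simp]: "norm (character \<xi> x) = 1"
  by (simp add: character_def)

lemma has_derivative_character:
  "(character \<xi> has_derivative (\<lambda>e. - \<i> * complex_of_real (e \<bullet> freq \<xi>) * character \<xi> x)) (at x)"
proof -
  have "((\<lambda>x. - \<i> * complex_of_real (x \<bullet> freq \<xi>)) has_derivative
      (\<lambda>e. - \<i> * complex_of_real (e \<bullet> freq \<xi>))) (at x)"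
    by (auto intro!: derivative_eq_intros)
  from has_derivative_compose[OF this DERIV_exp[unfolded has_field_derivative_def]]
  show ?thesis
    by (simp add: character_def[abs_def] mult_ac)
qed

lemma dir_deriv_character:
  "dir_deriv e (character \<xi>) = (\<lambda>x. - \<i> * complex_of_real (e \<bullet> freq \<xi>) * character \<xi> x)"
  by (simp add: fun_eq_iff dir_deriv_eq[OF has_derivative_character])

lemma smooth_character: "smooth (character \<xi>)"
proof (rule smooth_coinduct[where S = "range (\<lambda>c x. c * character \<xi> x)"])
  show "character \<xi> \<in> range (\<lambda>c x. c * character \<xi> x)"
    by (rule image_eqI[of _ _ 1]) auto
  have diff: "character \<xi> differentiable (at x)" for x
    using has_derivative_character differentiable_def by blast
  show "f differentiable (at x)" if "f \<in> range (\<lambda>c x. c * character \<xi> x)" for f x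
    using that diff by auto
  show "dir_deriv e f \<in> range (\<lambda>c x. c * character \<xi> x)"
    if "f \<in> range (\<lambda>c x. c * character \<xi> x)" for f e
  proof -
    obtain c where "f = (\<lambda>x. c * character \<xi> x)"
      using \<open>f \<in> _\<close> by auto
    have "dir_deriv e f = (\<lambda>x. c * (- \<i> * complex_of_real (e \<bullet> freq \<xi>)) * character \<xi> x)"
      unfolding \<open>f = _\<close> by (simp add: fun_eq_iff dir_deriv_cmult[OF diff] dir_deriv_character)
    then show ?thesis by blast
  qed
qed

lemma character_periodic: "character \<xi> (x + axis j (2 * pi)) = character \<xi> x"
proof -
  have "exp (complex_of_real (2 * (- real_of_int (\<xi> $ j)) * pi) * \<i>) = 1"
    by (rule exp_integer_2pi) simp
  moreover have "- \<i> * complex_of_real ((x + axis j (2 * pi)) \<bullet> freq \<xi>) =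
      - \<i> * complex_of_real (x \<bullet> freq \<xi>) + complex_of_real (2 * (- real_of_int (\<xi> $ j)) * pi) * \<i>"
    by (simp add: inner_add_left inner_axis' algebra_simps)
  ultimately show ?thesis
    by (simp only: character_def exp_add mult_1_right)
qed

lemma character_in_torus_test: "character \<xi> \<in> torus_test"
  by (simp add: torus_test_def smooth_character character_periodic)

lemma fourier_eq: "fourier u \<xi> = u (character \<xi>)"
  by (simp add: fourier_def character_def[abs_def])

section \<open>Periodic functions and their mean over the torus\<close>

definition periodic :: "(real^'n \<Rightarrow> complex) \<Rightarrow> bool" where
  "periodic f \<longleftrightarrow> (\<forall>x j. f (x + axis j (2 * pi)) = f x)"

lemma periodic_axis_int:
  assumes "periodic f"
  shows "f (x + axis j (2 * pi * real_of_int m)) = f x"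
proof -
  have nat: "f (x + axis j (2 * pi * real n)) = f x" for n x
  proof (induction n)
    case (Suc n)
    have "f (x + axis j (2 * pi * real (Suc n))) = f ((x + axis j (2 * pi * real n)) + axis j (2 * pi))"
      by (rule arg_cong[where f = f]) (simp add: vec_eq_iff axis_def algebra_simps)
    also have "\<dots> = f x"
      using assms Suc by (simp add: periodic_def)
    finally show ?case .
  qed (simp add: axis_def zero_vec_def[symmetric])
  show ?thesis
  proof (cases m)
    case (neg n)
    have "f (x + axis j (2 * pi * real_of_int m)) =
        f ((x + axis j (2 * pi * real_of_int m)) + axis j (2 * pi * real (Suc n)))"
      by (rule nat[symmetric])
    also have "real_of_int m = - real (Suc n)"
      using neg by simp
    then have "x + axis j (2 * pi * real_of_int m) + axis j (2 * pi * real (Suc n)) = x"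
      by (simp add: vec_eq_iff axis_def flip: distrib_left)
    finally show ?thesis .
  qed (simp add: nat)
qed

text \<open>The floor of each x_j / (2 pi) counts the periods to be removed. Compactness of the
  closed cell then controls periodic functions on the whole space.\<close>

lemma periodic_reduce:
  fixes f :: "real^'n::finite \<Rightarrow> complex"
  assumes "periodic f"
  obtains y where "y \<in> cbox 0 (\<chi> j. 2 * pi)" "f y = f x"
proof
  define m :: "'n \<Rightarrow> int" where "m j = - \<lfloor>x $ j / (2 * pi)\<rfloor>" for j
  define y where "y = x + (\<Sum>j\<in>UNIV. axis j (2 * pi * real_of_int (m j)))"
  have "f (x + (\<Sum>j\<in>J. axis j (2 * pi * real_of_int (m j)))) = f x" if "finite J" for J
    using that
  proof induction
    case (insert i J)
    then show ?case
      using periodic_axis_int[OF assms, of "x + (\<Sum>j\<in>J. axis j (2 * pi * real_of_int (m j)))" i "m i"]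
      by (simp add: algebra_simps)
  qed simp
  then show "f y = f x"
    by (simp add: y_def)
  have "y $ i = x $ i + 2 * pi * real_of_int (m i)" for i
    by (simp add: y_def axis_def sum.delta if_distrib cong: if_cong)
  moreover have "0 \<le> x $ i + 2 * pi * real_of_int (m i)" "x $ i + 2 * pi * real_of_int (m i) \<le> 2 * pi" for i
  proof -
    have "real_of_int \<lfloor>x $ i / (2 * pi)\<rfloor> * (2 * pi) \<le> x $ i"
      by (subst pos_le_divide_eq[symmetric]) simp_all
    moreover have "x $ i \<le> (real_of_int \<lfloor>x $ i / (2 * pi)\<rfloor> + 1) * (2 * pi)"
      by (subst pos_divide_le_eq[symmetric]) (simp_all add: real_of_int_floor_add_one_ge)
    ultimately show "0 \<le> x $ i + 2 * pi * real_of_int (m i)" "x $ i + 2 * pi * real_of_int (m i) \<le> 2 * pi"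
      by (simp_all add: m_def algebra_simps)
  qed
  ultimately show "y \<in> cbox 0 (\<chi> j. 2 * pi)"
    by (simp add: mem_box_cart)
qed

lemma torus_test_imp_periodic: "\<psi> \<in> torus_test \<Longrightarrow> periodic \<psi>"
  by (simp add: torus_test_def periodic_def)

lemma torus_test_continuous_on: "\<psi> \<in> torus_test \<Longrightarrow> continuous_on A \<psi>"
  by (simp add: torus_testD smooth_imp_continuous_on)

text \<open>This gives the suprema in \<open>Ck_norm\<close> their intended meaning, since a real
  supremum is informative only for sets bounded above.\<close>

lemma torus_test_bounded:
  fixes \<psi> :: "real^'n::finite \<Rightarrow> complex"
  assumes "\<psi> \<in> torus_test"
  shows "bdd_above (range (\<lambda>x. norm (\<psi> x)))"
proof -
  have "compact (\<psi> ` cbox 0 (\<chi> j. 2 * pi))"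
    by (intro compact_continuous_image torus_test_continuous_on assms compact_cbox)
  then obtain B where B: "norm (\<psi> y) \<le> B" if "y \<in> cbox 0 (\<chi> j. 2 * pi)" for y
    by (meson compact_imp_bounded bounded_iff imageI)
  have "norm (\<psi> x) \<le> B" for x
    by (metis periodic_reduce[OF torus_test_imp_periodic[OF assms], of x] B)
  then show ?thesis by (auto simp: bdd_above_def)
qed

lemma content_cell_pos: "measure lborel (cbox 0 (\<chi> j. 2 * pi) :: (real^'n::finite) set) > 0"
  by (rule content_pos_lt) (auto simp: Basis_vec_def inner_axis)

text \<open>The cell is cut at x_j = h and the shifted cell at x_j = 2 pi. They share the slab
  between h and 2 pi, with integral \<open>iB\<close>; the two remaining slabs differ by one period
  and both have integral \<open>iA\<close>.\<close>

lemma integral_shift_periodic: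
  fixes f :: "real^'n::finite \<Rightarrow> complex"
  assumes cont: "continuous_on UNIV f" and per: "periodic f" and h: "0 \<le> h" "h \<le> 2 * pi"
  shows "integral (cbox 0 (\<chi> j. 2 * pi)) (\<lambda>x. f (x + axis j h)) = integral (cbox 0 (\<chi> j. 2 * pi)) f"
proof -
  let ?b = "(\<chi> j. 2 * pi) :: real^'n" and ?c = "(\<chi> i. if i = j then h else 2 * pi) :: real^'n"
  have int: "f integrable_on cbox u v" for u v
    by (intro integrable_continuous continuous_on_subset[OF cont]) auto
  obtain iA where A: "(f has_integral iA) (cbox 0 ?c)"
    using int by blast
  obtain iB where B: "(f has_integral iB) (cbox (axis j h) ?b)"
    using int by blast
  have k: "axis j 1 \<in> (Basis :: (real^'n) set)"
    by (simp add: axis_in_Basis_iff)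
  have ip: "x \<bullet> axis j 1 = x $ j" for x :: "real^'n"
    by (simp add: inner_axis)
  have "((f \<circ> (+) (axis j (2 * pi))) has_integral iA) (cbox 0 ?c)"
    using A per by (simp add: o_def periodic_def add.commute)
  then have C: "(f has_integral iA) (cbox (axis j (2 * pi)) (?c + axis j (2 * pi)))"
    by (simp add: has_integral_shift_cbox_iff)
  have e1: "cbox 0 ?b \<inter> {x. x \<bullet> axis j 1 \<le> h} = cbox 0 ?c"
    unfolding ip using h by (auto simp: mem_box_cart; smt (verit))
  have e2: "cbox 0 ?b \<inter> {x. x \<bullet> axis j 1 \<ge> h} = cbox (axis j h) ?b"
    unfolding ip using h by (auto simp: mem_box_cart axis_def; smt (verit))
  have e3: "cbox (axis j h) (?b + axis j h) \<inter> {x. x \<bullet> axis j 1 \<le> 2 * pi} = cbox (axis j h) ?b"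
    unfolding ip using h by (auto simp: mem_box_cart axis_def; smt (verit))
  have e4: "cbox (axis j h) (?b + axis j h) \<inter> {x. x \<bullet> axis j 1 \<ge> 2 * pi} =
      cbox (axis j (2 * pi)) (?c + axis j (2 * pi))"
    unfolding ip using h by (auto simp: mem_box_cart axis_def; smt (verit))
  have "(f has_integral iA + iB) (cbox 0 ?b)"
    by (rule has_integral_split[OF _ _ k, where c = h]) (simp_all only: e1 e2 A B)
  moreover have "(f has_integral iB + iA) (cbox (axis j h) (?b + axis j h))"
    by (rule has_integral_split[OF _ _ k, where c = "2 * pi"]) (simp_all only: e3 e4 C B)
  ultimately show ?thesis
    using integral_shift_cbox[of "axis j h" "axis j h" "?b + axis j h" f]
    by (simp add: integral_unique add.commute)
qed

text \<open>Differentiation under the integral sign exhibits this integral as the derivative at h =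
  0 of the integral of the translate by h in direction j, which is constant in h by translation
  invariance. No iterated integrals are involved.\<close>

lemma integral_dir_deriv_eq_0:
  fixes \<psi> :: "real^'n::finite \<Rightarrow> complex"
  assumes "\<psi> \<in> torus_test"
  shows "integral (cbox 0 (\<chi> j. 2 * pi)) (dir_deriv (axis j 1) \<psi>) = 0"
proof -
  let ?C = "cbox 0 (\<chi> j. 2 * pi) :: (real^'n) set"
  define v where "v = (axis j 1 :: real^'n)"
  let ?d = "dir_deriv v \<psi>"
  have v: "v \<in> Basis"
    by (simp add: v_def axis_in_Basis_iff)
  have ax: "axis j h = h *\<^sub>R v" for h :: real
    by (simp add: v_def vec_eq_iff axis_def)
  have d: "((\<lambda>h. \<psi> (x + h *\<^sub>R v)) has_vector_derivative ?d (x + h *\<^sub>R v)) (at h within A)" for x h A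
  proof -
    have D: "(\<psi> has_derivative (\<lambda>e. dir_deriv e \<psi> (x + h *\<^sub>R v))) (at (x + h *\<^sub>R v))"
      by (intro has_derivative_frechet smooth_imp_differentiable torus_testD assms)
    have "((\<lambda>h. x + h *\<^sub>R v) has_derivative (\<lambda>h. h *\<^sub>R v)) (at h within A)"
      by (auto intro!: derivative_eq_intros)
    from has_derivative_compose[OF this D] show ?thesis
      unfolding has_vector_derivative_def linear_scale[OF has_derivative_linear[OF D]] .
  qed
  have cd: "continuous_on UNIV ?d"
    by (intro torus_test_continuous_on torus_test_dir_deriv assms v)
  have "((\<lambda>h. integral ?C (\<lambda>x. \<psi> (x + h *\<^sub>R v))) has_vector_derivative integral ?C (\<lambda>x. ?d (x + 0 *\<^sub>R v)))
      (at 0 within {0..2 * pi})"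
  proof (rule leibniz_rule_vector_derivative[where fx = "\<lambda>h x. ?d (x + h *\<^sub>R v)"])
    show "(\<lambda>x. \<psi> (x + h *\<^sub>R v)) integrable_on ?C" for h
      by (intro integrable_continuous continuous_on_compose2[OF torus_test_continuous_on[OF assms]]
          continuous_intros) auto
    show "continuous_on ({0..2 * pi} \<times> ?C) (\<lambda>(h, x). ?d (x + h *\<^sub>R v))"
      unfolding split_beta
      by (intro continuous_on_compose2[OF cd] continuous_intros) auto
  qed (auto intro: d)
  moreover have "((\<lambda>h. integral ?C (\<lambda>x. \<psi> (x + h *\<^sub>R v))) has_vector_derivative 0) (at 0 within {0..2 * pi})"
  proof (rule has_vector_derivative_transform[OF _ _ has_vector_derivative_const])
    show "integral ?C (\<lambda>x. \<psi> (x + h *\<^sub>R v)) = integral ?C \<psi>" if "h \<in> {0..2 * pi}" for h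
      unfolding ax[symmetric] using that
      by (intro integral_shift_periodic torus_test_continuous_on torus_test_imp_periodic assms) auto
  qed simp
  \<comment> \<open>Translation invariance is available for h between 0 and 2 pi, so the derivative
    at 0 is one-sided; a nontrivial filter still makes it unique.\<close>
  moreover have "at 0 within {0..2 * pi} \<noteq> bot"
    by (simp add: at_within_Icc_at_right)
  ultimately have "integral ?C (\<lambda>x. ?d (x + 0 *\<^sub>R v)) = 0"
    using vector_derivative_unique_within by blast
  then show ?thesis
    by (simp add: v_def)
qed

text \<open>At a nonzero frequency the character is a nonzero multiple of one of its own partial
  derivatives, whose integral vanishes.\<close>

lemma integral_character:
  fixes \<xi> :: "int^'n::finite"
  shows "integral (cbox 0 (\<chi> j. 2 * pi)) (character \<xi>) =
    (if \<xi> = 0 then of_real (measure lborel (cbox 0 (\<chi> j. 2 * pi) :: (real^'n) set)) else 0)"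
proof (cases "\<xi> = 0")
  case True
  then have "character \<xi> = (\<lambda>x. 1)" by auto
  then show ?thesis using True by (simp add: scaleR_conv_of_real)
next
  case False
  then obtain j where j: "\<xi> $ j \<noteq> 0" by (auto simp: vec_eq_iff)
  have "integral (cbox 0 (\<chi> j. 2 * pi)) (dir_deriv (axis j 1) (character \<xi>)) = 0"
    by (intro integral_dir_deriv_eq_0 character_in_torus_test)
  then show ?thesis
    using j False by (simp add: dir_deriv_character inner_axis')
qed

text \<open>This is the coefficient of \<open>character \<xi>\<close> in the expansion of \<psi>,
  that is, the usual Fourier coefficient at the frequency -\<xi>. Equivalently it is the pairing of
  e^{ix\<xi>} with \<psi>, so that \<open>u \<psi>\<close> becomes the sum of
  \<open>fcoeff \<xi> \<psi> * fourier u \<xi>\<close> without a reflection of \<xi>.\<close>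

definition fcoeff :: "int^'n::finite \<Rightarrow> (real^'n \<Rightarrow> complex) \<Rightarrow> complex" where
  "fcoeff \<xi> \<psi> = integral (cbox 0 (\<chi> j. 2 * pi)) (\<lambda>x. \<psi> x * character (- \<xi>) x) /
     of_real (measure lborel (cbox 0 (\<chi> j. 2 * pi) :: (real^'n) set))"

lemma continuous_on_character [continuous_intros]:
  "continuous_on A g \<Longrightarrow> continuous_on A (\<lambda>x. character \<xi> (g x))"
  unfolding character_def by (intro continuous_intros)

lemma fcoeff_integrable:
  assumes "continuous_on UNIV \<psi>"
  shows "(\<lambda>x. \<psi> x * character \<xi> x) integrable_on cbox a b"
  by (intro integrable_continuous continuous_intros continuous_on_subset[OF assms]) auto

lemma fcoeff_add:
  assumes "continuous_on UNIV \<psi>" "continuous_on UNIV \<theta>"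
  shows "fcoeff \<xi> (\<lambda>x. \<psi> x + \<theta> x) = fcoeff \<xi> \<psi> + fcoeff \<xi> \<theta>"
  by (simp add: fcoeff_def distrib_right integral_add fcoeff_integrable assms add_divide_distrib)

lemma fcoeff_cmult: "fcoeff \<xi> (\<lambda>x. c * \<psi> x) = c * fcoeff \<xi> \<psi>"
  by (simp add: fcoeff_def mult.assoc)

lemma norm_fcoeff_le:
  fixes \<psi> :: "real^'n::finite \<Rightarrow> complex"
  assumes "continuous_on UNIV \<psi>" "\<And>x. norm (\<psi> x) \<le> B"
  shows "norm (fcoeff \<xi> \<psi>) \<le> B"
proof -
  let ?C = "cbox 0 (\<chi> j. 2 * pi) :: (real^'n) set"
  have "norm (integral ?C (\<lambda>x. \<psi> x * character (- \<xi>) x)) \<le> B * measure lborel ?C"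
  proof (rule has_integral_bound[OF _ integrable_integral[OF fcoeff_integrable[OF assms(1)]]])
    show "0 \<le> B" using assms(2)[of 0] norm_ge_zero order_trans by blast
  qed (simp add: norm_mult assms(2))
  then show ?thesis
    using content_cell_pos[where 'n='n] by (simp add: fcoeff_def norm_divide field_simps)
qed

text \<open>Integration by parts: the derivative of the periodic product of \<psi> and
  \<open>character (- \<xi>)\<close> has integral zero.\<close>

lemma fcoeff_dir_deriv:
  assumes "\<psi> \<in> torus_test" "e \<in> Basis"
  shows "fcoeff \<xi> (dir_deriv e \<psi>) = - \<i> * complex_of_real (e \<bullet> freq \<xi>) * fcoeff \<xi> \<psi>"
proof -
  obtain j where e: "e = axis j 1"
    using assms(2) by (auto simp: Basis_vec_def)
  have dm: "dir_deriv e (\<lambda>x. \<psi> x * character (- \<xi>) x) =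
      (\<lambda>x. \<i> * complex_of_real (e \<bullet> freq \<xi>) * (\<psi> x * character (- \<xi>) x) + dir_deriv e \<psi> x * character (- \<xi>) x)"
    using assms(1)
    by (simp add: fun_eq_iff dir_deriv_mult smooth_imp_differentiable torus_testD character_in_torus_test
        dir_deriv_character freq_uminus)
  have "integral (cbox 0 (\<chi> j. 2 * pi)) (dir_deriv e (\<lambda>x. \<psi> x * character (- \<xi>) x)) = 0"
    unfolding e by (intro integral_dir_deriv_eq_0 torus_test_mult character_in_torus_test assms)
  then have "\<i> * complex_of_real (e \<bullet> freq \<xi>) * integral (cbox 0 (\<chi> j. 2 * pi)) (\<lambda>x. \<psi> x * character (- \<xi>) x) +
      integral (cbox 0 (\<chi> j. 2 * pi)) (\<lambda>x. dir_deriv e \<psi> x * character (- \<xi>) x) = 0"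
    unfolding dm
    by (subst (asm) integral_add)
      (auto intro!: integrable_on_mult_right fcoeff_integrable torus_test_continuous_on torus_test_dir_deriv assms)
  then have "integral (cbox 0 (\<chi> j. 2 * pi)) (\<lambda>x. dir_deriv e \<psi> x * character (- \<xi>) x) =
      - (\<i> * complex_of_real (e \<bullet> freq \<xi>) * integral (cbox 0 (\<chi> j. 2 * pi)) (\<lambda>x. \<psi> x * character (- \<xi>) x))"
    by (simp add: eq_neg_iff_add_eq_0 add.commute)
  then show ?thesis
    by (simp add: fcoeff_def)
qed

lemma fcoeff_character:
  fixes \<xi> \<eta> :: "int^'n::finite"
  shows "fcoeff \<xi> (character \<eta>) = (if \<xi> = \<eta> then 1 else 0)"
  using content_cell_pos[where 'n='n] integral_character[of "\<eta> - \<xi>"]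
  by (auto simp: fcoeff_def character_add[symmetric] scaleR_conv_of_real)

definition symbol :: "(real^'n::finite) list \<Rightarrow> int^'n \<Rightarrow> complex" where
  "symbol es \<xi> = prod_list (map (\<lambda>e. - \<i> * complex_of_real (e \<bullet> freq \<xi>)) es)"

lemma fcoeff_foldr_dir_deriv:
  assumes "\<psi> \<in> torus_test" "set es \<subseteq> Basis"
  shows "fcoeff \<xi> (foldr dir_deriv es \<psi>) = symbol es \<xi> * fcoeff \<xi> \<psi>"
  using assms(2)
  by (induction es) (simp_all add: symbol_def fcoeff_dir_deriv torus_test_foldr_dir_deriv assms(1))

lemma foldr_dir_deriv_character:
  assumes "set es \<subseteq> Basis"
  shows "foldr dir_deriv es (character \<xi>) = (\<lambda>x. symbol es \<xi> * character \<xi> x)"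
  using assms
proof (induction es)
  case (Cons e es)
  then have "foldr dir_deriv es (character \<xi>) = (\<lambda>x. symbol es \<xi> * character \<xi> x)"
    by simp
  then show ?case
    by (simp add: symbol_def fun_eq_iff[of "dir_deriv _ _"] dir_deriv_cmult dir_deriv_character
        smooth_imp_differentiable smooth_character) (simp add: mult_ac)
qed (simp add: symbol_def)

section \<open>Decay of Fourier coefficients\<close>

lemma finite_multi_indices: "finite {es. set es \<subseteq> (Basis :: 'a::euclidean_space set) \<and> length es \<le> k}"
  by (rule finite_lists_length_le) simp

lemma SUP_norm_nonneg:
  fixes \<psi> :: "real^'n::finite \<Rightarrow> complex"
  assumes "\<psi> \<in> torus_test"
  shows "0 \<le> (SUP x. norm (\<psi> x))"
  by (rule cSUP_upper2[OF torus_test_bounded[OF assms] UNIV_I]) simp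

lemma norm_le_Ck_norm:
  assumes "\<psi> \<in> torus_test" "set es \<subseteq> Basis" "length es \<le> k"
  shows "norm (foldr dir_deriv es \<psi> x) \<le> Ck_norm k \<psi>"
proof -
  have "norm (foldr dir_deriv es \<psi> x) \<le> (SUP x. norm (foldr dir_deriv es \<psi> x))"
    by (intro cSUP_upper torus_test_bounded torus_test_foldr_dir_deriv assms) auto
  also have "\<dots> \<le> Ck_norm k \<psi>"
    unfolding Ck_norm_def
    using assms by (intro member_le_sum finite_multi_indices)
      (auto intro!: SUP_norm_nonneg torus_test_foldr_dir_deriv)
  finally show ?thesis .
qed

lemma Ck_norm_nonneg:
  assumes "\<psi> \<in> torus_test"
  shows "0 \<le> Ck_norm k \<psi>"
  by (rule order_trans[OF norm_ge_zero norm_le_Ck_norm[OF assms, of "[]"]]) auto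

lemma norm_fcoeff_foldr_le:
  assumes "\<psi> \<in> torus_test" "set es \<subseteq> Basis" "length es \<le> k"
  shows "norm (symbol es \<xi>) * norm (fcoeff \<xi> \<psi>) \<le> Ck_norm k \<psi>"
  unfolding norm_mult[symmetric] fcoeff_foldr_dir_deriv[OF assms(1,2), symmetric]
  by (intro norm_fcoeff_le torus_test_continuous_on torus_test_foldr_dir_deriv norm_le_Ck_norm assms)

text \<open>Only the coordinate with the largest modulus is differentiated, k times. The Euclidean
  norm of \<xi> is at most the number of coordinates times that modulus, which produces the
  constant.\<close>

lemma norm_fcoeff_decay:
  fixes \<psi> :: "real^'n::finite \<Rightarrow> complex"
  assumes "\<psi> \<in> torus_test"
  shows "(1 + norm (freq \<xi>)) ^ k * norm (fcoeff \<xi> \<psi>) \<le> (1 + real CARD('n)) ^ k * Ck_norm k \<psi>"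
proof -
  obtain j where j: "\<bar>\<xi> $ i\<bar> \<le> \<bar>\<xi> $ j\<bar>" for i
  proof -
    have "Max (range (\<lambda>i. \<bar>\<xi> $ i\<bar>)) \<in> range (\<lambda>i. \<bar>\<xi> $ i\<bar>)"
      by (rule Max_in) auto
    then obtain j where "Max (range (\<lambda>i. \<bar>\<xi> $ i\<bar>)) = \<bar>\<xi> $ j\<bar>" by (elim rangeE)
    then show ?thesis
      using that by (metis Max_ge finite finite_imageI rangeI)
  qed
  \<comment> \<open>The maximum with 1 absorbs the summand 1 of the weight and covers \<xi> = 0,
    where derivatives give no information and the bound without derivatives is used.\<close>
  define m where "m = max 1 \<bar>real_of_int (\<xi> $ j)\<bar>"
  have "norm (freq \<xi>) \<le> (\<Sum>i\<in>UNIV. \<bar>freq \<xi> $ i\<bar>)"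
    by (rule norm_le_l1_cart)
  also have "\<dots> \<le> (\<Sum>i\<in>(UNIV :: 'n set). m)"
    by (rule sum_mono) (use j in \<open>simp add: m_def le_max_iff_disj flip: of_int_abs\<close>)
  finally have "1 + norm (freq \<xi>) \<le> (1 + real CARD('n)) * m"
    by (simp add: m_def algebra_simps)
  then have "(1 + norm (freq \<xi>)) ^ k \<le> (1 + real CARD('n)) ^ k * m ^ k"
    by (metis (no_types, lifting) power_mono power_mult_distrib add_nonneg_nonneg norm_ge_zero zero_le_one)
  moreover have "m ^ k * norm (fcoeff \<xi> \<psi>) \<le> Ck_norm k \<psi>"
  proof (cases "\<bar>real_of_int (\<xi> $ j)\<bar> \<le> 1")
    case True
    then show ?thesis
      using norm_fcoeff_foldr_le[OF assms, of "[]" k \<xi>] by (simp add: m_def symbol_def)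
  next
    case False
    have "norm (symbol (replicate k (axis j 1)) \<xi>) = m ^ k"
      using False by (simp add: symbol_def prod_list_replicate norm_power norm_mult inner_axis' m_def)
    then show ?thesis
      using norm_fcoeff_foldr_le[OF assms, of "replicate k (axis j 1)" k \<xi>]
      by (simp add: set_replicate_conv_if axis_in_Basis_iff split: if_splits)
  qed
  ultimately show ?thesis
    by (smt (verit, ccfv_SIG) mult.assoc mult_left_mono mult_right_mono norm_ge_zero of_nat_0_le_iff zero_le_power)
qed

section \<open>Fourier expansion of test functions\<close>

lemma summable_on_int_inverse_squares: "(\<lambda>m::int. 1 / (1 + \<bar>real_of_int m\<bar>)\<^sup>2) summable_on UNIV"
proof -
  have "summable (\<lambda>n. inverse (real (Suc n) ^ 2))"
    using inverse_power_summable[of 2, where 'a=real] by (subst summable_Suc_iff) simp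
  then have n: "(\<lambda>n. 1 / (1 + real n)\<^sup>2) summable_on UNIV"
    by (subst summable_on_UNIV_nonneg_real_iff) (simp_all add: field_simps)
  have "(\<lambda>m::int. 1 / (1 + \<bar>real_of_int m\<bar>)\<^sup>2) summable_on range int"
    using n by (subst summable_on_reindex) (simp_all add: o_def)
  moreover have "(\<lambda>m::int. 1 / (1 + \<bar>real_of_int m\<bar>)\<^sup>2) summable_on (\<lambda>n. - int (Suc n)) ` UNIV"
  proof (subst summable_on_reindex)
    show "((\<lambda>m. 1 / (1 + \<bar>real_of_int m\<bar>)\<^sup>2) \<circ> (\<lambda>n. - int (Suc n))) summable_on UNIV"
      by (rule summable_on_comparison_test[OF n]) (auto simp: o_def intro!: divide_left_mono power_mono)
  qed (simp add: inj_on_def)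
  moreover have "range int \<union> (\<lambda>n. - int (Suc n)) ` UNIV = UNIV"
  proof (intro equalityI subset_UNIV subsetI)
    show "m \<in> range int \<union> (\<lambda>n. - int (Suc n)) ` UNIV" for m
      by (cases m rule: int_cases) auto
  qed
  moreover have "range int \<inter> (\<lambda>n. - int (Suc n)) ` UNIV = {}"
    by auto
  ultimately show ?thesis
    using summable_on_Un_disjoint by metis
qed

text \<open>The exponent spends a square on each coordinate: the term is at most the product over j
  of 1 / (1 + |\<xi>_j|)^2, and the sum of such products over a box factors into one-dimensional
  sums.\<close>

lemma summable_on_freq: "(\<lambda>\<xi>. 1 / (1 + norm (freq \<xi> :: real^'n::finite)) ^ (2 * CARD('n))) summable_on UNIV"
proof (rule nonneg_bdd_above_summable_on)
  define h :: "int \<Rightarrow> real" where "h m = 1 / (1 + \<bar>real_of_int m\<bar>)\<^sup>2" for m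
  have h0: "0 \<le> h m" for m by (simp add: h_def)
  show "bdd_above (sum (\<lambda>\<xi>. 1 / (1 + norm (freq \<xi> :: real^'n)) ^ (2 * CARD('n))) ` {F. F \<subseteq> UNIV \<and> finite F})"
  proof (rule bdd_aboveI2)
    fix F :: "(int^'n) set" assume F: "F \<in> {F. F \<subseteq> UNIV \<and> finite F}"
    define S where "S = (\<Union>\<xi>\<in>F. range (vec_nth \<xi>))"
    have S: "finite S" using F by (auto simp: S_def)
    have "(\<Sum>\<xi>\<in>F. 1 / (1 + norm (freq \<xi> :: real^'n)) ^ (2 * CARD('n))) \<le> (\<Sum>\<xi>\<in>F. \<Prod>j\<in>UNIV. h (\<xi> $ j))"
    proof (rule sum_mono)
      fix \<xi> :: "int^'n"
      have "(\<Prod>j\<in>UNIV. (1 + \<bar>real_of_int (\<xi> $ j)\<bar>)\<^sup>2) \<le> (\<Prod>j\<in>(UNIV::'n set). (1 + norm (freq \<xi>))\<^sup>2)"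
        using component_le_norm_cart[of "freq \<xi>"] by (intro prod_mono conjI power_mono) auto
      also have "\<dots> = (1 + norm (freq \<xi>)) ^ (2 * CARD('n))"
        by (simp add: power_mult)
      finally have "1 / (1 + norm (freq \<xi>)) ^ (2 * CARD('n)) \<le> 1 / (\<Prod>j\<in>UNIV. (1 + \<bar>real_of_int (\<xi> $ j)\<bar>)\<^sup>2)"
        by (intro divide_left_mono) (auto intro!: mult_pos_pos prod_pos zero_less_power simp: add_pos_nonneg)
      then show "1 / (1 + norm (freq \<xi> :: real^'n)) ^ (2 * CARD('n)) \<le> (\<Prod>j\<in>UNIV. h (\<xi> $ j))"
        by (simp add: h_def prod_dividef)
    qed
    also have "\<dots> = (\<Sum>g\<in>vec_nth ` F. \<Prod>j\<in>UNIV. h (g j))"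
      by (subst sum.reindex) (auto simp: inj_on_def vec_nth_inject)
    \<comment> \<open>The finite set of frequencies is enlarged to a full product of the set
      \<open>S\<close> of all occurring coordinates, where sum and product can be exchanged.\<close>
    also have "\<dots> \<le> (\<Sum>g\<in>PiE (UNIV::'n set) (\<lambda>j. S). \<Prod>j\<in>UNIV. h (g j))"
      by (rule sum_mono2) (use S in \<open>auto simp: S_def intro!: finite_PiE prod_nonneg h0\<close>)
    also have "\<dots> = (\<Prod>j\<in>(UNIV::'n set). \<Sum>m\<in>S. h m)"
      by (rule prod_sum_PiE[symmetric]) (auto simp: S)
    also have "\<dots> \<le> (\<Prod>j\<in>(UNIV::'n set). infsum h UNIV)"
      using summable_on_int_inverse_squares
      by (intro prod_mono conjI sum_nonneg h0 finite_sum_le_infsum S) (auto simp: h_def[abs_def])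
    finally show "(\<Sum>\<xi>\<in>F. 1 / (1 + norm (freq \<xi> :: real^'n)) ^ (2 * CARD('n))) \<le> (\<Prod>j\<in>(UNIV::'n set). infsum h UNIV)" .
  qed
qed simp

text \<open>Of the k + 2 N derivatives used, N being the dimension, k beat the weight and 2 N leave
  a summable factor. \<open>C\<close> and \<open>k\<close> depend on neither \<psi> nor \<xi>, as
  the continuity estimate of a synthesized distribution requires.\<close>

lemma norm_fcoeff_powr_le:
  obtains C k where "0 \<le> C" "\<And>\<psi> \<xi>. \<psi> \<in> torus_test \<Longrightarrow>
    norm (fcoeff \<xi> \<psi>) * (1 + norm (freq \<xi> :: real^'n::finite)) powr s \<le>
      C * Ck_norm k \<psi> * (1 / (1 + norm (freq \<xi>)) ^ (2 * CARD('n)))"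
proof -
  obtain k :: nat where k: "s \<le> real k"
    using real_arch_simple by blast
  let ?d = "2 * CARD('n)"
  define C where "C = (1 + real CARD('n)) ^ (k + ?d)"
  show ?thesis
  proof (rule that[of C "k + ?d"])
    fix \<psi> :: "real^'n \<Rightarrow> complex" and \<xi> :: "int^'n" assume \<psi>: "\<psi> \<in> torus_test"
    have pos: "0 < (1 + norm (freq \<xi>)) ^ ?d"
      by (intro zero_less_power add_pos_nonneg) auto
    have "(1 + norm (freq \<xi>)) powr s \<le> (1 + norm (freq \<xi>)) ^ k"
      using k by (subst powr_realpow[symmetric]) (auto intro: powr_mono simp: add_pos_nonneg)
    then have "norm (fcoeff \<xi> \<psi>) * (1 + norm (freq \<xi>)) powr s * (1 + norm (freq \<xi>)) ^ ?d \<le>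
        norm (fcoeff \<xi> \<psi>) * (1 + norm (freq \<xi>)) ^ k * (1 + norm (freq \<xi>)) ^ ?d"
      using pos by (intro mult_right_mono mult_left_mono) auto
    also have "\<dots> = (1 + norm (freq \<xi>)) ^ (k + ?d) * norm (fcoeff \<xi> \<psi>)"
      by (simp add: power_add)
    also have "\<dots> \<le> C * Ck_norm (k + ?d) \<psi>"
      unfolding C_def by (rule norm_fcoeff_decay[OF \<psi>])
    finally show "norm (fcoeff \<xi> \<psi>) * (1 + norm (freq \<xi>)) powr s \<le>
        C * Ck_norm (k + ?d) \<psi> * (1 / (1 + norm (freq \<xi>)) ^ ?d)"
      using pos by (simp add: field_simps)
  qed (simp add: C_def)
qed

lemma fcoeff_summable:
  fixes \<psi> :: "real^'n::finite \<Rightarrow> complex"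
  assumes "\<psi> \<in> torus_test"
  shows "(\<lambda>\<xi>. norm (fcoeff \<xi> \<psi>) * (1 + norm (freq \<xi>)) powr s) summable_on UNIV"
proof -
  obtain C k where C: "\<And>\<xi>. norm (fcoeff \<xi> \<psi>) * (1 + norm (freq \<xi>)) powr s \<le>
      C * Ck_norm k \<psi> * (1 / (1 + norm (freq \<xi>)) ^ (2 * CARD('n)))"
    using norm_fcoeff_powr_le[of s, where 'n='n] assms by metis
  have "(\<lambda>\<xi>. C * Ck_norm k \<psi> * (1 / (1 + norm (freq \<xi> :: real^'n)) ^ (2 * CARD('n)))) summable_on UNIV"
    by (intro summable_on_cmult_right summable_on_freq)
  then show ?thesis
    by (rule summable_on_comparison_test) (use C in auto)
qed

lemma fcoeff_abs_summable:
  fixes \<psi> :: "real^'n::finite \<Rightarrow> complex"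
  assumes "\<psi> \<in> torus_test"
  shows "(\<lambda>\<xi>. norm (fcoeff \<xi> \<psi>)) summable_on UNIV"
proof -
  \<comment> \<open>The weight with exponent 0 equals 1 only for a nonzero base, because
    \<open>0 powr 0\<close> is 0.\<close>
  have "1 + norm (freq \<xi> :: real^'n) \<noteq> 0" for \<xi>
    by (smt (verit) norm_ge_zero)
  then show ?thesis
    using fcoeff_summable[OF assms, of 0] by simp
qed

section \<open>Trigonometric polynomials and completeness of the characters\<close>

inductive_set trig_poly :: "(real^'n::finite \<Rightarrow> complex) set" where
  mono: "(\<lambda>x. c * character \<xi> x) \<in> trig_poly"
| add: "p \<in> trig_poly \<Longrightarrow> q \<in> trig_poly \<Longrightarrow> (\<lambda>x. p x + q x) \<in> trig_poly"

lemma trig_poly_const: "(\<lambda>x. c) \<in> trig_poly"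
  using trig_poly.mono[of c 0] by simp

lemma trig_poly_mult_mono: "p \<in> trig_poly \<Longrightarrow> (\<lambda>x. c * character \<xi> x * p x) \<in> trig_poly"
proof (induction rule: trig_poly.induct)
  case (mono d \<eta>)
  have "(\<lambda>x. c * character \<xi> x * (d * character \<eta> x)) = (\<lambda>x. (c * d) * character (\<xi> + \<eta>) x)"
    by (simp add: character_add mult_ac)
  then show ?case by (simp only: trig_poly.mono)
next
  case (add p q)
  then show ?case by (simp add: distrib_left trig_poly.add)
qed

lemma trig_poly_mult: "p \<in> trig_poly \<Longrightarrow> q \<in> trig_poly \<Longrightarrow> (\<lambda>x. p x * q x) \<in> trig_poly"
  by (induction rule: trig_poly.induct) (simp_all add: trig_poly_mult_mono distrib_right trig_poly.add)

lemma trig_poly_prod: "(\<And>i. i \<in> I \<Longrightarrow> p i \<in> trig_poly) \<Longrightarrow> (\<lambda>x. \<Prod>i\<in>I. p i x) \<in> trig_poly"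
  by (induction I rule: infinite_finite_induct) (simp_all add: trig_poly_const trig_poly_mult)

lemma trig_poly_power: "p \<in> trig_poly \<Longrightarrow> (\<lambda>x. p x ^ m) \<in> trig_poly"
  by (induction m) (simp_all add: trig_poly_const trig_poly_mult)

text \<open>By Euler's formula only the frequency 0 and plus or minus the j-th unit vector occur;
  the centre \<open>z\<close> enters through the coefficients alone.\<close>

lemma trig_poly_cos:
  fixes z :: "real^'n::finite"
  shows "(\<lambda>x. complex_of_real ((1 + cos (x $ j - z $ j)) / 2)) \<in> trig_poly"
proof -
  let ?k = "axis j 1 :: int^'n"
  have fr: "freq ?k = axis j 1"
    by (simp add: vec_eq_iff axis_def)
  have "complex_of_real ((1 + cos (x $ j - z $ j)) / 2) =
      1 / 2 + (exp (\<i> * z $ j) / 4 * character ?k x + exp (- \<i> * z $ j) / 4 * character (- ?k) x)" for x :: "real^'n"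
    by (simp add: character_def freq_uminus fr inner_axis cos_of_real[symmetric] cos_exp_eq
        exp_add[symmetric] algebra_simps add_divide_distrib)
  then show ?thesis
    by (simp only: trig_poly.add trig_poly_const trig_poly.mono)
qed

text \<open>Continuity of \<open>p\<close> is carried through the induction because additivity of
  the integral needs integrable summands.\<close>

lemma integral_trig_poly_eq_0:
  assumes "continuous_on UNIV f" "\<And>\<xi>. fcoeff \<xi> f = 0" "p \<in> trig_poly"
  shows "integral (cbox 0 (\<chi> j. 2 * pi)) (\<lambda>x. f x * p x) = 0 \<and> continuous_on UNIV p"
  using assms(3)
proof induction
  case (mono c \<xi>)
  have "integral (cbox 0 (\<chi> j. 2 * pi)) (\<lambda>x. f x * character \<xi> x) = 0"
    using assms(2)[of "- \<xi>"] content_cell_pos[where 'n='a] by (simp add: fcoeff_def)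
  then have "integral (cbox 0 (\<chi> j. 2 * pi)) (\<lambda>x. c * (f x * character \<xi> x)) = 0"
    by simp
  then show ?case
    by (simp add: mult_ac continuous_intros)
next
  case (add p q)
  then have "(\<lambda>x. f x * p x) integrable_on (cbox 0 (\<chi> j. 2 * pi))"
    "(\<lambda>x. f x * q x) integrable_on (cbox 0 (\<chi> j. 2 * pi))"
    by (auto intro!: integrable_continuous continuous_intros continuous_on_subset[OF assms(1)]
        intro: continuous_on_subset)
  then show ?case
    using add by (simp add: distrib_left integral_add continuous_intros)
qed

text \<open>The powers of the kernel \<open>\<Prod>j. (1 + cos (x\<^sub>j - z\<^sub>j)) / 2\<close> concentrate at \<open>z\<close>. If \<open>f z = 1\<close>, the
  integrals of \<open>f\<close> against them cannot all vanish.\<close>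

lemma fcoeff_eq_0_imp_eq_0:
  fixes f :: "real^'n::finite \<Rightarrow> complex"
  assumes cont: "continuous_on UNIV f" and per: "periodic f" and zero: "\<And>\<xi>. fcoeff \<xi> f = 0"
  shows "f x = 0"
proof (rule ccontr)
  let ?C = "cbox 0 (\<chi> j. 2 * pi) :: (real^'n) set" and ?B = "box 0 (\<chi> j. 2 * pi) :: (real^'n) set"
  assume "f x \<noteq> 0"
  then obtain y where y: "y \<in> ?C" "f y \<noteq> 0"
    using periodic_reduce[OF per] by metis
  have B: "?B \<noteq> {}"
    by (simp add: box_ne_empty(2) Basis_vec_def inner_axis)
  \<comment> \<open>The peak must lie in the open cell: for a point on a face, the kernel would also
    equal 1 at the opposite point of the closed cell. A continuous function vanishing on the open
    cell vanishes on its closure, so such a point exists.\<close>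
  have "\<exists>z\<in>?B. f z \<noteq> 0"
  proof (rule ccontr)
    assume "\<not> ?thesis"
    then have "f y = 0"
      using continuous_constant_on_closure[of ?B f 0 y] y B
      by (auto simp: continuous_on_subset[OF cont])
    with y show False by simp
  qed
  then obtain z where z: "z \<in> ?B" "f z \<noteq> 0" by blast
  define g where "g x = (1 / f z) * f x" for x
  have g1: "g z = 1" using z by (simp add: g_def)
  have cg: "continuous_on UNIV g" unfolding g_def by (intro continuous_intros cont)
  have g0: "fcoeff \<xi> g = 0" for \<xi> unfolding g_def fcoeff_cmult zero by simp
  define K where "K x = (\<Prod>j\<in>UNIV. (1 + cos (x $ j - z $ j)) / 2)" for x :: "real^'n"
  have K: "(\<lambda>x. complex_of_real (K x)) \<in> trig_poly"
    unfolding K_def of_real_prod by (intro trig_poly_prod trig_poly_cos)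
  have cK: "continuous_on A K" for A
    unfolding K_def by (intro continuous_intros) auto
  have fac: "0 \<le> (1 + cos t) / 2" for t :: real
    using cos_ge_minus_one[of t] by (simp, linarith)
  have fac1: "(1 + cos t) / 2 \<le> 1" for t :: real
    using cos_le_one[of t] by (simp add: field_simps)
  have K0: "0 \<le> K x" for x
    unfolding K_def by (intro prod_nonneg fac)
  have K1: "K z = 1" by (simp add: K_def)
  have Kless: "K x < 1" if x: "x \<in> ?C" "x \<noteq> z" for x
  proof -
    obtain j where j: "x $ j \<noteq> z $ j" using x(2) unfolding vec_eq_iff by blast
    have "0 \<le> x $ j" "x $ j \<le> 2 * pi" "0 < z $ j" "z $ j < 2 * pi"
      using x(1) z(1) by (simp_all add: mem_box_cart)
    then have less: "\<bar>x $ j - z $ j\<bar> < 2 * pi"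
      by linarith
    have "cos (x $ j - z $ j) \<noteq> 1"
    proof
      assume "cos (x $ j - z $ j) = 1"
      then obtain n :: int where n: "x $ j - z $ j = n * 2 * pi"
        by (auto simp: cos_one_2pi_int)
      with less have "\<bar>real_of_int n\<bar> * (2 * pi) < 1 * (2 * pi)"
        by (simp add: abs_mult)
      then have "\<bar>real_of_int n\<bar> < 1"
        by (rule mult_right_less_imp_less) simp
      then have "n = 0" by linarith
      with n j show False by simp
    qed
    then have "(1 + cos (x $ j - z $ j)) / 2 < 1"
      using cos_le_one[of "x $ j - z $ j"] by (simp add: less_le)
    moreover have "K x = (1 + cos (x $ j - z $ j)) / 2 * (\<Prod>i\<in>UNIV - {j}. (1 + cos (x $ i - z $ i)) / 2)"
      unfolding K_def by (rule prod.remove) auto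
    moreover have "(\<Prod>i\<in>UNIV - {j}. (1 + cos (x $ i - z $ i)) / 2) \<le> 1"
      by (intro prod_le_1 conjI fac fac1)
    moreover have "0 \<le> (\<Prod>i\<in>UNIV - {j}. (1 + cos (x $ i - z $ i)) / 2)"
      by (intro prod_nonneg fac)
    ultimately show ?thesis
      using fac[of "x $ j - z $ j"] by (smt (verit) mult_left_le)
  qed
  have "open ({x. 1 / 2 < Re (g x)} \<inter> ?B)"
    using cg by (intro open_Int open_Collect_less) (auto intro!: continuous_intros)
  moreover have "z \<in> {x. 1 / 2 < Re (g x)} \<inter> ?B" using z g1 by simp
  ultimately obtain d where d: "0 < d" "ball z d \<subseteq> {x. 1 / 2 < Re (g x)} \<inter> ?B"
    using open_contains_ball by blast
  \<comment> \<open>Away from the peak, compactness gives a maximum of \<open>K\<close> below 1.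
    Taking the maximum with 1/2 keeps \<open>q\<close> positive for the quotient formed at the
    end.\<close>
  obtain q where q: "0 < q" "q < 1" "\<And>x. x \<in> ?C - ball z d \<Longrightarrow> K x \<le> q"
  proof (cases "?C - ball z d = {}")
    case True
    show ?thesis by (rule that[of "1 / 2"]) (use True in auto)
  next
    case False
    have "compact (?C - ball z d)"
      by (intro compact_diff compact_cbox open_ball)
    from continuous_attains_sup[OF this False cK]
    obtain w where w: "w \<in> ?C - ball z d" "\<And>x. x \<in> ?C - ball z d \<Longrightarrow> K x \<le> K w" by blast
    have "K w < 1"
      using w(1) d(1) by (intro Kless) auto
    show ?thesis
      by (rule that[of "max (1 / 2) (K w)"]) (use w(2) \<open>K w < 1\<close> in \<open>auto simp: le_max_iff_disj\<close>)
  qed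
  \<comment> \<open>A level strictly between \<open>q\<close> and the peak value 1. \<open>K\<close>
    exceeds it on a small box at the peak, where the m-th power of the kernel therefore dominates
    q^m.\<close>
  define q' where "q' = (1 + q) / 2"
  have q': "q < q'" "0 < q'" "q' < 1" using q by (auto simp: q'_def)
  have "open ({x. q' < K x} \<inter> ball z d)"
    using cK by (intro open_Int open_Collect_less) (auto intro!: continuous_intros)
  moreover have "z \<in> {x. q' < K x} \<inter> ball z d" using q' K1 d by simp
  ultimately obtain a b where ab: "cbox a b \<subseteq> {x. q' < K x} \<inter> ball z d" "\<forall>i\<in>Basis. a \<bullet> i < b \<bullet> i"
    using open_contains_cbox by metis
  have sub: "cbox a b \<subseteq> ?C"
    using ab(1) d(2) box_subset_cbox by blast
  have "bounded (g ` ?C)"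
    by (intro compact_imp_bounded compact_continuous_image continuous_on_subset[OF cg] compact_cbox) auto
  then obtain G where G: "0 < G" "\<And>x. x \<in> ?C \<Longrightarrow> norm (g x) \<le> G"
    unfolding bounded_pos by blast
  \<comment> \<open>The left side is the integral of a step function lying below Re (g K^m): on the
    box Re g > 1/2 and K > \<open>q'\<close>, in the rest of the ball the integrand is nonnegative,
    and outside the ball it is at least -G q^m. The integral of g K^m is zero.\<close>
  have ineq: "q' ^ m / 2 * measure lborel (cbox a b) - G * q ^ m * measure lborel ?C \<le> 0" for m
  proof -
    have "(\<lambda>x. complex_of_real (K x) ^ m) \<in> trig_poly"
      by (intro trig_poly_power K)
    then have int0: "integral ?C (\<lambda>x. g x * complex_of_real (K x) ^ m) = 0"
      using integral_trig_poly_eq_0[OF cg g0] by blast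
    have "(\<lambda>x. g x * complex_of_real (K x) ^ m) integrable_on ?C"
      by (intro integrable_continuous continuous_intros continuous_on_subset[OF cg] cK) auto
    from integrable_integral[OF this]
    have "((\<lambda>x. g x * complex_of_real (K x) ^ m) has_integral 0) ?C"
      unfolding int0 .
    from has_integral_linear[OF this bounded_linear_Re]
    have upper: "((\<lambda>x. Re (g x * complex_of_real (K x) ^ m)) has_integral 0) ?C"
      by (simp add: o_def)
    have lower: "((\<lambda>x. (if x \<in> cbox a b then q' ^ m / 2 else 0) - G * q ^ m) has_integral
        measure lborel (cbox a b) *\<^sub>R (q' ^ m / 2) - measure lborel ?C *\<^sub>R (G * q ^ m)) ?C"
      by (intro has_integral_diff has_integral_const) (simp only: has_integral_restrict[OF sub] has_integral_const)
    have "measure lborel (cbox a b) *\<^sub>R (q' ^ m / 2) - measure lborel ?C *\<^sub>R (G * q ^ m) \<le> 0"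
    proof (rule has_integral_le[OF lower upper])
      fix x assume x: "x \<in> ?C"
      have Re: "Re (g x * complex_of_real (K x) ^ m) = Re (g x) * K x ^ m"
        by (simp flip: of_real_power)
      show "(if x \<in> cbox a b then q' ^ m / 2 else 0) - G * q ^ m \<le> Re (g x * complex_of_real (K x) ^ m)"
      proof (cases "x \<in> ball z d")
        case True
        then have g: "1 / 2 < Re (g x)" using d by blast
        have "(if x \<in> cbox a b then q' ^ m / 2 else 0) \<le> Re (g x) * K x ^ m"
        proof (cases "x \<in> cbox a b")
          case True
          then have "q' ^ m \<le> K x ^ m"
            using ab(1) q' by (intro power_mono) auto
          then have "1 / 2 * q' ^ m \<le> Re (g x) * K x ^ m"
            using g q' by (intro mult_mono) auto
          then show ?thesis using True by simp
        next
          case False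
          then show ?thesis using g K0[of x] by simp
        qed
        moreover have "0 \<le> G * q ^ m" using G q by simp
        ultimately show ?thesis unfolding Re by linarith
      next
        case False
        then have "K x ^ m \<le> q ^ m"
          using q x K0 by (intro power_mono) auto
        then have "\<bar>Re (g x)\<bar> * K x ^ m \<le> G * q ^ m"
          using G x K0 abs_Re_le_cmod[of "g x"] by (intro mult_mono) (auto intro: order_trans)
        then have "- (G * q ^ m) \<le> Re (g x) * K x ^ m"
          using K0[of x] by (smt (verit) mult_minus_left mult_right_mono zero_le_power)
        then show ?thesis
          unfolding Re using False ab(1) by auto
      qed
    qed
    then show ?thesis by (simp add: mult_ac)
  qed
  define c where "c = measure lborel (cbox a b) / 2"
  have c: "0 < c"
    using content_pos_lt[of a b] ab(2) by (simp add: c_def)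
  \<comment> \<open>The powers of this ratio outgrow the constant by which \<open>ineq\<close>
    bounds them for every m.\<close>
  have "1 < q' / q" using q q' by (simp add: field_simps)
  then obtain m where m: "G * measure lborel ?C / c < (q' / q) ^ m"
    using real_arch_pow by blast
  then have "G * measure lborel ?C * q ^ m < c * q' ^ m"
    using c q by (simp add: field_simps power_divide)
  then show False
    using ineq[of m] by (simp add: c_def mult_ac)
qed

text \<open>Absolute summability makes the series converge uniformly to some continuous periodic
  \<open>S\<close>. Termwise integration shows that \<open>S\<close> has the same coefficients as
  \<psi>, so the difference vanishes by completeness.\<close>

lemma uniform_limit_fourier:
  fixes \<psi> :: "real^'n::finite \<Rightarrow> complex"
  assumes "\<psi> \<in> torus_test"
  shows "uniform_limit UNIV (\<lambda>F x. \<Sum>\<xi>\<in>F. fcoeff \<xi> \<psi> * character \<xi> x) \<psi> (finite_subsets_at_top UNIV)"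
proof -
  let ?C = "cbox 0 (\<chi> j. 2 * pi) :: (real^'n) set"
  define S where "S x = (\<Sum>\<^sub>\<infinity>\<xi>. fcoeff \<xi> \<psi> * character \<xi> x)" for x
  note summ = fcoeff_abs_summable[OF assms]
  have ul: "uniform_limit UNIV (\<lambda>F x. \<Sum>\<xi>\<in>F. fcoeff \<xi> \<psi> * character \<xi> x) S (finite_subsets_at_top UNIV)"
    unfolding S_def by (rule Weierstrass_m_test_general[OF _ summ]) (simp add: norm_mult)
  have cS: "continuous_on UNIV S"
    by (rule uniform_limit_theorem[OF _ ul]) (auto intro!: always_eventually continuous_intros)
  have pS: "periodic S"
    by (simp add: periodic_def S_def character_periodic)
  have coS: "fcoeff \<eta> S = fcoeff \<eta> \<psi>" for \<eta>
  proof -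
    have S\<eta>: "S x * character (- \<eta>) x = (\<Sum>\<^sub>\<infinity>\<xi>. fcoeff \<xi> \<psi> * character (\<xi> - \<eta>) x)" for x
    proof -
      have "(\<lambda>\<xi>. fcoeff \<xi> \<psi> * character \<xi> x) summable_on UNIV"
        by (rule abs_summable_summable) (simp add: norm_mult summ)
      then show ?thesis
        unfolding S_def using infsum_cmult_left[of "character (- \<eta>) x" "\<lambda>\<xi>. fcoeff \<xi> \<psi> * character \<xi> x" UNIV]
        by (simp add: mult.assoc character_add[symmetric])
    qed
    have "uniform_limit ?C (\<lambda>F x. \<Sum>\<xi>\<in>F. fcoeff \<xi> \<psi> * character (\<xi> - \<eta>) x) (\<lambda>x. S x * character (- \<eta>) x)
        (finite_subsets_at_top UNIV)"
      unfolding S\<eta> by (rule Weierstrass_m_test_general[OF _ summ]) (simp add: norm_mult)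
    then obtain I J where I: "\<And>F. ((\<lambda>x. \<Sum>\<xi>\<in>F. fcoeff \<xi> \<psi> * character (\<xi> - \<eta>) x) has_integral I F) ?C"
      and J: "((\<lambda>x. S x * character (- \<eta>) x) has_integral J) ?C" and lim: "(I \<longlongrightarrow> J) (finite_subsets_at_top UNIV)"
      by (rule uniform_limit_integral_cbox) (auto intro!: continuous_intros)
    have IF: "I F = (if \<eta> \<in> F then fcoeff \<eta> \<psi> * measure lborel ?C else 0)" if "finite F" for F
    proof -
      have "((\<lambda>x. \<Sum>\<xi>\<in>F. fcoeff \<xi> \<psi> * character (\<xi> - \<eta>) x) has_integral
          (\<Sum>\<xi>\<in>F. fcoeff \<xi> \<psi> * integral ?C (character (\<xi> - \<eta>)))) ?C"
        by (intro has_integral_sum has_integral_mult_right integrable_integral integrable_continuous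
            continuous_intros that)
      with I have "I F = (\<Sum>\<xi>\<in>F. fcoeff \<xi> \<psi> * integral ?C (character (\<xi> - \<eta>)))"
        using has_integral_unique by blast
      also have "\<dots> = (\<Sum>\<xi>\<in>F. if \<xi> = \<eta> then fcoeff \<eta> \<psi> * measure lborel ?C else 0)"
        by (intro sum.cong) (auto simp: integral_character)
      finally show ?thesis using that by simp
    qed
    \<comment> \<open>By orthogonality the integral of a partial sum is constant as soon as the
      partial sum contains the frequency \<eta>.\<close>
    have "\<forall>\<^sub>F F in finite_subsets_at_top UNIV. I F = fcoeff \<eta> \<psi> * measure lborel ?C"
      unfolding eventually_finite_subsets_at_top by (rule exI[of _ "{\<eta>}"]) (auto simp: IF)
    then have "(I \<longlongrightarrow> fcoeff \<eta> \<psi> * measure lborel ?C) (finite_subsets_at_top UNIV)"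
      by (rule tendsto_eventually)
    then have "J = fcoeff \<eta> \<psi> * measure lborel ?C"
      using lim tendsto_unique finite_subsets_at_top_neq_bot by blast
    then show ?thesis
      using J content_cell_pos[where 'n='n] by (simp add: fcoeff_def[of _ S] integral_unique)
  qed
  have "\<psi> x - S x = 0" for x
  proof -
    have c\<psi>: "continuous_on UNIV \<psi>" and p\<psi>: "periodic \<psi>"
      using assms by (simp_all add: torus_test_continuous_on torus_test_imp_periodic)
    have "\<psi> x + (- 1) * S x = 0"
    proof (rule fcoeff_eq_0_imp_eq_0[where f = "\<lambda>x. \<psi> x + (- 1) * S x"])
      show "continuous_on UNIV (\<lambda>x. \<psi> x + (- 1) * S x)"
        by (intro continuous_intros cS c\<psi>)
      show "periodic (\<lambda>x. \<psi> x + (- 1) * S x)"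
        using p\<psi> pS by (simp add: periodic_def)
      show "fcoeff \<xi> (\<lambda>x. \<psi> x + (- 1) * S x) = 0" for \<xi>
        by (subst fcoeff_add, fact c\<psi>) (intro continuous_intros cS, simp only: fcoeff_cmult coS, simp)
    qed
    then show ?thesis by simp
  qed
  then have "S = \<psi>" by (simp add: fun_eq_iff)
  with ul show ?thesis by simp
qed

section \<open>Distributions as Fourier series\<close>

lemma distribution_add:
  assumes "u \<in> distributions" "\<psi> \<in> torus_test" "\<theta> \<in> torus_test"
  shows "u (\<lambda>x. \<psi> x + \<theta> x) = u \<psi> + u \<theta>"
  using assms unfolding distributions_def by blast

lemma distribution_cmult:
  assumes "u \<in> distributions" "\<psi> \<in> torus_test"
  shows "u (\<lambda>x. c * \<psi> x) = c * u \<psi>"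
  using assms unfolding distributions_def by blast

lemma distribution_sum:
  assumes u: "u \<in> distributions" and "finite F"
  shows "u (\<lambda>x. \<Sum>\<xi>\<in>F. c \<xi> * character \<xi> x) = (\<Sum>\<xi>\<in>F. c \<xi> * fourier u \<xi>)"
  using assms(2)
proof (induction F)
  case empty
  have "u (\<lambda>x. 0 * character 0 x) = 0 * u (character 0)"
    by (intro distribution_cmult u character_in_torus_test)
  then show ?case by simp
next
  case (insert \<eta> F)
  have t: "(\<lambda>x. c \<xi> * character \<xi> x) \<in> torus_test" for \<xi>
    by (intro torus_test_cmult character_in_torus_test)
  have s: "(\<lambda>x. \<Sum>\<xi>\<in>F. c \<xi> * character \<xi> x) \<in> torus_test"
    by (intro torus_test_sum t)
  have "u (\<lambda>x. c \<eta> * character \<eta> x + (\<Sum>\<xi>\<in>F. c \<xi> * character \<xi> x)) =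
      u (\<lambda>x. c \<eta> * character \<eta> x) + u (\<lambda>x. \<Sum>\<xi>\<in>F. c \<xi> * character \<xi> x)"
    by (intro distribution_add u s t)
  moreover have "u (\<lambda>x. c \<eta> * character \<eta> x) = c \<eta> * u (character \<eta>)"
    by (intro distribution_cmult u character_in_torus_test)
  ultimately show ?case
    using insert by (simp add: fourier_eq)
qed

text \<open>A distribution is bounded by one \<open>Ck_norm\<close>, which involves finitely many
  derivatives. Each derivative of the Fourier remainder of \<psi> is the Fourier remainder of the
  corresponding derivative of \<psi>, hence uniformly small.\<close>

lemma distribution_has_sum:
  fixes u :: "'n::finite functional"
  assumes u: "u \<in> distributions" and \<psi>: "\<psi> \<in> torus_test"
  shows "((\<lambda>\<xi>. fcoeff \<xi> \<psi> * fourier u \<xi>) has_sum u \<psi>) UNIV"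
proof -
  let ?E = "\<lambda>k. {es. set es \<subseteq> (Basis :: (real^'n) set) \<and> length es \<le> k}"
  obtain C k where C: "\<And>\<theta>. \<theta> \<in> torus_test \<Longrightarrow> norm (u \<theta>) \<le> C * Ck_norm k \<theta>"
    using u unfolding distributions_def by blast
  define R where "R F x = \<psi> x + (- 1) * (\<Sum>\<xi>\<in>F. fcoeff \<xi> \<psi> * character \<xi> x)" for F x
  have t: "(\<lambda>x. \<Sum>\<xi>\<in>F. fcoeff \<xi> \<psi> * character \<xi> x) \<in> torus_test" for F
    by (intro torus_test_sum torus_test_cmult character_in_torus_test)
  have R: "R F \<in> torus_test" for F
    unfolding R_def by (intro torus_test_add \<psi> torus_test_cmult t)
  have foldrR: "foldr dir_deriv es (R F) x =
      foldr dir_deriv es \<psi> x - (\<Sum>\<xi>\<in>F. fcoeff \<xi> (foldr dir_deriv es \<psi>) * character \<xi> x)"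
    if es: "set es \<subseteq> Basis" for es F x
  proof -
    have "foldr dir_deriv es (\<lambda>x. fcoeff \<xi> \<psi> * character \<xi> x) x =
        fcoeff \<xi> (foldr dir_deriv es \<psi>) * character \<xi> x" for \<xi>
      by (simp add: foldr_dir_deriv_cmult smooth_character es foldr_dir_deriv_character
          fcoeff_foldr_dir_deriv \<psi>)
    then show ?thesis
      unfolding R_def[abs_def]
      by (subst foldr_dir_deriv_add, simp_all only: foldr_dir_deriv_cmult torus_testD \<psi> t es torus_test_cmult)
        (simp add: foldr_dir_deriv_sum smooth_cmult smooth_character es)
  qed
  have "((\<lambda>F. norm (u (R F))) \<longlongrightarrow> 0) (finite_subsets_at_top UNIV)"
  proof (rule tendstoI)
    fix e :: real assume e: "0 < e"
    \<comment> \<open>The \<open>Ck_norm\<close> of the remainder will be at most the number of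
      multi-indices times \<open>d\<close>. The summand 1 prevents division by zero and the factor 2
      leaves room for a strict inequality; the modulus is taken because the sign of \<open>C\<close>
      is unknown.\<close>
    define d where "d = e / (2 * (\<bar>C\<bar> * real (card (?E k)) + 1))"
    have d: "0 < d" using e by (simp add: d_def add_nonneg_pos)
    have "\<forall>\<^sub>F F in finite_subsets_at_top UNIV. \<forall>es\<in>?E k. \<forall>x. norm (foldr dir_deriv es (R F) x) < d"
    proof (rule eventually_ball_finite[OF finite_multi_indices], safe)
      fix es :: "(real^'n) list" assume es: "set es \<subseteq> Basis"
      from uniform_limit_fourier[OF torus_test_foldr_dir_deriv[OF \<psi> es]] d
      have "\<forall>\<^sub>F F in finite_subsets_at_top UNIV. \<forall>x\<in>UNIV.
          dist (\<Sum>\<xi>\<in>F. fcoeff \<xi> (foldr dir_deriv es \<psi>) * character \<xi> x) (foldr dir_deriv es \<psi> x) < d"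
        unfolding uniform_limit_iff by blast
      then show "\<forall>\<^sub>F F in finite_subsets_at_top UNIV. \<forall>x. norm (foldr dir_deriv es (R F) x) < d"
        by (simp add: foldrR[OF es] dist_norm norm_minus_commute)
    qed
    then show "\<forall>\<^sub>F F in finite_subsets_at_top UNIV. dist (norm (u (R F))) 0 < e"
    proof eventually_elim
      case (elim F)
      have "Ck_norm k (R F) \<le> real (card (?E k)) * d"
        unfolding Ck_norm_def using elim
        by (intro sum_bounded_above cSUP_least) (auto intro: less_imp_le)
      then have "\<bar>C\<bar> * Ck_norm k (R F) \<le> \<bar>C\<bar> * (real (card (?E k)) * d)"
        by (intro mult_left_mono) auto
      moreover have "norm (u (R F)) \<le> \<bar>C\<bar> * Ck_norm k (R F)"
        using C[OF R] Ck_norm_nonneg[OF R] by (meson abs_ge_self mult_right_mono order_trans)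
      moreover have "\<bar>C\<bar> * (real (card (?E k)) * d) < e"
      proof -
        have "(\<bar>C\<bar> * real (card (?E k)) + 1) * d = e / 2"
          by (simp add: d_def add_nonneg_eq_0_iff field_simps)
        then show ?thesis using d e by (simp add: algebra_simps)
      qed
      ultimately show ?case by simp
    qed
  qed
  then have "((\<lambda>F. u (R F)) \<longlongrightarrow> 0) (finite_subsets_at_top UNIV)"
    by (simp add: tendsto_norm_zero_iff)
  moreover have "\<forall>\<^sub>F F in finite_subsets_at_top UNIV. u (R F) = u \<psi> - (\<Sum>\<xi>\<in>F. fcoeff \<xi> \<psi> * fourier u \<xi>)"
  proof (rule eventually_finite_subsets_at_top_weakI)
    fix F :: "(int^'n) set" assume F: "finite F"
    have "u (R F) = u \<psi> + u (\<lambda>x. (- 1) * (\<Sum>\<xi>\<in>F. fcoeff \<xi> \<psi> * character \<xi> x))"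
      unfolding R_def by (intro distribution_add u \<psi> torus_test_cmult t)
    also have "u (\<lambda>x. (- 1) * (\<Sum>\<xi>\<in>F. fcoeff \<xi> \<psi> * character \<xi> x)) =
        (- 1) * u (\<lambda>x. \<Sum>\<xi>\<in>F. fcoeff \<xi> \<psi> * character \<xi> x)"
      by (intro distribution_cmult u t)
    finally show "u (R F) = u \<psi> - (\<Sum>\<xi>\<in>F. fcoeff \<xi> \<psi> * fourier u \<xi>)"
      by (simp add: distribution_sum[OF u F])
  qed
  ultimately have "((\<lambda>F. u \<psi> - (\<Sum>\<xi>\<in>F. fcoeff \<xi> \<psi> * fourier u \<xi>)) \<longlongrightarrow> 0) (finite_subsets_at_top UNIV)"
    by (rule Lim_transform_eventually)
  from tendsto_diff[OF tendsto_const[of "u \<psi>"] this]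
  show ?thesis by (simp add: has_sum_def)
qed

text \<open>For coefficients of polynomial growth this is the distribution given by the series of
  a_\<xi> e^{ix\<xi>}. The value 0 elsewhere follows the convention in
  \<open>distributions\<close>.\<close>

definition synthesis :: "(int^'n::finite \<Rightarrow> complex) \<Rightarrow> 'n functional" where
  "synthesis a \<psi> = (if \<psi> \<in> torus_test then \<Sum>\<^sub>\<infinity>\<xi>. fcoeff \<xi> \<psi> * a \<xi> else 0)"

lemma fcoeff_mult_summable:
  fixes a :: "int^'n::finite \<Rightarrow> complex"
  assumes "\<psi> \<in> torus_test" and a: "\<And>\<xi>. norm (a \<xi>) \<le> B * (1 + norm (freq \<xi>)) powr s"
  shows "(\<lambda>\<xi>. norm (fcoeff \<xi> \<psi> * a \<xi>)) summable_on UNIV"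
proof (rule summable_on_comparison_test)
  show "(\<lambda>\<xi>. B * (norm (fcoeff \<xi> \<psi>) * (1 + norm (freq \<xi>)) powr s)) summable_on UNIV"
    by (intro summable_on_cmult_right fcoeff_summable assms)
  show "norm (fcoeff \<xi> \<psi> * a \<xi>) \<le> B * (norm (fcoeff \<xi> \<psi>) * (1 + norm (freq \<xi>)) powr s)" for \<xi>
    using mult_left_mono[OF a, of "norm (fcoeff \<xi> \<psi>)"] by (simp add: norm_mult mult_ac)
qed simp

text \<open>Polynomial growth of \<open>a\<close> is absorbed by the rapid decay of the coefficients
  of \<psi>, with constants uniform in \<psi>; the remaining sum \<open>Z\<close> is a fixed
  number.\<close>

lemma synthesis_distribution:
  fixes a :: "int^'n::finite \<Rightarrow> complex"
  assumes a: "\<And>\<xi>. norm (a \<xi>) \<le> B * (1 + norm (freq \<xi>)) powr s"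
  shows "synthesis a \<in> distributions"
proof -
  have summ: "(\<lambda>\<xi>. fcoeff \<xi> \<psi> * a \<xi>) summable_on UNIV" if "\<psi> \<in> torus_test" for \<psi>
    by (rule abs_summable_summable[OF fcoeff_mult_summable[OF that a]])
  obtain C k where C0: "0 \<le> C" and C: "\<And>\<psi> \<xi>. \<psi> \<in> torus_test \<Longrightarrow>
    norm (fcoeff \<xi> \<psi>) * (1 + norm (freq \<xi> :: real^'n)) powr s \<le>
      C * Ck_norm k \<psi> * (1 / (1 + norm (freq \<xi>)) ^ (2 * CARD('n)))"
    using norm_fcoeff_powr_le[of s, where 'n='n] by metis
  define Z where "Z = (\<Sum>\<^sub>\<infinity>\<xi>. 1 / (1 + norm (freq \<xi> :: real^'n)) ^ (2 * CARD('n)))"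
  \<comment> \<open>At frequency 0 the weight is 1, so \<open>B\<close> dominates a norm.\<close>
  have B: "0 \<le> B"
    using order_trans[OF norm_ge_zero a[of 0]] by (simp add: freq_def zero_vec_def[symmetric])
  have bound: "norm (synthesis a \<psi>) \<le> B * C * Z * Ck_norm k \<psi>" if \<psi>: "\<psi> \<in> torus_test" for \<psi>
  proof -
    have "((\<lambda>\<xi>. (B * C * Ck_norm k \<psi>) * (1 / (1 + norm (freq \<xi> :: real^'n)) ^ (2 * CARD('n)))) has_sum
        (B * C * Ck_norm k \<psi>) * Z) UNIV"
      unfolding Z_def by (intro has_sum_cmult_right has_sum_infsum summable_on_freq)
    moreover have "norm (fcoeff \<xi> \<psi> * a \<xi>) \<le> (B * C * Ck_norm k \<psi>) * (1 / (1 + norm (freq \<xi>)) ^ (2 * CARD('n)))" for \<xi>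
    proof -
      have "norm (fcoeff \<xi> \<psi> * a \<xi>) \<le> B * (norm (fcoeff \<xi> \<psi>) * (1 + norm (freq \<xi>)) powr s)"
        using mult_left_mono[OF a, of "norm (fcoeff \<xi> \<psi>)"] by (simp add: norm_mult mult_ac)
      also have "\<dots> \<le> B * (C * Ck_norm k \<psi> * (1 / (1 + norm (freq \<xi>)) ^ (2 * CARD('n))))"
        by (intro mult_left_mono C \<psi> B)
      finally show ?thesis by (simp add: mult_ac)
    qed
    ultimately have "norm (synthesis a \<psi>) \<le> (B * C * Ck_norm k \<psi>) * Z"
      unfolding synthesis_def using \<psi> norm_infsum_le[OF has_sum_infsum[OF summ[OF \<psi>]]] by auto
    then show ?thesis by (simp add: mult_ac)
  qed
  have "synthesis a (\<lambda>x. \<psi> x + \<theta> x) = synthesis a \<psi> + synthesis a \<theta>"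
    if "\<psi> \<in> torus_test" "\<theta> \<in> torus_test" for \<psi> \<theta>
    using that
    by (simp add: synthesis_def torus_test_add fcoeff_add torus_test_continuous_on distrib_right
        infsum_add summ)
  moreover have "synthesis a (\<lambda>x. c * \<psi> x) = c * synthesis a \<psi>" if "\<psi> \<in> torus_test" for c \<psi>
    using that by (simp add: synthesis_def torus_test_cmult fcoeff_cmult mult.assoc infsum_cmult_right summ)
  moreover have "synthesis a \<psi> = 0" if "\<psi> \<notin> torus_test" for \<psi>
    using that by (simp add: synthesis_def)
  ultimately show ?thesis
    unfolding distributions_def using bound by blast
qed

text \<open>Tested on a character, the defining series has a single nonzero term by
  orthogonality.\<close>

lemma fourier_synthesis: "fourier (synthesis a) \<xi> = a \<xi>"
proof -
  have "fourier (synthesis a) \<xi> = (\<Sum>\<^sub>\<infinity>\<eta>. if \<eta> = \<xi> then a \<xi> else 0)"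
    by (auto simp: fourier_eq synthesis_def character_in_torus_test fcoeff_character intro!: infsum_cong)
  also have "\<dots> = a \<xi>"
    by (subst infsum_cong_neutral[where T = "{\<xi>}" and g = "\<lambda>\<eta>. a \<xi>"]) auto
  finally show ?thesis .
qed

text \<open>Consequently a distribution is determined by its Fourier coefficients; uniqueness and
  the initial condition of the constructed solution are read off from this.\<close>

lemma synthesis_fourier:
  assumes "u \<in> distributions"
  shows "synthesis (fourier u) = u"
proof
  fix \<psi>
  show "synthesis (fourier u) \<psi> = u \<psi>"
    using assms infsumI[OF distribution_has_sum[OF assms]]
    by (auto simp: synthesis_def distributions_def)
qed

section \<open>Sobolev spaces through Fourier coefficients\<close>

text \<open>The general term of the squared H^r norm, stated for coefficient families so that
  estimates can precede the construction of a distribution.\<close>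

definition weighted_sq :: "real \<Rightarrow> (int^'n::finite \<Rightarrow> complex) \<Rightarrow> int^'n \<Rightarrow> real" where
  "weighted_sq r a \<xi> = (norm (a \<xi>))\<^sup>2 * (1 + norm (freq \<xi>)) powr (2 * r)"

lemma sobolev_iff: "u \<in> sobolev r \<longleftrightarrow> u \<in> distributions \<and> weighted_sq r (fourier u) summable_on UNIV"
  by (simp add: sobolev_def weighted_sq_def[abs_def])

lemma sobolev_norm_eq: "sobolev_norm r u = sqrt (infsum (weighted_sq r (fourier u)) UNIV)"
  by (simp add: sobolev_norm_def weighted_sq_def[abs_def])

lemma fourier_diff: "fourier (\<lambda>\<psi>. u \<psi> - v \<psi>) = (\<lambda>\<xi>. fourier u \<xi> - fourier v \<xi>)"
  by (simp add: fun_eq_iff fourier_eq)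

lemma weighted_sq_nonneg [simp]: "0 \<le> weighted_sq r a \<xi>"
  by (simp add: weighted_sq_def)

text \<open>Applied termwise, this stands in for the triangle inequality of the H^r norm and avoids
  Minkowski's inequality.\<close>

lemma norm_sq_add_le: "(norm (a + b))\<^sup>2 \<le> 2 * (norm a)\<^sup>2 + 2 * (norm b)\<^sup>2"
proof -
  have "(norm (a + b))\<^sup>2 \<le> (norm a + norm b)\<^sup>2"
    by (intro power_mono norm_triangle_ineq) simp
  also have "\<dots> \<le> 2 * (norm a)\<^sup>2 + 2 * (norm b)\<^sup>2"
    using sum_squares_bound[of "norm a" "norm b"] by (simp add: power2_sum)
  finally show ?thesis .
qed

lemma weighted_sq_add_le:
  "weighted_sq r (\<lambda>\<xi>. a \<xi> + b \<xi>) \<xi> \<le> 2 * weighted_sq r a \<xi> + 2 * weighted_sq r b \<xi>"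
  using mult_right_mono[OF norm_sq_add_le[of "a \<xi>" "b \<xi>"], of "(1 + norm (freq \<xi>)) powr (2 * r)"]
  by (simp add: weighted_sq_def algebra_simps)

lemma weighted_sq_add_summable:
  assumes "weighted_sq r a summable_on UNIV" "weighted_sq r b summable_on UNIV"
  shows "weighted_sq r (\<lambda>\<xi>. a \<xi> + b \<xi>) summable_on UNIV"
  by (rule summable_on_comparison_test[OF summable_on_add[OF summable_on_cmult_right[OF assms(1), of 2]
          summable_on_cmult_right[OF assms(2), of 2]] weighted_sq_add_le]) simp

lemma weighted_sq_diff_summable:
  assumes "weighted_sq r a summable_on UNIV" "weighted_sq r b summable_on UNIV"
  shows "weighted_sq r (\<lambda>\<xi>. a \<xi> - b \<xi>) summable_on UNIV"
proof -
  have "weighted_sq r (\<lambda>\<xi>. - b \<xi>) = weighted_sq r b"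
    by (simp add: weighted_sq_def fun_eq_iff)
  then show ?thesis
    using weighted_sq_add_summable[OF assms(1), of "\<lambda>\<xi>. - b \<xi>"] assms(2) by simp
qed

text \<open>One term of a nonnegative series is at most its sum. Elements of H^r thus have
  coefficients of polynomial growth, which is the hypothesis of
  \<open>synthesis_distribution\<close>.\<close>

lemma norm_le_weighted:
  assumes "weighted_sq r a summable_on UNIV"
  shows "norm (a \<xi>) \<le> sqrt (infsum (weighted_sq r a) UNIV) * (1 + norm (freq \<xi>)) powr (- r)"
proof -
  have pos: "0 < 1 + norm (freq \<xi>)"
    by (simp add: add_pos_nonneg)
  have "weighted_sq r a \<xi> \<le> infsum (weighted_sq r a) UNIV"
    using finite_sum_le_infsum[OF assms, of "{\<xi>}"] by simp
  then have "sqrt (weighted_sq r a \<xi>) \<le> sqrt (infsum (weighted_sq r a) UNIV)"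
    by simp
  moreover have "weighted_sq r a \<xi> = (norm (a \<xi>) * (1 + norm (freq \<xi>)) powr r)\<^sup>2"
    by (simp add: weighted_sq_def power_mult_distrib power2_eq_square[of "_ powr _"] flip: powr_add)
  ultimately have "norm (a \<xi>) * (1 + norm (freq \<xi>)) powr r \<le> sqrt (infsum (weighted_sq r a) UNIV)"
    by simp
  then show ?thesis
    using pos by (simp add: powr_minus field_simps)
qed

lemma C_sobolevD:
  assumes "u \<in> C_sobolev T r" "t \<in> {0..T}"
  shows "u t \<in> distributions" "weighted_sq r (fourier (u t)) summable_on UNIV"
  using assms by (auto simp: C_sobolev_def sobolev_iff)

lemma C_sobolev_diff_tendsto:
  assumes "u \<in> C_sobolev T r" "t \<in> {0..T}"
  shows "((\<lambda>s. sqrt (infsum (weighted_sq r (\<lambda>\<xi>. fourier (u s) \<xi> - fourier (u t) \<xi>)) UNIV)) \<longlongrightarrow> 0)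
    (at t within {0..T})"
  using assms by (simp add: C_sobolev_def sobolev_norm_eq fourier_diff)

lemma C_sobolev_fourier_continuous:
  assumes u: "u \<in> C_sobolev T r"
  shows "continuous_on {0..T} (\<lambda>t. fourier (u t) \<xi>)"
  unfolding continuous_on_def
proof
  fix t assume t: "t \<in> {0..T}"
  have "((\<lambda>s. sqrt (infsum (weighted_sq r (\<lambda>\<xi>. fourier (u s) \<xi> - fourier (u t) \<xi>)) UNIV)
      * (1 + norm (freq \<xi>)) powr (- r)) \<longlongrightarrow> 0) (at t within {0..T})"
    by (intro tendsto_mult_left_zero C_sobolev_diff_tendsto u t)
  then have "((\<lambda>s. fourier (u s) \<xi> - fourier (u t) \<xi>) \<longlongrightarrow> 0) (at t within {0..T})"
  proof (rule tendsto_0_le[where K = 1])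
    show "\<forall>\<^sub>F s in at t within {0..T}. norm (fourier (u s) \<xi> - fourier (u t) \<xi>) \<le>
        norm (sqrt (infsum (weighted_sq r (\<lambda>\<xi>. fourier (u s) \<xi> - fourier (u t) \<xi>)) UNIV)
          * (1 + norm (freq \<xi>)) powr (- r)) * 1"
      unfolding eventually_at_filter
    proof (intro always_eventually allI impI)
      fix s assume "s \<noteq> t" "s \<in> {0..T}"
      \<comment> \<open>A divergent series would have \<open>infsum\<close> equal to 0 and give no
        bound, so summability of the difference comes first.\<close>
      then have "weighted_sq r (\<lambda>\<xi>. fourier (u s) \<xi> - fourier (u t) \<xi>) summable_on UNIV"
        by (intro weighted_sq_diff_summable C_sobolevD[OF u] t)
      from norm_le_weighted[OF this, of \<xi>]
      show "norm (fourier (u s) \<xi> - fourier (u t) \<xi>) \<le>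
        norm (sqrt (infsum (weighted_sq r (\<lambda>\<xi>. fourier (u s) \<xi> - fourier (u t) \<xi>)) UNIV)
          * (1 + norm (freq \<xi>)) powr (- r)) * 1"
        by simp
    qed
  qed
  then show "((\<lambda>t. fourier (u t) \<xi>) \<longlongrightarrow> fourier (u t) \<xi>) (at t within {0..T})"
    by (rule LIM_zero_cancel)
qed

text \<open>A finite subcover replaces continuity: the termwise estimate with factors 2 bounds the
  squared H^r norm near each time but does not show that it is continuous.\<close>

lemma bounded_above_of_locally_bounded:
  fixes f :: "'a::metric_space \<Rightarrow> real"
  assumes "compact K" and loc: "\<And>t. t \<in> K \<Longrightarrow> \<exists>B. \<forall>\<^sub>F s in at t within K. f s \<le> B"
  obtains B where "\<And>s. s \<in> K \<Longrightarrow> f s \<le> B"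
proof -
  have "\<exists>d B. 0 < d \<and> (\<forall>s\<in>K. dist s t < d \<longrightarrow> f s \<le> B)" if t: "t \<in> K" for t
  proof -
    obtain B d where "0 < d" "\<forall>s\<in>K. s \<noteq> t \<and> dist s t < d \<longrightarrow> f s \<le> B"
      using loc[OF t] unfolding eventually_at by blast
    then show ?thesis
      \<comment> \<open>The filter \<open>at t within K\<close> omits the point \<open>t\<close>,
        whose value is added by the maximum.\<close>
      by (intro exI[of _ d] exI[of _ "max B (f t)"]) (auto simp: le_max_iff_disj)
  qed
  then obtain d B where dB: "\<And>t. t \<in> K \<Longrightarrow> 0 < d t" "\<And>s t. t \<in> K \<Longrightarrow> s \<in> K \<Longrightarrow> dist s t < d t \<Longrightarrow> f s \<le> B t"
    by metis
  have "K \<subseteq> (\<Union>t\<in>K. ball t (d t))"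
    using dB(1) by auto
  from compactE_image[OF assms(1) _ this] obtain C where C: "C \<subseteq> K" "finite C" "K \<subseteq> (\<Union>t\<in>C. ball t (d t))"
    by auto
  show ?thesis
  proof
    fix s assume s: "s \<in> K"
    then obtain t where t: "t \<in> C" "dist s t < d t"
      using C(3) by (auto simp: dist_commute)
    then have "f s \<le> B t" using dB(2) C(1) s by blast
    also have "\<dots> \<le> \<bar>B t\<bar>" by simp
    also have "\<dots> \<le> (\<Sum>t\<in>C. \<bar>B t\<bar>)"
      using t C(2) by (intro member_le_sum) auto
    finally show "f s \<le> (\<Sum>t\<in>C. \<bar>B t\<bar>)" .
  qed
qed

lemma C_sobolev_bounded:
  fixes u :: "real \<Rightarrow> 'n::finite functional"
  assumes u: "u \<in> C_sobolev T r"
  obtains B where "0 \<le> B" "\<And>t. t \<in> {0..T} \<Longrightarrow> infsum (weighted_sq r (fourier (u t))) UNIV \<le> B"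
    "\<And>t \<xi>. t \<in> {0..T} \<Longrightarrow> norm (fourier (u t) \<xi>) \<le> sqrt B * (1 + norm (freq \<xi>)) powr (- r)"
proof -
  have "\<exists>B. \<forall>\<^sub>F s in at t within {0..T}. infsum (weighted_sq r (fourier (u s))) UNIV \<le> B"
    if t: "t \<in> {0..T}" for t
  proof -
    let ?d = "\<lambda>s. infsum (weighted_sq r (\<lambda>\<xi>. fourier (u s) \<xi> - fourier (u t) \<xi>)) UNIV"
    have "\<forall>\<^sub>F s in at t within {0..T}. sqrt (?d s) < 1"
      by (rule order_tendstoD(2)[OF C_sobolev_diff_tendsto[OF u t]]) simp
    moreover have "\<forall>\<^sub>F s in at t within {0..T}. s \<in> {0..T}"
      by (simp add: eventually_at_filter)
    ultimately have "\<forall>\<^sub>F s in at t within {0..T}.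
        infsum (weighted_sq r (fourier (u s))) UNIV \<le> 2 * 1 + 2 * infsum (weighted_sq r (fourier (u t))) UNIV"
    proof eventually_elim
      case (elim s)
      note s = C_sobolevD(2)[OF u elim(2)] and t' = C_sobolevD(2)[OF u t]
      note sd = weighted_sq_diff_summable[OF s t']
      have "weighted_sq r (\<lambda>\<xi>. (fourier (u s) \<xi> - fourier (u t) \<xi>) + fourier (u t) \<xi>) \<xi> \<le>
          2 * weighted_sq r (\<lambda>\<xi>. fourier (u s) \<xi> - fourier (u t) \<xi>) \<xi> + 2 * weighted_sq r (fourier (u t)) \<xi>" for \<xi>
        by (rule weighted_sq_add_le)
      then have "weighted_sq r (fourier (u s)) \<xi> \<le>
          2 * weighted_sq r (\<lambda>\<xi>. fourier (u s) \<xi> - fourier (u t) \<xi>) \<xi> + 2 * weighted_sq r (fourier (u t)) \<xi>" for \<xi>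
        by simp
      then have "infsum (weighted_sq r (fourier (u s))) UNIV \<le>
          infsum (\<lambda>\<xi>. 2 * weighted_sq r (\<lambda>\<xi>. fourier (u s) \<xi> - fourier (u t) \<xi>) \<xi> + 2 * weighted_sq r (fourier (u t)) \<xi>) UNIV"
        by (intro infsum_mono s summable_on_add summable_on_cmult_right sd t')
      also have "\<dots> = 2 * ?d s + 2 * infsum (weighted_sq r (fourier (u t))) UNIV"
        by (subst infsum_add) (simp_all add: infsum_cmult_right summable_on_cmult_right sd t')
      finally show ?case using elim(1) by simp
    qed
    then show ?thesis by blast
  qed
  from bounded_above_of_locally_bounded[OF compact_Icc this]
  obtain B where B: "\<And>t. t \<in> {0..T} \<Longrightarrow> infsum (weighted_sq r (fourier (u t))) UNIV \<le> B"
    by blast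
  show ?thesis
  proof (rule that[of "max 0 B"])
    fix t \<xi> assume t: "t \<in> {0..T}"
    show B': "infsum (weighted_sq r (fourier (u t))) UNIV \<le> max 0 B"
      using B[OF t] by simp
    have "norm (fourier (u t) \<xi>) \<le> sqrt (infsum (weighted_sq r (fourier (u t))) UNIV) * (1 + norm (freq \<xi>)) powr (- r)"
      by (rule norm_le_weighted[OF C_sobolevD(2)[OF u t]])
    also have "\<dots> \<le> sqrt (max 0 B) * (1 + norm (freq \<xi>)) powr (- r)"
      using B' by (intro mult_right_mono) auto
    finally show "norm (fourier (u t) \<xi>) \<le> sqrt (max 0 B) * (1 + norm (freq \<xi>)) powr (- r)" .
  qed simp
qed

text \<open>A majorant independent of t allows limits and integrals in time to be taken termwise.
  The second part recovers the equation tested with an arbitrary \<psi> from the equations of the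
  single frequencies.\<close>

lemma fourier_series_time:
  fixes a :: "int^'n::finite \<Rightarrow> real \<Rightarrow> complex"
  assumes \<psi>: "\<psi> \<in> torus_test" and cont: "\<And>\<xi>. continuous_on {0..T} (a \<xi>)"
    and a: "\<And>\<xi> t. t \<in> {0..T} \<Longrightarrow> norm (a \<xi> t) \<le> B * (1 + norm (freq \<xi>)) powr s"
    and U: "\<And>t. t \<in> {0..T} \<Longrightarrow> ((\<lambda>\<xi>. fcoeff \<xi> \<psi> * a \<xi> t) has_sum U t) UNIV"
  shows "continuous_on {0..T} U"
    and "(\<And>\<xi>. integral {0..T} (a \<xi>) = 0) \<Longrightarrow> integral {0..T} U = 0"
proof -
  have ul: "uniform_limit {0..T} (\<lambda>F t. \<Sum>\<xi>\<in>F. fcoeff \<xi> \<psi> * a \<xi> t) U (finite_subsets_at_top UNIV)"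
  proof (rule Weierstrass_m_test_general'[where M = "\<lambda>\<xi>. B * (norm (fcoeff \<xi> \<psi>) * (1 + norm (freq \<xi>)) powr s)"])
    show "norm (fcoeff \<xi> \<psi> * a \<xi> t) \<le> B * (norm (fcoeff \<xi> \<psi>) * (1 + norm (freq \<xi>)) powr s)"
      if "t \<in> {0..T}" for \<xi> t
      using mult_left_mono[OF a[OF that], of "norm (fcoeff \<xi> \<psi>)"] by (simp add: norm_mult mult_ac)
  qed (auto intro!: U summable_on_cmult_right fcoeff_summable \<psi>)
  show "continuous_on {0..T} U"
    by (rule uniform_limit_theorem[OF _ ul]) (auto intro!: always_eventually continuous_intros cont)
  assume z: "\<And>\<xi>. integral {0..T} (a \<xi>) = 0"
  obtain I J where I: "\<And>F. ((\<lambda>t. \<Sum>\<xi>\<in>F. fcoeff \<xi> \<psi> * a \<xi> t) has_integral I F) {0..T}"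
    and J: "(U has_integral J) {0..T}" and lim: "(I \<longlongrightarrow> J) (finite_subsets_at_top UNIV)"
    by (rule uniform_limit_integral[OF ul]) (auto intro!: continuous_intros cont)
  have z': "(a \<xi> has_integral 0) {0..T}" for \<xi>
    using integrable_integral[OF integrable_continuous_interval[OF cont[of \<xi>]]] z by simp
  have "\<forall>\<^sub>F F in finite_subsets_at_top UNIV. I F = 0"
  proof (rule eventually_finite_subsets_at_top_weakI)
    fix F :: "(int^'n) set" assume F: "finite F"
    have "((\<lambda>t. \<Sum>\<xi>\<in>F. fcoeff \<xi> \<psi> * a \<xi> t) has_integral (\<Sum>\<xi>\<in>F. fcoeff \<xi> \<psi> * 0)) {0..T}"
      by (intro has_integral_sum has_integral_mult_right z' F)
    from has_integral_unique[OF I this] show "I F = 0"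
      by simp
  qed
  then have "(I \<longlongrightarrow> 0) (finite_subsets_at_top UNIV)"
    by (rule tendsto_eventually)
  then have "J = 0"
    by (rule tendsto_unique[OF finite_subsets_at_top_neq_bot lim])
  then show "integral {0..T} U = 0"
    using J by (simp add: integral_unique)
qed

section \<open>Weak derivatives in time\<close>

lemma has_vector_derivative_dir_deriv:
  fixes f :: "real \<Rightarrow> complex"
  assumes "f differentiable (at t)"
  shows "(f has_vector_derivative dir_deriv 1 f t) (at t within A)"
proof -
  have D: "(f has_derivative (\<lambda>e. dir_deriv e f t)) (at t)"
    by (rule has_derivative_frechet[OF assms])
  have "(\<lambda>e. dir_deriv e f t) = (\<lambda>e. e *\<^sub>R dir_deriv 1 f t)"
    using linear_scale[OF has_derivative_linear[OF D], of _ 1] by (intro ext) (metis mult.right_neutral real_scaleR_def)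
  with D have "(f has_derivative (\<lambda>e. e *\<^sub>R dir_deriv 1 f t)) (at t)"
    by (simp only:)
  then show ?thesis
    unfolding has_vector_derivative_def by (rule has_derivative_at_withinI)
qed

lemma has_vector_derivative_imp_continuous_on:
  assumes "\<And>t. t \<in> S \<Longrightarrow> (v has_vector_derivative v' t) (at t within S)"
  shows "continuous_on S v"
  unfolding continuous_on_eq_continuous_within
  using assms has_vector_derivative_continuous by blast

lemma dir_deriv_1_eq:
  fixes f :: "real \<Rightarrow> complex"
  assumes "(f has_vector_derivative d) (at t)"
  shows "dir_deriv 1 f t = d"
  using dir_deriv_eq[OF assms[unfolded has_vector_derivative_def]] by simp

text \<open>The chain rule produces a factor \<open>a\<close>, so the invariant class consists of
  scalar multiples.\<close>

lemma smooth_real_affine: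
  fixes f :: "real \<Rightarrow> complex"
  assumes "smooth f"
  shows "smooth (\<lambda>t. f (a * t + b))"
proof (rule smooth_coinduct[where S = "{\<lambda>t. c * f (a * t + b) | c f. smooth f}"])
  show "(\<lambda>t. f (a * t + b)) \<in> {\<lambda>t. c * f (a * t + b) | c f. smooth f}"
    using assms by (auto intro!: exI[of _ 1] exI[of _ f])
  have vd: "((\<lambda>t. c * g (a * t + b)) has_vector_derivative (c * complex_of_real a) * dir_deriv 1 g (a * t + b)) (at t)"
    if "smooth g" for c g t
  proof -
    have "((\<lambda>t. a * t + b) has_vector_derivative a) (at t)"
      by (auto intro!: derivative_eq_intros simp: has_vector_derivative_def)
    from vector_diff_chain_at[OF this has_vector_derivative_dir_deriv[OF smooth_imp_differentiable[OF that]]]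
    have "((\<lambda>t. g (a * t + b)) has_vector_derivative a *\<^sub>R dir_deriv 1 g (a * t + b)) (at t)"
      by (simp add: o_def)
    from has_vector_derivative_mult_right[OF this, of c]
    show ?thesis by (simp add: scaleR_conv_of_real mult.assoc)
  qed
  show "h differentiable (at t)" if "h \<in> {\<lambda>t. c * f (a * t + b) | c f. smooth f}" for h t
    using that vd differentiableI_vector by blast
  show "dir_deriv e h \<in> {\<lambda>t. c * f (a * t + b) | c f. smooth f}"
    if h: "h \<in> {\<lambda>t. c * f (a * t + b) | c f. smooth f}" and e: "e \<in> Basis" for h e
  proof -
    obtain c g where h: "h = (\<lambda>t. c * g (a * t + b))" and g: "smooth g"
      using h by blast
    have "dir_deriv e h = (\<lambda>t. (c * complex_of_real a) * dir_deriv 1 g (a * t + b))"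
      using e dir_deriv_1_eq[OF vd[OF g, of c]] by (simp add: fun_eq_iff h)
    moreover have "smooth (dir_deriv 1 g)"
      by (rule smooth_dir_deriv[OF g]) simp
    ultimately show ?thesis by blast
  qed
qed

text \<open>The derivative of \<open>p (1/x) e\<^sup>-\<^sup>1\<^sup>/\<^sup>x\<close> has the same form, so the functions \<open>flat p\<close> are smooth by
  coinduction.\<close>

definition flat :: "real poly \<Rightarrow> real \<Rightarrow> real" where
  "flat p x = (if 0 < x then poly p (1 / x) * exp (- (1 / x)) else 0)"

lemma poly_exp_tendsto_0: "((\<lambda>y. poly p y * exp (- y)) \<longlongrightarrow> 0) at_top" for p :: "real poly"
proof -
  have "((\<lambda>y. \<Sum>i\<le>degree p. coeff p i * (y ^ i / exp y)) \<longlongrightarrow> (\<Sum>i\<le>degree p. coeff p i * 0)) at_top"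
    by (intro tendsto_sum tendsto_mult tendsto_const tendsto_power_div_exp_0)
  then show ?thesis
    by (simp add: poly_altdef exp_minus field_simps sum_divide_distrib)
qed

text \<open>With y = 1/x, the derivative of p(y) e^{-y} in x is y^2 (p(y) - p'(y)) e^{-y}. At 0 the
  right difference quotient is y p(y) e^{-y}, which tends to 0 as y grows.\<close>

lemma flat_has_derivative: "(flat p has_real_derivative flat ([:0, 0, 1:] * (p - pderiv p)) x) (at x)"
proof (cases x "0::real" rule: linorder_cases)
  case less
  have "((\<lambda>x. 0) has_real_derivative 0) (at x)" by simp
  then have "(flat p has_real_derivative 0) (at x)"
    by (rule has_field_derivative_transform_within_open[where S = "{..<0}"]) (use less in \<open>auto simp: flat_def\<close>)
  then show ?thesis using less by (simp add: flat_def)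
next
  case greater
  have "((\<lambda>x. poly p (1 / x) * exp (- (1 / x))) has_real_derivative flat ([:0, 0, 1:] * (p - pderiv p)) x) (at x)"
    using greater
    by (auto intro!: derivative_eq_intros DERIV_chain2[OF poly_DERIV]
        simp: flat_def algebra_simps power2_eq_square divide_simps)
  then show ?thesis
    by (rule has_field_derivative_transform_within_open[where S = "{0<..}"]) (use greater in \<open>auto simp: flat_def\<close>)
next
  case equal
  have "((\<lambda>h. poly ([:0, 1:] * p) (1 / h) * exp (- (1 / h))) \<longlongrightarrow> 0) (at_right 0)"
    using filterlim_compose[OF poly_exp_tendsto_0 filterlim_inverse_at_top_right, of "[:0, 1:] * p"]
    by (simp add: inverse_eq_divide)
  then have "((\<lambda>h. flat p h / h) \<longlongrightarrow> 0) (at_right 0)"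
    by (rule Lim_transform_eventually) (auto simp: eventually_at_filter flat_def)
  moreover have "((\<lambda>h. flat p h / h) \<longlongrightarrow> 0) (at_left 0)"
    by (rule tendsto_eventually) (auto simp: eventually_at_filter flat_def)
  ultimately have "((\<lambda>h. flat p h / h) \<longlongrightarrow> 0) (at 0)"
    by (simp add: filterlim_split_at)
  then show ?thesis
    unfolding DERIV_def equal by (simp add: flat_def)
qed

lemma smooth_flat: "smooth (\<lambda>x. complex_of_real (flat p x))"
proof (rule smooth_coinduct[where S = "range (\<lambda>p x. complex_of_real (flat p x))"])
  have vd: "((\<lambda>x. complex_of_real (flat p x)) has_vector_derivative
      complex_of_real (flat ([:0, 0, 1:] * (p - pderiv p)) x)) (at x)" for p x
    by (intro has_vector_derivative_of_real has_real_derivative_iff_has_vector_derivative[THEN iffD1] flat_has_derivative)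
  show "h differentiable (at x)" if "h \<in> range (\<lambda>p x. complex_of_real (flat p x))" for h x
    using that vd differentiableI_vector by blast
  show "dir_deriv e h \<in> range (\<lambda>p x. complex_of_real (flat p x))"
    if h: "h \<in> range (\<lambda>p x. complex_of_real (flat p x))" and e: "e \<in> Basis" for h e
  proof -
    obtain p where h: "h = (\<lambda>x. complex_of_real (flat p x))"
      using h by blast
    have "dir_deriv e h = (\<lambda>x. complex_of_real (flat ([:0, 0, 1:] * (p - pderiv p)) x))"
      using e dir_deriv_1_eq[OF vd[of p]] by (simp add: fun_eq_iff h)
    then show ?thesis by blast
  qed
qed simp

text \<open>Positive exactly between 0 and d. The support begins at 0 instead of being centred, so
  the translate to \<open>s\<close> is a test function whenever 0 < s and s + d < T.\<close>

definition bump :: "real \<Rightarrow> real \<Rightarrow> real" where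
  "bump d t = flat 1 t * flat 1 (d - t)"

lemma bump_nonneg: "0 \<le> bump d t"
  by (simp add: bump_def flat_def)

lemma bump_pos_iff: "0 < bump d t \<longleftrightarrow> t \<in> {0<..<d}"
  by (auto simp: bump_def flat_def)

lemma bump_eq_0: "t \<notin> {0..d} \<Longrightarrow> bump d t = 0"
  by (auto simp: bump_def flat_def)

lemma smooth_bump: "smooth (\<lambda>t. complex_of_real (bump d t))"
proof -
  have "smooth (\<lambda>t. complex_of_real (flat 1 t) * complex_of_real (flat 1 (- 1 * t + d)))"
    by (intro smooth_mult smooth_flat smooth_real_affine[OF smooth_flat])
  then show ?thesis by (simp add: bump_def add.commute)
qed

lemma continuous_on_bump: "continuous_on A (bump d)"
proof -
  have "continuous_on A (\<lambda>t. Re (complex_of_real (bump d t)))"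
    by (intro continuous_intros smooth_imp_continuous_on smooth_bump)
  then show ?thesis by simp
qed

section \<open>Test functions in time and the lemma of du Bois-Reymond\<close>

lemma time_testD:
  assumes "\<phi> \<in> time_test T"
  shows "smooth \<phi>" "t \<notin> {0<..<T} \<Longrightarrow> \<phi> t = 0"
  using assms by (auto simp: time_test_def)

lemma time_test_deriv:
  assumes "\<phi> \<in> time_test T"
  shows "(\<phi> has_vector_derivative dir_deriv 1 \<phi> t) (at t within A)"
  by (intro has_vector_derivative_dir_deriv smooth_imp_differentiable time_testD[OF assms])

lemma time_test_continuous:
  assumes "\<phi> \<in> time_test T"
  shows "continuous_on A \<phi>" "continuous_on A (dir_deriv 1 \<phi>)"
  using assms by (auto intro!: smooth_imp_continuous_on smooth_dir_deriv dest: time_testD)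

lemma bump_time_test:
  assumes "0 < s" "s + d < T"
  shows "(\<lambda>t. complex_of_real (bump d (t - s))) \<in> time_test T"
proof -
  have "smooth (\<lambda>t. complex_of_real (bump d (1 * t + (- s))))"
    by (rule smooth_real_affine[OF smooth_bump])
  moreover have "compact {s..s + d} \<and> {s..s + d} \<subseteq> {0<..<T} \<and>
      (\<forall>t. t \<notin> {s..s + d} \<longrightarrow> complex_of_real (bump d (t - s)) = 0)"
    using assms by (auto simp: bump_eq_0)
  ultimately show ?thesis
    unfolding time_test_def by (intro CollectI conjI exI[of _ "{s..s + d}"]) simp_all
qed

text \<open>Integration by parts; the boundary terms vanish with \<phi> at both ends.\<close>

lemma weak_derivative:
  assumes T: "0 < T" and v: "\<And>t. t \<in> {0..T} \<Longrightarrow> (v has_vector_derivative v' t) (at t within {0..T})"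
    and v': "continuous_on {0..T} v'" and \<phi>: "\<phi> \<in> time_test T"
  shows "integral {0..T} (\<lambda>t. v t * dir_deriv 1 \<phi> t) = - integral {0..T} (\<lambda>t. v' t * \<phi> t)"
proof -
  have cv: "continuous_on {0..T} v"
    by (rule has_vector_derivative_imp_continuous_on[OF v])
  have "((\<lambda>t. v t * dir_deriv 1 \<phi> t + v' t * \<phi> t) has_integral v T * \<phi> T - v 0 * \<phi> 0) {0..T}"
    by (rule fundamental_theorem_of_calculus)
      (use T in \<open>auto intro!: has_vector_derivative_mult v time_test_deriv[OF \<phi>]\<close>)
  then have "integral {0..T} (\<lambda>t. v t * dir_deriv 1 \<phi> t + v' t * \<phi> t) = 0"
    by (simp add: time_testD(2)[OF \<phi>] integral_unique)
  then show ?thesis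
    by (subst (asm) integral_add)
      (auto intro!: integrable_continuous_interval continuous_intros cv v' time_test_continuous[OF \<phi>]
        simp: eq_neg_iff_add_eq_0)
qed

text \<open>The derivative of the integral in the translation parameter x is minus \<open>G\<close>
  integrated against the derivative of the translated bump, a test function throughout the range of
  x. The weak hypothesis makes it zero.\<close>

lemma mollified_constant:
  fixes G :: "real \<Rightarrow> complex"
  assumes G: "continuous_on {0..T} G"
    and weak: "\<And>\<phi>. \<phi> \<in> time_test T \<Longrightarrow> integral {0..T} (\<lambda>t. G t * dir_deriv 1 \<phi> t) = 0"
    and s: "0 < s" "s \<le> s'" "s' + d < T"
  shows "integral {0..T} (\<lambda>t. G t * bump d (t - s)) = integral {0..T} (\<lambda>t. G t * bump d (t - s'))"
proof -
  define \<eta> where "\<eta> t = complex_of_real (bump d t)" for t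
  have \<eta>: "smooth \<eta>" unfolding \<eta>_def by (rule smooth_bump)
  have c\<eta>: "continuous_on UNIV \<eta>" "continuous_on UNIV (dir_deriv 1 \<eta>)"
    by (intro smooth_imp_continuous_on \<eta> smooth_dir_deriv, simp)+
  have shift: "((\<lambda>t. \<eta> (t - x)) has_vector_derivative dir_deriv 1 \<eta> (t - x)) (at t)" for t x
  proof -
    have "((\<lambda>t. t - x) has_vector_derivative 1) (at t)"
      by (auto intro!: derivative_eq_intros)
    from vector_diff_chain_at[OF this has_vector_derivative_dir_deriv[OF smooth_imp_differentiable[OF \<eta>]]]
    show ?thesis by (simp add: o_def)
  qed
  have shift': "((\<lambda>x. \<eta> (t - x)) has_vector_derivative - dir_deriv 1 \<eta> (t - x)) (at x within A)" for t x A
  proof -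
    have "((\<lambda>x. t - x) has_vector_derivative - 1) (at x)"
      by (auto intro!: derivative_eq_intros)
    from vector_diff_chain_at[OF this has_vector_derivative_dir_deriv[OF smooth_imp_differentiable[OF \<eta>]]]
    show ?thesis by (auto simp: o_def intro: has_vector_derivative_at_within)
  qed
  have "((\<lambda>x. integral {0..T} (\<lambda>t. G t * \<eta> (t - x))) has_vector_derivative 0) (at x within {s..s'})"
    if x: "x \<in> {s..s'}" for x
  proof -
    have "((\<lambda>x. integral (cbox 0 T) (\<lambda>t. G t * \<eta> (t - x))) has_vector_derivative
        integral (cbox 0 T) (\<lambda>t. G t * - dir_deriv 1 \<eta> (t - x))) (at x within {s..s'})"
    proof (rule leibniz_rule_vector_derivative[where fx = "\<lambda>x t. G t * - dir_deriv 1 \<eta> (t - x)"])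
      show "((\<lambda>x. G t * \<eta> (t - x)) has_vector_derivative G t * - dir_deriv 1 \<eta> (t - x)) (at x within {s..s'})" for x t
        by (intro has_vector_derivative_mult_right shift')
      show "(\<lambda>t. G t * \<eta> (t - x)) integrable_on cbox 0 T" for x
        unfolding box_real
        by (intro integrable_continuous_interval continuous_intros G continuous_on_compose2[OF c\<eta>(1)]) auto
      show "continuous_on ({s..s'} \<times> cbox 0 T) (\<lambda>(x, t). G t * - dir_deriv 1 \<eta> (t - x))"
        unfolding split_beta box_real
        by (intro continuous_intros continuous_on_compose2[OF G] continuous_on_compose2[OF c\<eta>(2)]) auto
    qed (use x in auto)
    moreover have "integral {0..T} (\<lambda>t. G t * dir_deriv 1 \<eta> (t - x)) = 0"
      using weak[OF bump_time_test[of x d T]] x s dir_deriv_1_eq[OF shift[of x]]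
      by (simp add: \<eta>_def[symmetric])
    ultimately show ?thesis by (simp add: box_real)
  qed
  then obtain c where "\<And>x. x \<in> {s..s'} \<Longrightarrow> integral {0..T} (\<lambda>t. G t * \<eta> (t - x)) = c"
    by (rule has_vector_derivative_zero_constant[OF convex_real_interval(5)]) blast+
  then show ?thesis
    using s by (simp add: \<eta>_def)
qed

text \<open>Averages of \<open>G\<close> against one narrow bump placed at \<open>s\<close> and at
  \<open>s'\<close> coincide, and continuity makes each close to the value there.\<close>

lemma du_Bois_Reymond:
  fixes G :: "real \<Rightarrow> complex"
  assumes G: "continuous_on {0..T} G"
    and weak: "\<And>\<phi>. \<phi> \<in> time_test T \<Longrightarrow> integral {0..T} (\<lambda>t. G t * dir_deriv 1 \<phi> t) = 0"
    and s: "0 < s" "s < s'" "s' < T"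
  shows "G s = G s'"
proof -
  have small: "norm (G s - G s') \<le> 2 * e" if e: "0 < e" for e
  proof -
    have near: "\<exists>\<delta>>0. \<forall>t\<in>{0..T}. \<bar>t - x\<bar> < \<delta> \<longrightarrow> norm (G t - G x) < e" if "x \<in> {0..T}" for x
      using G that e unfolding continuous_on_iff dist_norm real_norm_def by blast
    obtain \<delta> where \<delta>: "0 < \<delta>" "\<And>t. t \<in> {0..T} \<Longrightarrow> \<bar>t - s\<bar> < \<delta> \<Longrightarrow> norm (G t - G s) < e"
      using near[of s] s by auto
    obtain \<delta>' where \<delta>': "0 < \<delta>'" "\<And>t. t \<in> {0..T} \<Longrightarrow> \<bar>t - s'\<bar> < \<delta>' \<Longrightarrow> norm (G t - G s') < e"
      using near[of s'] s by auto
    \<comment> \<open>Narrow enough for both continuity estimates, and for the bump placed at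
      \<open>s'\<close> to end before \<open>T\<close>.\<close>
    define d where "d = min (min \<delta> \<delta>') (T - s') / 2"
    have d: "0 < d" "d < \<delta>" "d < \<delta>'" "s' + d < T"
      using \<delta>(1) \<delta>'(1) s by (auto simp: d_def min_def field_simps)
    define D where "D x = integral {0..T} (\<lambda>t. bump d (t - x))" for x
    have cb: "continuous_on {0..T} (\<lambda>t. bump d (t - x))" for x
      by (intro continuous_on_compose2[OF continuous_on_bump[of UNIV]] continuous_intros) auto
    \<comment> \<open>That both bumps have the same mass is the previous lemma for the constant
      function 1, whose weak derivative vanishes.\<close>
    have "integral {0..T} (\<lambda>t. 1 * complex_of_real (bump d (t - s))) =
        integral {0..T} (\<lambda>t. 1 * complex_of_real (bump d (t - s')))"
    proof (rule mollified_constant[where G = "\<lambda>t. 1"])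
      show "integral {0..T} (\<lambda>t. 1 * dir_deriv 1 \<phi> t) = 0" if "\<phi> \<in> time_test T" for \<phi>
        by (subst weak_derivative[where v = "\<lambda>t. 1" and v' = "\<lambda>t. 0"])
          (use s that in \<open>auto intro!: derivative_eq_intros\<close>)
    qed (use s d in auto)
    moreover have iD: "((\<lambda>t. complex_of_real (bump d (t - x))) has_integral complex_of_real (D x)) {0..T}" for x
      using has_integral_linear[OF integrable_integral[OF integrable_continuous_interval[OF cb]] bounded_linear_of_real[where 'a=complex]]
      by (simp add: D_def o_def)
    ultimately have DD: "D s = D s'"
      by (simp add: integral_unique[OF iD])
    have Dpos: "0 < D s"
    proof -
      have "0 \<le> D s" unfolding D_def
        by (intro integral_nonneg integrable_continuous_interval cb bump_nonneg)
      moreover have "D s \<noteq> 0"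
      proof
        assume "D s = 0"
        then have "\<And>t. t \<in> {0..T} \<Longrightarrow> bump d (t - s) = 0"
          using integral_eq_0_iff[OF cb, of s] s by (auto simp: D_def bump_nonneg)
        from this[of "s + d / 2"] show False
          using bump_pos_iff[of d "d / 2"] s d by (auto simp: field_simps)
      qed
      ultimately show ?thesis by simp
    qed
    have close: "norm (integral {0..T} (\<lambda>t. G t * bump d (t - x)) - G x * D x) \<le> e * D x"
      if x: "\<And>t. t \<in> {0..T} \<Longrightarrow> \<bar>t - x\<bar> \<le> d \<Longrightarrow> norm (G t - G x) < e" for x
    proof -
      have iG: "(\<lambda>t. G t * complex_of_real (bump d (t - x))) integrable_on {0..T}"
        by (intro integrable_continuous_interval continuous_intros G cb)
      have ic: "((\<lambda>t. G x * complex_of_real (bump d (t - x))) has_integral G x * complex_of_real (D x)) {0..T}"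
        by (intro has_integral_mult_right iD)
      have "integral {0..T} (\<lambda>t. G t * complex_of_real (bump d (t - x))) - G x * D x =
          integral {0..T} (\<lambda>t. G t * complex_of_real (bump d (t - x)) - G x * complex_of_real (bump d (t - x)))"
        by (subst integral_diff[OF iG]) (use ic in \<open>auto simp: integral_unique[OF iD]\<close>)
      also have "norm \<dots> \<le> integral {0..T} (\<lambda>t. e * bump d (t - x))"
      proof (rule integral_norm_bound_integral)
        show "(\<lambda>t. G t * complex_of_real (bump d (t - x)) - G x * complex_of_real (bump d (t - x))) integrable_on {0..T}"
          using iG ic by (intro integrable_diff) auto
        show "(\<lambda>t. e * bump d (t - x)) integrable_on {0..T}"
          by (intro integrable_continuous_interval continuous_intros cb)
        show "norm (G t * complex_of_real (bump d (t - x)) - G x * complex_of_real (bump d (t - x))) \<le> e * bump d (t - x)"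
          if t: "t \<in> {0..T}" for t
        proof -
          have "norm (G t * complex_of_real (bump d (t - x)) - G x * complex_of_real (bump d (t - x))) =
              norm (G t - G x) * bump d (t - x)"
            by (simp add: left_diff_distrib[symmetric] norm_mult bump_nonneg)
          also have "\<dots> \<le> e * bump d (t - x)"
          proof (cases "t - x \<in> {0..d}")
            case True
            then show ?thesis using x[OF t] by (intro mult_right_mono bump_nonneg) (simp add: less_imp_le)
          qed (simp add: bump_eq_0)
          finally show ?thesis .
        qed
      qed
      finally show ?thesis by (simp add: D_def)
    qed
    have eq: "integral {0..T} (\<lambda>t. G t * bump d (t - s)) = integral {0..T} (\<lambda>t. G t * bump d (t - s'))"
      using s d by (intro mollified_constant[OF G weak]) auto
    let ?I = "integral {0..T} (\<lambda>t. G t * bump d (t - s))"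
    have "norm (?I - G s * D s) \<le> e * D s"
      using \<delta>(2) d by (intro close) auto
    moreover have "norm (?I - G s' * D s) \<le> e * D s"
      unfolding eq DD using \<delta>'(2) d by (intro close) auto
    ultimately have "norm (?I - G s' * D s) + norm (?I - G s * D s) \<le> e * D s + e * D s"
      by (rule add_mono[rotated])
    then have "norm ((?I - G s' * D s) - (?I - G s * D s)) \<le> e * D s + e * D s"
      by (rule order_trans[OF norm_triangle_ineq4])
    moreover have "(?I - G s' * D s) - (?I - G s * D s) = (G s - G s') * D s"
      by (simp add: algebra_simps)
    ultimately have "norm ((G s - G s') * D s) \<le> e * D s + e * D s"
      by (simp only:)
    then have "norm (G s - G s') * D s \<le> (2 * e) * D s"
      using Dpos by (simp add: norm_mult)
    then show ?thesis
      using Dpos by simp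
  qed
  have "norm (G s - G s') \<le> 0"
  proof (rule field_le_epsilon)
    show "norm (G s - G s') \<le> 0 + e" if "0 < e" for e
      using small[of "e / 2"] that by simp
  qed
  then show ?thesis by simp
qed

text \<open>The difference of \<open>w\<close> and a primitive of \<open>h\<close> has vanishing
  weak derivative, so it is constant on the open interval and, by continuity, up to the
  endpoints.\<close>

lemma weak_imp_classical:
  fixes w h :: "real \<Rightarrow> complex"
  assumes T: "0 < T" and w: "continuous_on {0..T} w" and h: "continuous_on {0..T} h"
    and weak: "\<And>\<phi>. \<phi> \<in> time_test T \<Longrightarrow>
      integral {0..T} (\<lambda>t. w t * dir_deriv 1 \<phi> t) = - integral {0..T} (\<lambda>t. h t * \<phi> t)"
    and t: "t \<in> {0..T}"
  shows "(w has_vector_derivative h t) (at t within {0..T})"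
proof -
  define H where "H t = integral {0..t} h" for t
  have H: "(H has_vector_derivative h t) (at t within {0..T})" if "t \<in> {0..T}" for t
    unfolding H_def using integral_has_vector_derivative[OF h that] .
  have cH: "continuous_on {0..T} H"
    by (rule has_vector_derivative_imp_continuous_on[OF H])
  define G where "G t = w t - H t" for t
  have cG: "continuous_on {0..T} G"
    unfolding G_def by (intro continuous_intros w cH)
  have "integral {0..T} (\<lambda>t. G t * dir_deriv 1 \<phi> t) = 0" if \<phi>: "\<phi> \<in> time_test T" for \<phi>
  proof -
    have wH: "integral {0..T} (\<lambda>t. H t * dir_deriv 1 \<phi> t) = - integral {0..T} (\<lambda>t. h t * \<phi> t)"
      by (rule weak_derivative[OF T H h \<phi>])
    have "integral {0..T} (\<lambda>t. w t * dir_deriv 1 \<phi> t - H t * dir_deriv 1 \<phi> t) = 0"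
      by (subst integral_diff)
        (auto intro!: integrable_continuous_interval continuous_intros w cH time_test_continuous[OF \<phi>]
          simp: weak[OF \<phi>] wH)
    then show ?thesis by (simp add: G_def left_diff_distrib)
  qed
  note dBR = du_Bois_Reymond[OF cG this]
  have const: "G x = G (T / 2)" if x: "x \<in> {0<..<T}" for x
  proof (cases x "T / 2" rule: linorder_cases)
    case less
    then show ?thesis using x T by (intro dBR) auto
  next
    case greater
    then show ?thesis using x T by (intro dBR[symmetric]) auto
  next
    case equal
    then show ?thesis by (simp only:)
  qed
  have cl: "closure {0<..<T} = {0..T}"
    using T by (rule closure_greaterThanLessThan)
  have "G x = G (T / 2)" if "x \<in> {0..T}" for x
    by (rule continuous_constant_on_closure[where S = "{0<..<T}", unfolded cl, OF cG const that])
  then have eq: "w x = G (T / 2) + H x" if "x \<in> {0..T}" for x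
    using that by (simp add: G_def algebra_simps)
  have "((\<lambda>x. G (T / 2) + H x) has_vector_derivative h t) (at t within {0..T})"
    using has_vector_derivative_add[OF has_vector_derivative_const H[OF t]] by simp
  from has_vector_derivative_transform[OF t _ this] show ?thesis
    using eq by blast
qed

section \<open>Scalar linear equations\<close>

text \<open>The integrating factor \<open>E\<close> has no zeros and makes w E constant.\<close>

lemma scalar_ode_unique:
  fixes w m :: "real \<Rightarrow> complex"
  assumes m: "continuous_on {0..T} m"
    and w: "\<And>t. t \<in> {0..T} \<Longrightarrow> (w has_vector_derivative m t * w t) (at t within {0..T})"
    and "w 0 = 0" and t: "t \<in> {0..T}"
  shows "w t = 0"
proof -
  define E where "E t = exp (- integral {0..t} m)" for t
  have E: "(E has_vector_derivative - m t * E t) (at t within {0..T})" if "t \<in> {0..T}" for t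
  proof -
    have "((\<lambda>t. - integral {0..t} m) has_vector_derivative - m t) (at t within {0..T})"
      by (intro has_vector_derivative_minus integral_has_vector_derivative m that)
    from field_vector_diff_chain_within[OF this DERIV_subset[OF DERIV_exp]]
    show ?thesis by (simp add: E_def[abs_def] o_def)
  qed
  have "((\<lambda>t. w t * E t) has_vector_derivative 0) (at t within {0..T})" if "t \<in> {0..T}" for t
    using has_vector_derivative_mult[OF w[OF that] E[OF that]] by (simp add: algebra_simps)
  then obtain c where c: "\<And>t. t \<in> {0..T} \<Longrightarrow> w t * E t = c"
    by (rule has_vector_derivative_zero_constant[OF convex_real_interval(5)]) blast+
  have "w t * E t = w 0 * E 0"
    using c[OF t] c[of 0] t by simp
  then show ?thesis
    using \<open>w 0 = 0\<close> by (simp add: E_def)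
qed

text \<open>In the bound only exp (A t - A s) with s \<le> t occurs, whose modulus depends on Re m
  alone. An arbitrarily large imaginary part of \<open>m\<close>, as at high frequencies, does no
  harm.\<close>

lemma scalar_ode_solution:
  fixes m f :: "real \<Rightarrow> complex"
  assumes T: "0 < T" and m: "continuous_on {0..T} m" and f: "continuous_on {0..T} f"
    and M: "0 \<le> M" "\<And>t. t \<in> {0..T} \<Longrightarrow> Re (m t) \<le> M"
  obtains v where "v 0 = g"
    "\<And>t. t \<in> {0..T} \<Longrightarrow> (v has_vector_derivative m t * v t + f t) (at t within {0..T})"
    "\<And>t. t \<in> {0..T} \<Longrightarrow> norm (v t) \<le> exp (M * T) * (norm g + integral {0..T} (\<lambda>s. norm (f s)))"
proof -
  define A where "A t = integral {0..t} m" for t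
  have A: "(A has_vector_derivative m t) (at t within {0..T})" if "t \<in> {0..T}" for t
    unfolding A_def by (rule integral_has_vector_derivative[OF m that])
  have cA: "continuous_on {0..T} A"
    by (rule has_vector_derivative_imp_continuous_on[OF A])
  define F where "F t = integral {0..t} (\<lambda>s. exp (- A s) * f s)" for t
  have cF: "continuous_on {0..T} (\<lambda>s. exp (- A s) * f s)"
    by (intro continuous_intros cA f)
  have F: "(F has_vector_derivative exp (- A t) * f t) (at t within {0..T})" if "t \<in> {0..T}" for t
    unfolding F_def by (rule integral_has_vector_derivative[OF cF that])
  define v where "v t = exp (A t) * (g + F t)" for t
  have v0: "v 0 = g"
    by (simp add: v_def A_def F_def)
  have v: "(v has_vector_derivative m t * v t + f t) (at t within {0..T})" if t: "t \<in> {0..T}" for t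
  proof -
    have E: "((\<lambda>t. exp (A t)) has_vector_derivative m t * exp (A t)) (at t within {0..T})"
      using field_vector_diff_chain_within[OF A[OF t] DERIV_subset[OF DERIV_exp]] by (simp add: o_def)
    have "((\<lambda>t. g + F t) has_vector_derivative exp (- A t) * f t) (at t within {0..T})"
      using F[OF t] by (auto intro!: derivative_eq_intros)
    from has_vector_derivative_mult[OF E this] show ?thesis
      by (simp add: v_def[abs_def] exp_minus field_simps)
  qed
  have ReA: "Re (A t - A s) \<le> M * T" if "0 \<le> s" "s \<le> t" "t \<le> T" for s t
  proof -
    have int: "m integrable_on {x..y}" if "0 \<le> x" "y \<le> T" for x y
      using that by (intro integrable_continuous_interval continuous_on_subset[OF m]) auto
    have "A t - A s = integral {s..t} m"
      unfolding A_def using Henstock_Kurzweil_Integration.integral_combine[of 0 s t m] that int by (simp add: algebra_simps)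
    then have "((\<lambda>x. Re (m x)) has_integral Re (A t - A s)) {s..t}"
      using has_integral_linear[OF integrable_integral[OF int] bounded_linear_Re, of s t] that
      by (simp add: o_def)
    moreover have "((\<lambda>x. M) has_integral (t - s) *\<^sub>R M) {s..t}"
      using has_integral_const_real[of M s t] that by simp
    ultimately have "Re (A t - A s) \<le> (t - s) *\<^sub>R M"
      by (rule has_integral_le) (use M that in auto)
    \<comment> \<open>Nonnegativity of \<open>M\<close> allows the length t - s to be replaced by
      \<open>T\<close>.\<close>
    also have "\<dots> \<le> M * T"
      using M that by (simp add: mult.commute mult_left_mono)
    finally show ?thesis .
  qed
  have "norm (v t) \<le> exp (M * T) * (norm g + integral {0..T} (\<lambda>s. norm (f s)))" if t: "t \<in> {0..T}" for t
  proof -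
    have sub: "{0..t} \<subseteq> {0..T}" using t by auto
    have "norm (exp (A t) * g) \<le> exp (M * T) * norm g"
      using ReA[of 0 t] t by (auto simp: norm_mult A_def intro!: mult_right_mono)
    moreover have "norm (exp (A t) * F t) \<le> exp (M * T) * integral {0..T} (\<lambda>s. norm (f s))"
    proof -
      have "exp (A t) * F t = integral {0..t} (\<lambda>s. exp (A t) * (exp (- A s) * f s))"
        by (simp add: F_def)
      also have "norm \<dots> \<le> integral {0..t} (\<lambda>s. exp (M * T) * norm (f s))"
      proof (rule integral_norm_bound_integral)
        show "(\<lambda>s. exp (A t) * (exp (- A s) * f s)) integrable_on {0..t}"
          by (intro integrable_continuous_interval continuous_intros continuous_on_subset[OF cA sub] continuous_on_subset[OF f sub])
        show "(\<lambda>s. exp (M * T) * norm (f s)) integrable_on {0..t}"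
          by (intro integrable_continuous_interval continuous_intros continuous_on_subset[OF f sub])
        fix s assume s: "s \<in> {0..t}"
        have "norm (exp (A t) * (exp (- A s) * f s)) = exp (Re (A t - A s)) * norm (f s)"
          by (simp add: norm_mult norm_divide norm_inverse exp_diff exp_minus field_simps)
        also have "\<dots> \<le> exp (M * T) * norm (f s)"
          using ReA[of s t] s t by (intro mult_right_mono) auto
        finally show "norm (exp (A t) * (exp (- A s) * f s)) \<le> exp (M * T) * norm (f s)" .
      qed
      also have "\<dots> \<le> integral {0..T} (\<lambda>s. exp (M * T) * norm (f s))"
        by (intro integral_subset_le sub integrable_continuous_interval continuous_intros f
            continuous_on_subset[OF f sub]) auto
      finally show ?thesis by simp
    qed
    ultimately show ?thesis
      unfolding v_def distrib_left by (rule norm_triangle_le[OF add_mono])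
  qed
  with v0 v show ?thesis
    by (rule that)
qed

text \<open>Cauchy-Schwarz in variance form: the square of |f| - c is integrated, with c the mean of
  |f|.\<close>

lemma integral_norm_sq_le:
  fixes f :: "real \<Rightarrow> complex"
  assumes T: "0 < T" and f: "continuous_on {0..T} f"
  shows "(integral {0..T} (\<lambda>s. norm (f s)))\<^sup>2 \<le> T * integral {0..T} (\<lambda>s. (norm (f s))\<^sup>2)"
proof -
  define I where "I = integral {0..T} (\<lambda>s. norm (f s))"
  define c where "c = I / T"
  have i1: "((\<lambda>s. norm (f s)) has_integral I) {0..T}"
    unfolding I_def by (intro integrable_integral integrable_continuous_interval continuous_intros f)
  have i2: "((\<lambda>s. (norm (f s))\<^sup>2) has_integral integral {0..T} (\<lambda>s. (norm (f s))\<^sup>2)) {0..T}"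
    by (intro integrable_integral integrable_continuous_interval continuous_intros f)
  have "((\<lambda>s. c\<^sup>2) has_integral (T - 0) *\<^sub>R c\<^sup>2) {0..T}"
    using has_integral_const_real[of "c\<^sup>2" 0 T] T by simp
  from has_integral_add[OF has_integral_diff[OF i2 has_integral_mult_right[OF i1, of "2 * c"]] this]
  have "0 \<le> integral {0..T} (\<lambda>s. (norm (f s))\<^sup>2) - 2 * c * I + (T - 0) *\<^sub>R c\<^sup>2"
  proof (rule has_integral_nonneg)
    show "0 \<le> (norm (f s))\<^sup>2 - 2 * c * norm (f s) + c\<^sup>2" for s
      using zero_le_power2[of "norm (f s) - c"] by (simp add: power2_diff mult_ac)
  qed
  then have "0 \<le> T * (integral {0..T} (\<lambda>s. (norm (f s))\<^sup>2) - 2 * c * I + T * c\<^sup>2)"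
    using T by simp
  also have "\<dots> = T * integral {0..T} (\<lambda>s. (norm (f s))\<^sup>2) - I\<^sup>2"
    using T by (simp add: c_def field_simps power2_eq_square)
  finally show ?thesis by (simp add: I_def)
qed

section \<open>The Cauchy problem on the Fourier side\<close>

lemma C_sobolev_pairing_continuous:
  assumes u: "u \<in> C_sobolev T r" and \<psi>: "\<psi> \<in> torus_test"
  shows "continuous_on {0..T} (\<lambda>t. u t \<psi>)"
proof -
  obtain B where "\<And>t \<xi>. t \<in> {0..T} \<Longrightarrow> norm (fourier (u t) \<xi>) \<le> sqrt B * (1 + norm (freq \<xi>)) powr (- r)"
    using C_sobolev_bounded[OF u] by metis
  then show ?thesis
    by (intro fourier_series_time(1)[where a = "\<lambda>\<xi> t. fourier (u t) \<xi>", OF \<psi> C_sobolev_fourier_continuous[OF u]]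
        distribution_has_sum C_sobolevD[OF u] \<psi>)
qed

lemma has_sum_fcoeff_character:
  assumes "((\<lambda>\<eta>. fcoeff \<eta> (character \<xi>) * b \<eta>) has_sum X) UNIV"
  shows "X = b \<xi>"
proof -
  have "((\<lambda>\<eta>. b \<xi>) has_sum b \<xi>) {\<xi>}"
    using has_sum_finite[of "{\<xi>}" "\<lambda>\<eta>. b \<xi>"] by simp
  moreover have "((\<lambda>\<eta>. fcoeff \<eta> (character \<xi>) * b \<eta>) has_sum b \<xi>) UNIV \<longleftrightarrow> ((\<lambda>\<eta>. b \<xi>) has_sum b \<xi>) {\<xi>}"
    by (rule has_sum_cong_neutral) (auto simp: fcoeff_character)
  ultimately show ?thesis
    using assms has_sum_unique by blast
qed

lemma has_sum_sum:
  fixes f :: "'i \<Rightarrow> 'a \<Rightarrow> complex"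
  shows "(\<And>j. j \<in> J \<Longrightarrow> (f j has_sum S j) A) \<Longrightarrow> ((\<lambda>x. \<Sum>j\<in>J. f j x) has_sum (\<Sum>j\<in>J. S j)) A"
  by (induction J rule: infinite_finite_induct) (simp_all add: has_sum_add)

lemma has_sum_diff:
  fixes f g :: "'a \<Rightarrow> complex"
  assumes "(f has_sum S) A" "(g has_sum S') A"
  shows "((\<lambda>x. f x - g x) has_sum (S - S')) A"
  using has_sum_add[OF assms(1) has_sum_uminusI[OF assms(2)]] by simp

locale cauchy_problem =
  fixes T :: real and a2 :: "real \<Rightarrow> complex" and a1 :: "'n::finite \<Rightarrow> real \<Rightarrow> complex" and a0 :: "real \<Rightarrow> complex"
  assumes T: "0 < T"
    and a2: "continuous_on {0..T} a2" and a1: "\<And>j. continuous_on {0..T} (a1 j)"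
    and a0: "continuous_on {0..T} a0"
    and Im_a2: "\<And>t. t \<in> {0..T} \<Longrightarrow> Im (a2 t) \<le> 0"
    and Im_a1: "\<And>j t. t \<in> {0..T} \<Longrightarrow> Im (a1 j t) = 0"
begin

definition mu :: "int^'n \<Rightarrow> real \<Rightarrow> complex" where
  "mu \<xi> t = a2 t * of_real (\<Sum>j\<in>UNIV. (freq \<xi> $ j)\<^sup>2) + (\<Sum>j\<in>UNIV. a1 j t * of_real (freq \<xi> $ j)) + a0 t"

lemma continuous_mu: "continuous_on {0..T} (mu \<xi>)"
  unfolding mu_def by (intro continuous_intros a2 a1 a0)

text \<open>The second order term contributes a nonpositive imaginary part and the first order terms
  none, so a bound for |a_0| suffices.\<close>

lemma Im_mu_le:
  obtains M where "0 \<le> M" "\<And>\<xi> t. t \<in> {0..T} \<Longrightarrow> Im (mu \<xi> t) \<le> M"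
proof -
  have "bounded (a0 ` {0..T})"
    by (intro compact_imp_bounded compact_continuous_image a0 compact_Icc)
  then obtain M where M: "0 < M" "\<And>t. t \<in> {0..T} \<Longrightarrow> norm (a0 t) \<le> M"
    unfolding bounded_pos by blast
  show ?thesis
  proof
    fix \<xi> :: "int^'n" and t assume t: "t \<in> {0..T}"
    have "Im (a2 t) * (\<Sum>j\<in>UNIV. (freq \<xi> $ j)\<^sup>2) \<le> 0"
      using Im_a2[OF t] by (intro mult_nonpos_nonneg sum_nonneg) auto
    moreover have "Im (a0 t) \<le> M"
      using M(2)[OF t] abs_Im_le_cmod[of "a0 t"] by linarith
    ultimately show "Im (mu \<xi> t) \<le> M"
      by (simp add: mu_def Im_a1[OF t] Im_sum del: of_real_sum)
  qed (use M in simp)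
qed

text \<open>This growth of order two serves only the convergence of series tested with some \<psi>;
  it does not enter the estimate of the solution.\<close>

lemma norm_mu_le:
  obtains M where "0 \<le> M" "\<And>\<xi> t. t \<in> {0..T} \<Longrightarrow> norm (mu \<xi> t) \<le> M * (1 + norm (freq \<xi>)) powr 2"
proof -
  have "bounded ((\<lambda>t. real CARD('n) * norm (a2 t) + (\<Sum>j\<in>UNIV. norm (a1 j t)) + norm (a0 t)) ` {0..T})"
    by (intro compact_imp_bounded compact_continuous_image continuous_intros a0 a1 a2 compact_Icc)
  then obtain M where M: "0 < M"
    "\<And>t. t \<in> {0..T} \<Longrightarrow> norm (real CARD('n) * norm (a2 t) + (\<Sum>j\<in>UNIV. norm (a1 j t)) + norm (a0 t)) \<le> M"
    unfolding bounded_pos by blast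
  show ?thesis
  proof
    fix \<xi> :: "int^'n" and t assume t: "t \<in> {0..T}"
    define w where "w = 1 + norm (freq \<xi>)"
    have w: "1 \<le> w" "w \<le> w\<^sup>2"
      by (simp_all add: w_def self_le_power)
    have f: "\<bar>freq \<xi> $ j\<bar> \<le> w" for j
      using component_le_norm_cart[of "freq \<xi>" j] by (simp add: w_def)
    have "norm (mu \<xi> t) \<le> norm (a2 t) * (\<Sum>j\<in>UNIV. (freq \<xi> $ j)\<^sup>2) + (\<Sum>j\<in>UNIV. norm (a1 j t) * \<bar>freq \<xi> $ j\<bar>) + norm (a0 t)"
      unfolding mu_def
      by (intro norm_triangle_le add_mono order_trans[OF norm_sum] sum_mono)
        (auto simp: norm_mult sum_nonneg simp del: of_real_sum)
    also have "\<dots> \<le> norm (a2 t) * (\<Sum>j\<in>(UNIV::'n set). w\<^sup>2) + (\<Sum>j\<in>UNIV. norm (a1 j t) * w\<^sup>2) + norm (a0 t) * w\<^sup>2"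
    proof (intro add_mono mult_left_mono sum_mono)
      show "(freq \<xi> $ j)\<^sup>2 \<le> w\<^sup>2" for j
        using f[of j] w by (intro abs_le_square_iff[THEN iffD1]) auto
      show "\<bar>freq \<xi> $ j\<bar> \<le> w\<^sup>2" for j
        using f[of j] w by linarith
      show "norm (a0 t) \<le> norm (a0 t) * w\<^sup>2"
        using mult_left_mono[of 1 "w\<^sup>2" "norm (a0 t)"] w by simp
    qed auto
    also have "\<dots> = (real CARD('n) * norm (a2 t) + (\<Sum>j\<in>UNIV. norm (a1 j t)) + norm (a0 t)) * w\<^sup>2"
      by (simp add: distrib_right sum_distrib_right)
    also have "\<dots> \<le> M * w\<^sup>2"
      using M(2)[OF t] by (intro mult_right_mono) (auto simp: abs_le_iff)
    finally show "norm (mu \<xi> t) \<le> M * (1 + norm (freq \<xi>)) powr 2"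
      using w by (simp add: w_def[symmetric] powr_numeral)
  qed (use M in simp)
qed

text \<open>Derivatives are moved to \<psi>, where each multiplies its coefficient by -i \<xi>_j.
  The sign of the distributional derivative and the factor 1/i turn this into \<xi>_j for one
  \<open>dist_D\<close>; for the second derivative the two signs cancel.\<close>

lemma spatial_op_has_sum:
  assumes ut: "u t \<in> distributions" and \<psi>: "\<psi> \<in> torus_test"
  shows "((\<lambda>\<xi>. fcoeff \<xi> \<psi> * (mu \<xi> t * fourier (u t) \<xi>)) has_sum spatial_op a2 a1 a0 u t \<psi>) UNIV"
proof -
  let ?e = "\<lambda>j. axis j 1 :: real^'n"
  let ?c = "\<lambda>\<xi>. fcoeff \<xi> \<psi> * fourier (u t) \<xi>"
  have e: "?e j \<in> Basis" for j by (simp add: axis_in_Basis_iff)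
  have d: "dir_deriv (?e j) \<psi> \<in> torus_test" for j
    by (intro torus_test_dir_deriv \<psi> e)
  have dd: "dir_deriv (?e j) (dir_deriv (?e j) \<psi>) \<in> torus_test" for j
    by (intro torus_test_dir_deriv d e)
  have c1: "fcoeff \<xi> (dir_deriv (?e j) \<psi>) = - \<i> * of_real (freq \<xi> $ j) * fcoeff \<xi> \<psi>" for \<xi> j
    by (simp add: fcoeff_dir_deriv[OF \<psi> e] inner_axis')
  have c2: "fcoeff \<xi> (dir_deriv (?e j) (dir_deriv (?e j) \<psi>)) = - of_real ((freq \<xi> $ j)\<^sup>2) * fcoeff \<xi> \<psi>" for \<xi> j
    by (simp add: fcoeff_dir_deriv[OF d e] c1 inner_axis' power2_eq_square algebra_simps)
  have D: "((\<lambda>\<xi>. of_real (freq \<xi> $ j) * ?c \<xi>) has_sum dist_D j (u t) \<psi>) UNIV" for j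
    using has_sum_cmult_right[OF distribution_has_sum[OF ut d[of j]], of "\<i>"]
    by (simp add: c1 dist_D_def dist_deriv_def \<psi> mult_ac)
  have L: "((\<lambda>\<xi>. - of_real ((freq \<xi> $ j)\<^sup>2) * ?c \<xi>) has_sum dist_deriv j (dist_deriv j (u t)) \<psi>) UNIV" for j
    using distribution_has_sum[OF ut dd[of j]]
    by (simp only: c2 dist_deriv_def \<psi> d if_True minus_minus mult.assoc)
  have "((\<lambda>\<xi>. - a2 t * (\<Sum>j\<in>UNIV. - of_real ((freq \<xi> $ j)\<^sup>2) * ?c \<xi>) +
      (\<Sum>j\<in>UNIV. a1 j t * (of_real (freq \<xi> $ j) * ?c \<xi>)) + a0 t * ?c \<xi>) has_sum spatial_op a2 a1 a0 u t \<psi>) UNIV"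
    unfolding spatial_op_def dist_laplace_def
    by (intro has_sum_add has_sum_cmult_right has_sum_sum L D distribution_has_sum ut \<psi>)
  moreover have "- a2 t * (\<Sum>j\<in>UNIV. - of_real ((freq \<xi> $ j)\<^sup>2) * ?c \<xi>) +
      (\<Sum>j\<in>UNIV. a1 j t * (of_real (freq \<xi> $ j) * ?c \<xi>)) + a0 t * ?c \<xi> =
      fcoeff \<xi> \<psi> * (mu \<xi> t * fourier (u t) \<xi>)" for \<xi>
  proof -
    have "(\<Sum>j\<in>UNIV. - of_real ((freq \<xi> $ j)\<^sup>2) * ?c \<xi>) = - of_real (\<Sum>j\<in>UNIV. (freq \<xi> $ j)\<^sup>2) * ?c \<xi>"
      by (simp add: sum_distrib_right sum_negf)
    moreover have "(\<Sum>j\<in>UNIV. a1 j t * (of_real (freq \<xi> $ j) * ?c \<xi>)) = (\<Sum>j\<in>UNIV. a1 j t * of_real (freq \<xi> $ j)) * ?c \<xi>"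
      by (simp add: sum_distrib_right mult.assoc)
    ultimately show ?thesis
      unfolding mu_def by (simp add: algebra_simps del: of_real_sum)
  qed
  ultimately show ?thesis
    by (simp only:)
qed

lemma spatial_op_continuous:
  assumes u: "u \<in> C_sobolev T r" and \<psi>: "\<psi> \<in> torus_test"
  shows "continuous_on {0..T} (\<lambda>t. spatial_op a2 a1 a0 u t \<psi>)"
proof -
  obtain B where B: "0 \<le> B" "\<And>t \<xi>. t \<in> {0..T} \<Longrightarrow> norm (fourier (u t) \<xi>) \<le> sqrt B * (1 + norm (freq \<xi>)) powr (- r)"
    using C_sobolev_bounded[OF u] by metis
  obtain M where M: "0 \<le> M" "\<And>\<xi> t. t \<in> {0..T} \<Longrightarrow> norm (mu \<xi> t) \<le> M * (1 + norm (freq \<xi>)) powr 2"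
    using norm_mu_le by blast
  show ?thesis
  proof (rule fourier_series_time(1)[where a = "\<lambda>\<xi> t. mu \<xi> t * fourier (u t) \<xi>", OF \<psi>])
    show "continuous_on {0..T} (\<lambda>t. mu \<xi> t * fourier (u t) \<xi>)" for \<xi>
      by (intro continuous_intros continuous_mu C_sobolev_fourier_continuous[OF u])
    show "norm (mu \<xi> t * fourier (u t) \<xi>) \<le> (M * sqrt B) * (1 + norm (freq \<xi>)) powr (2 - r)"
      if t: "t \<in> {0..T}" for \<xi> t
    proof -
      have "norm (mu \<xi> t * fourier (u t) \<xi>) \<le>
          (M * (1 + norm (freq \<xi>)) powr 2) * (sqrt B * (1 + norm (freq \<xi>)) powr (- r))"
        unfolding norm_mult using M B t by (intro mult_mono) auto
      also have "\<dots> = (M * sqrt B) * ((1 + norm (freq \<xi>)) powr 2 * (1 + norm (freq \<xi>)) powr (- r))"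
        by simp
      finally show ?thesis unfolding powr_add[symmetric] by simp
    qed
    show "((\<lambda>\<xi>. fcoeff \<xi> \<psi> * (mu \<xi> t * fourier (u t) \<xi>)) has_sum spatial_op a2 a1 a0 u t \<psi>) UNIV"
      if "t \<in> {0..T}" for t
      by (intro spatial_op_has_sum C_sobolevD[OF u] that \<psi>)
  qed
qed

text \<open>Testing with characters isolates the frequencies. Conversely, the scalar identities are
  summed against the coefficients of \<psi>, the polynomial growth of \<open>k\<close> being of
  order 2 - r.\<close>

lemma equation_iff:
  assumes u: "u \<in> C_sobolev T r" and f: "f \<in> C_sobolev T r" and \<phi>: "\<phi> \<in> time_test T"
  shows "P_op T a2 a1 a0 u \<phi> = time_dist T f \<phi> \<longleftrightarrow>
    (\<forall>\<xi>. integral {0..T} (\<lambda>t. fourier (u t) \<xi> * (- ((1 / \<i>) * dir_deriv 1 \<phi> t)) +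
      mu \<xi> t * fourier (u t) \<xi> * \<phi> t - fourier (f t) \<xi> * \<phi> t) = 0)"
proof -
  let ?d = "\<lambda>t. - ((1 / \<i>) * dir_deriv 1 \<phi> t)"
  define k where "k \<xi> t = fourier (u t) \<xi> * ?d t + mu \<xi> t * fourier (u t) \<xi> * \<phi> t - fourier (f t) \<xi> * \<phi> t" for \<xi> t
  define L where "L \<psi> t = u t \<psi> * ?d t + spatial_op a2 a1 a0 u t \<psi> * \<phi> t - f t \<psi> * \<phi> t" for \<psi> t
  have c\<phi>: "continuous_on {0..T} \<phi>" "continuous_on {0..T} ?d"
    by (intro continuous_intros time_test_continuous[OF \<phi>])+
  have diff: "P_op T a2 a1 a0 u \<phi> \<psi> - time_dist T f \<phi> \<psi> = integral {0..T} (L \<psi>)" if \<psi>: "\<psi> \<in> torus_test" for \<psi>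
  proof -
    have i: "(\<lambda>t. u t \<psi> * ?d t) integrable_on {0..T}"
      "(\<lambda>t. spatial_op a2 a1 a0 u t \<psi> * \<phi> t) integrable_on {0..T}"
      "(\<lambda>t. f t \<psi> * \<phi> t) integrable_on {0..T}"
      by (intro integrable_continuous_interval continuous_on_mult c\<phi> spatial_op_continuous[OF u \<psi>]
          C_sobolev_pairing_continuous[OF u \<psi>] C_sobolev_pairing_continuous[OF f \<psi>])+
    show ?thesis
      unfolding P_op_def weak_Dt_def time_dist_def L_def
        integral_diff[OF integrable_add[OF i(1,2)] i(3)] integral_add[OF i(1,2)] ..
  qed
  have sum: "((\<lambda>\<xi>. fcoeff \<xi> \<psi> * k \<xi> t) has_sum L \<psi> t) UNIV" if \<psi>: "\<psi> \<in> torus_test" and t: "t \<in> {0..T}" for \<psi> t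
  proof -
    have "((\<lambda>\<xi>. fcoeff \<xi> \<psi> * fourier (u t) \<xi> * ?d t + fcoeff \<xi> \<psi> * (mu \<xi> t * fourier (u t) \<xi>) * \<phi> t
        - fcoeff \<xi> \<psi> * fourier (f t) \<xi> * \<phi> t) has_sum L \<psi> t) UNIV"
      unfolding L_def
      by (intro has_sum_diff has_sum_add has_sum_cmult_left distribution_has_sum spatial_op_has_sum
          C_sobolevD[OF u t] C_sobolevD[OF f t] \<psi>)
    then show ?thesis
      by (simp add: k_def algebra_simps)
  qed
  have Lk: "L (character \<xi>) t = k \<xi> t" if "t \<in> {0..T}" for \<xi> t
    by (rule has_sum_fcoeff_character[OF sum[OF character_in_torus_test that]])
  \<comment> \<open>The equation is an equality of total functionals, so arguments that are not test
    functions must be compared too; both sides take the conventional value 0 there.\<close>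
  have zero: "P_op T a2 a1 a0 u \<phi> \<psi> = 0 \<and> time_dist T f \<phi> \<psi> = 0" if "\<psi> \<notin> torus_test" for \<psi>
  proof -
    have "u t \<psi> = 0" "f t \<psi> = 0" if t: "t \<in> {0..T}" for t
      using C_sobolevD(1)[OF u t] C_sobolevD(1)[OF f t] \<open>\<psi> \<notin> _\<close> by (auto simp: distributions_def)
    moreover from this have "spatial_op a2 a1 a0 u t \<psi> = 0" if t: "t \<in> {0..T}" for t
      using t \<open>\<psi> \<notin> _\<close> by (simp add: spatial_op_def dist_laplace_def dist_D_def dist_deriv_def)
    ultimately have "P_op T a2 a1 a0 u \<phi> \<psi> = integral {0..T} (\<lambda>t. 0) + integral {0..T} (\<lambda>t. 0)"
      "time_dist T f \<phi> \<psi> = integral {0..T} (\<lambda>t. 0)"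
      unfolding P_op_def weak_Dt_def time_dist_def
      by (intro arg_cong2[where f = "(+)"] integral_cong; simp)+
    then show ?thesis by simp
  qed
  note cu = C_sobolev_fourier_continuous[OF u] and cf = C_sobolev_fourier_continuous[OF f]
  have ck: "continuous_on {0..T} (k \<xi>)" for \<xi>
    unfolding k_def
    by (intro continuous_on_diff continuous_on_add continuous_on_mult c\<phi> cu cf continuous_mu)
  have "P_op T a2 a1 a0 u \<phi> = time_dist T f \<phi> \<longleftrightarrow> (\<forall>\<xi>. integral {0..T} (k \<xi>) = 0)"
  proof
    assume eq: "P_op T a2 a1 a0 u \<phi> = time_dist T f \<phi>"
    show "\<forall>\<xi>. integral {0..T} (k \<xi>) = 0"
    proof
      fix \<xi>
      have "integral {0..T} (k \<xi>) = integral {0..T} (L (character \<xi>))"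
        by (intro integral_cong) (simp add: Lk)
      then show "integral {0..T} (k \<xi>) = 0"
        using diff[OF character_in_torus_test] eq by simp
    qed
  next
    assume z: "\<forall>\<xi>. integral {0..T} (k \<xi>) = 0"
    obtain B where B: "0 \<le> B" "\<And>t \<xi>. t \<in> {0..T} \<Longrightarrow> norm (fourier (u t) \<xi>) \<le> sqrt B * (1 + norm (freq \<xi>)) powr (- r)"
      using C_sobolev_bounded[OF u] by metis
    obtain B' where B': "0 \<le> B'" "\<And>t \<xi>. t \<in> {0..T} \<Longrightarrow> norm (fourier (f t) \<xi>) \<le> sqrt B' * (1 + norm (freq \<xi>)) powr (- r)"
      using C_sobolev_bounded[OF f] by metis
    obtain M where M: "0 \<le> M" "\<And>\<xi> t. t \<in> {0..T} \<Longrightarrow> norm (mu \<xi> t) \<le> M * (1 + norm (freq \<xi>)) powr 2"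
      using norm_mu_le by blast
    have "bounded (\<phi> ` {0..T})" "bounded (?d ` {0..T})"
      by (intro compact_imp_bounded compact_continuous_image c\<phi> compact_Icc)+
    then obtain P Q where P: "0 < P" "\<And>t. t \<in> {0..T} \<Longrightarrow> norm (\<phi> t) \<le> P"
      and Q: "0 < Q" "\<And>t. t \<in> {0..T} \<Longrightarrow> norm (?d t) \<le> Q"
      unfolding bounded_pos by (metis imageI)
    have kb: "norm (k \<xi> t) \<le> (sqrt B * Q + M * sqrt B * P + sqrt B' * P) * (1 + norm (freq \<xi>)) powr (2 - r)"
      if t: "t \<in> {0..T}" for \<xi> t
    proof -
      define w where "w = 1 + norm (freq \<xi>)"
      have w: "1 \<le> w" by (simp add: w_def)
      have ww: "w powr 2 * w powr (- r) = w powr (2 - r)"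
        unfolding powr_add[symmetric] by simp
      have wr: "w powr (- r) \<le> w powr (2 - r)" using w by (intro powr_mono) auto
      have "norm (k \<xi> t) \<le> norm (fourier (u t) \<xi>) * norm (?d t) +
          norm (mu \<xi> t) * norm (fourier (u t) \<xi>) * norm (\<phi> t) + norm (fourier (f t) \<xi>) * norm (\<phi> t)"
        unfolding k_def norm_mult[symmetric] by (intro norm_triangle_le_diff add_mono norm_triangle_ineq order_refl)
      also have "\<dots> \<le> (sqrt B * w powr (- r)) * Q + (M * w powr 2) * (sqrt B * w powr (- r)) * P + (sqrt B' * w powr (- r)) * P"
        using B B' M P Q t unfolding w_def by (intro add_mono mult_mono) (auto intro: mult_nonneg_nonneg)
      also have "\<dots> = sqrt B * Q * w powr (- r) + M * sqrt B * P * (w powr 2 * w powr (- r)) + sqrt B' * P * w powr (- r)"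
        by (simp add: mult_ac)
      also have "\<dots> \<le> sqrt B * Q * w powr (2 - r) + M * sqrt B * P * w powr (2 - r) + sqrt B' * P * w powr (2 - r)"
        unfolding ww using B B' M P Q by (intro add_mono mult_left_mono wr order_refl) auto
      finally show ?thesis
        by (simp add: w_def algebra_simps)
    qed
    show "P_op T a2 a1 a0 u \<phi> = time_dist T f \<phi>"
    proof
      fix \<psi>
      show "P_op T a2 a1 a0 u \<phi> \<psi> = time_dist T f \<phi> \<psi>"
      proof (cases "\<psi> \<in> torus_test")
        case True
        have "integral {0..T} (L \<psi>) = 0"
          by (rule fourier_series_time(2)[OF True ck kb sum[OF True]]) (use z in auto)
        then show ?thesis using diff[OF True] by simp
      qed (simp add: zero)
    qed
  qed
  then show ?thesis by (simp add: k_def[abs_def])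
qed

text \<open>Multiplying the scalar equation by i gives v' = -i mu v + i f. Weak and classical forms
  agree because coefficients and right-hand side are continuous in time.\<close>

lemma solves_iff:
  assumes u: "u \<in> C_sobolev T r" and f: "f \<in> C_sobolev T r"
  shows "solves_Cauchy T a2 a1 a0 f g u \<longleftrightarrow> u 0 = g \<and>
    (\<forall>\<xi>. \<forall>t\<in>{0..T}. ((\<lambda>t. fourier (u t) \<xi>) has_vector_derivative
      (- \<i> * mu \<xi> t) * fourier (u t) \<xi> + \<i> * fourier (f t) \<xi>) (at t within {0..T}))"
proof -
  define h where "h \<xi> t = (- \<i> * mu \<xi> t) * fourier (u t) \<xi> + \<i> * fourier (f t) \<xi>" for \<xi> t
  note cu = C_sobolev_fourier_continuous[OF u] and cf = C_sobolev_fourier_continuous[OF f]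
  have ch: "continuous_on {0..T} (h \<xi>)" for \<xi>
    unfolding h_def by (intro continuous_intros cu cf continuous_mu)
  have weak: "integral {0..T} (\<lambda>t. fourier (u t) \<xi> * (- ((1 / \<i>) * dir_deriv 1 \<phi> t)) +
      mu \<xi> t * fourier (u t) \<xi> * \<phi> t - fourier (f t) \<xi> * \<phi> t) = 0 \<longleftrightarrow>
      integral {0..T} (\<lambda>t. fourier (u t) \<xi> * dir_deriv 1 \<phi> t) = - integral {0..T} (\<lambda>t. h \<xi> t * \<phi> t)"
    if \<phi>: "\<phi> \<in> time_test T" for \<phi> \<xi>
  proof -
    have "integral {0..T} (\<lambda>t. fourier (u t) \<xi> * (- ((1 / \<i>) * dir_deriv 1 \<phi> t)) +
        mu \<xi> t * fourier (u t) \<xi> * \<phi> t - fourier (f t) \<xi> * \<phi> t) =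
        integral {0..T} (\<lambda>t. \<i> * (fourier (u t) \<xi> * dir_deriv 1 \<phi> t + h \<xi> t * \<phi> t))"
      by (intro integral_cong) (simp add: h_def field_simps)
    also have "\<dots> = \<i> * (integral {0..T} (\<lambda>t. fourier (u t) \<xi> * dir_deriv 1 \<phi> t) + integral {0..T} (\<lambda>t. h \<xi> t * \<phi> t))"
    proof -
      have "(\<lambda>t. fourier (u t) \<xi> * dir_deriv 1 \<phi> t) integrable_on {0..T}"
        "(\<lambda>t. h \<xi> t * \<phi> t) integrable_on {0..T}"
        by (intro integrable_continuous_interval continuous_on_mult cu ch time_test_continuous[OF \<phi>])+
      from integral_add[OF this] show ?thesis
        by simp
    qed
    finally show ?thesis
      by (simp add: eq_neg_iff_add_eq_0)
  qed
  have "(\<forall>\<phi>\<in>time_test T. P_op T a2 a1 a0 u \<phi> = time_dist T f \<phi>) \<longleftrightarrow>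
      (\<forall>\<xi>. \<forall>t\<in>{0..T}. ((\<lambda>t. fourier (u t) \<xi>) has_vector_derivative h \<xi> t) (at t within {0..T}))"
  proof
    assume *: "\<forall>\<phi>\<in>time_test T. P_op T a2 a1 a0 u \<phi> = time_dist T f \<phi>"
    have "integral {0..T} (\<lambda>t. fourier (u t) \<xi> * dir_deriv 1 \<phi> t) = - integral {0..T} (\<lambda>t. h \<xi> t * \<phi> t)"
      if \<phi>: "\<phi> \<in> time_test T" for \<phi> \<xi>
      using * equation_iff[OF u f \<phi>] weak[OF \<phi>] \<phi> by blast
    then show "\<forall>\<xi>. \<forall>t\<in>{0..T}. ((\<lambda>t. fourier (u t) \<xi>) has_vector_derivative h \<xi> t) (at t within {0..T})"
      using weak_imp_classical[OF T cu ch] by blast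
  next
    assume *: "\<forall>\<xi>. \<forall>t\<in>{0..T}. ((\<lambda>t. fourier (u t) \<xi>) has_vector_derivative h \<xi> t) (at t within {0..T})"
    have "integral {0..T} (\<lambda>t. fourier (u t) \<xi> * dir_deriv 1 \<phi> t) = - integral {0..T} (\<lambda>t. h \<xi> t * \<phi> t)"
      if \<phi>: "\<phi> \<in> time_test T" for \<phi> \<xi>
      by (rule weak_derivative[OF T _ ch \<phi>]) (use * in blast)
    then show "\<forall>\<phi>\<in>time_test T. P_op T a2 a1 a0 u \<phi> = time_dist T f \<phi>"
      using equation_iff[OF u f] weak by blast
  qed
  then show ?thesis
    unfolding solves_Cauchy_def h_def using u by blast
qed

lemma unique:
  assumes u: "u \<in> C_sobolev T r" and v: "v \<in> C_sobolev T r" and f: "f \<in> C_sobolev T r"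
    and su: "solves_Cauchy T a2 a1 a0 f g u" and sv: "solves_Cauchy T a2 a1 a0 f g v" and t: "t \<in> {0..T}"
  shows "v t = u t"
proof -
  have "fourier (v t) \<xi> - fourier (u t) \<xi> = 0" for \<xi>
  proof (rule scalar_ode_unique[where m = "\<lambda>t. - \<i> * mu \<xi> t", OF _ _ _ t])
    show "continuous_on {0..T} (\<lambda>t. - \<i> * mu \<xi> t)"
      by (intro continuous_intros continuous_mu)
    show "((\<lambda>t. fourier (v t) \<xi> - fourier (u t) \<xi>) has_vector_derivative
        - \<i> * mu \<xi> t * (fourier (v t) \<xi> - fourier (u t) \<xi>)) (at t within {0..T})" if t: "t \<in> {0..T}" for t
    proof -
      have "((\<lambda>t. fourier (v t) \<xi>) has_vector_derivative
          (- \<i> * mu \<xi> t) * fourier (v t) \<xi> + \<i> * fourier (f t) \<xi>) (at t within {0..T})"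
        using sv solves_iff[OF v f] t by blast
      moreover have "((\<lambda>t. fourier (u t) \<xi>) has_vector_derivative
          (- \<i> * mu \<xi> t) * fourier (u t) \<xi> + \<i> * fourier (f t) \<xi>) (at t within {0..T})"
        using su solves_iff[OF u f] t by blast
      ultimately show ?thesis
        using has_vector_derivative_diff by (fastforce simp: algebra_simps)
    qed
    show "fourier (v 0) \<xi> - fourier (u 0) \<xi> = 0"
      using su sv by (simp add: solves_Cauchy_def)
  qed
  then have "fourier (v t) = fourier (u t)"
    by (simp add: fun_eq_iff)
  then show ?thesis
    using synthesis_fourier C_sobolevD(1)[OF u t] C_sobolevD(1)[OF v t] by metis
qed

text \<open>Finite partial sums pass under the integral and are bounded there by the supremum in
  time of the squared H^r norm, so no convergence theorem is needed.\<close>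

lemma weighted_integral_summable:
  fixes f :: "real \<Rightarrow> 'n functional"
  assumes f: "f \<in> C_sobolev T r"
  shows "(\<lambda>\<xi>. integral {0..T} (\<lambda>s. weighted_sq r (fourier (f s)) \<xi>)) summable_on UNIV"
proof (rule nonneg_bdd_above_summable_on)
  obtain B where B: "\<And>t. t \<in> {0..T} \<Longrightarrow> infsum (weighted_sq r (fourier (f t))) UNIV \<le> B"
    using C_sobolev_bounded[OF f] by metis
  have c: "continuous_on {0..T} (\<lambda>s. weighted_sq r (fourier (f s)) \<xi>)" for \<xi>
    unfolding weighted_sq_def by (intro continuous_intros C_sobolev_fourier_continuous[OF f])
  show "0 \<le> integral {0..T} (\<lambda>s. weighted_sq r (fourier (f s)) \<xi>)" for \<xi>
    by (intro integral_nonneg integrable_continuous_interval c weighted_sq_nonneg)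
  show "bdd_above (sum (\<lambda>\<xi>. integral {0..T} (\<lambda>s. weighted_sq r (fourier (f s)) \<xi>)) ` {F. F \<subseteq> UNIV \<and> finite F})"
  proof (rule bdd_aboveI2)
    fix F :: "(int^'n) set" assume F: "F \<in> {F. F \<subseteq> UNIV \<and> finite F}"
    have "(\<Sum>\<xi>\<in>F. integral {0..T} (\<lambda>s. weighted_sq r (fourier (f s)) \<xi>)) =
        integral {0..T} (\<lambda>s. \<Sum>\<xi>\<in>F. weighted_sq r (fourier (f s)) \<xi>)"
      using F by (subst integral_sum) (auto intro: integrable_continuous_interval c)
    also have "\<dots> \<le> integral {0..T} (\<lambda>s. B)"
    proof (rule integral_le)
      show "(\<Sum>\<xi>\<in>F. weighted_sq r (fourier (f s)) \<xi>) \<le> B" if s: "s \<in> {0..T}" for s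
        using finite_sum_le_infsum[OF C_sobolevD(2)[OF f s], of F] B[OF s] F by fastforce
    qed (auto intro!: integrable_continuous_interval continuous_intros c)
    finally show "(\<Sum>\<xi>\<in>F. integral {0..T} (\<lambda>s. weighted_sq r (fourier (f s)) \<xi>)) \<le> integral {0..T} (\<lambda>s. B)" .
  qed
qed

text \<open>The time-independent majorant makes the series for the squared distance between times s
  and t converge uniformly in s. Its sum is therefore continuous in s and vanishes at s = t. The
  factor 4 comes from 2 b + 2 b.\<close>

lemma C_sobolev_synthesis:
  fixes V :: "int^'n \<Rightarrow> real \<Rightarrow> complex"
  assumes V: "\<And>\<xi>. continuous_on {0..T} (V \<xi>)" and b: "b summable_on UNIV"
    and bound: "\<And>\<xi> t. t \<in> {0..T} \<Longrightarrow> weighted_sq r (\<lambda>\<xi>. V \<xi> t) \<xi> \<le> b \<xi>"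
  shows "(\<lambda>t. synthesis (\<lambda>\<xi>. V \<xi> t)) \<in> C_sobolev T r"
proof -
  have four: "fourier (synthesis (\<lambda>\<xi>. V \<xi> t)) = (\<lambda>\<xi>. V \<xi> t)" for t
    by (simp add: fun_eq_iff fourier_synthesis)
  have summ: "weighted_sq r (\<lambda>\<xi>. V \<xi> t) summable_on UNIV" if "t \<in> {0..T}" for t
    by (rule summable_on_comparison_test[OF b bound[OF that]]) simp
  have "synthesis (\<lambda>\<xi>. V \<xi> t) \<in> sobolev r" if "t \<in> {0..T}" for t
    unfolding sobolev_iff four
    by (intro conjI summ that synthesis_distribution[OF norm_le_weighted[OF summ[OF that]]])
  moreover have "((\<lambda>s. sobolev_norm r (\<lambda>\<psi>. synthesis (\<lambda>\<xi>. V \<xi> s) \<psi> - synthesis (\<lambda>\<xi>. V \<xi> t) \<psi>)) \<longlongrightarrow> 0)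
      (at t within {0..T})" if t: "t \<in> {0..T}" for t
  proof -
    define N where "N s = infsum (weighted_sq r (\<lambda>\<xi>. V \<xi> s - V \<xi> t)) UNIV" for s
    have "uniform_limit {0..T} (\<lambda>F s. \<Sum>\<xi>\<in>F. weighted_sq r (\<lambda>\<xi>. V \<xi> s - V \<xi> t) \<xi>) N (finite_subsets_at_top UNIV)"
      unfolding N_def
    proof (rule Weierstrass_m_test_general[where M = "\<lambda>\<xi>. 4 * b \<xi>"])
      show "norm (weighted_sq r (\<lambda>\<xi>. V \<xi> s - V \<xi> t) \<xi>) \<le> 4 * b \<xi>" if s: "s \<in> {0..T}" for \<xi> s
      proof -
        have "weighted_sq r (\<lambda>\<xi>. V \<xi> s + - V \<xi> t) \<xi> \<le>
            2 * weighted_sq r (\<lambda>\<xi>. V \<xi> s) \<xi> + 2 * weighted_sq r (\<lambda>\<xi>. - V \<xi> t) \<xi>"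
          by (rule weighted_sq_add_le)
        moreover have "weighted_sq r (\<lambda>\<xi>. - V \<xi> t) \<xi> = weighted_sq r (\<lambda>\<xi>. V \<xi> t) \<xi>"
          by (simp add: weighted_sq_def)
        ultimately show ?thesis
          using bound[OF s, of \<xi>] bound[OF t, of \<xi>] by simp
      qed
    qed (intro summable_on_cmult_right b)
    then have "continuous_on {0..T} N"
      by (rule uniform_limit_theorem[rotated])
        (auto intro!: always_eventually continuous_intros V simp: weighted_sq_def)
    then have "((\<lambda>s. sqrt (N s)) \<longlongrightarrow> sqrt (N t)) (at t within {0..T})"
      using t by (auto simp: continuous_on_def intro: tendsto_real_sqrt)
    moreover have "N t = 0"
      by (simp add: N_def weighted_sq_def[abs_def])
    ultimately show ?thesis
      by (simp add: sobolev_norm_eq fourier_diff four N_def)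
  qed
  ultimately show ?thesis
    by (simp add: C_sobolev_def)
qed

lemma existence:
  assumes f: "f \<in> C_sobolev T r" and g: "g \<in> sobolev r"
  obtains u where "u \<in> C_sobolev T r" "solves_Cauchy T a2 a1 a0 f g u"
proof -
  obtain M where M: "0 \<le> M" "\<And>\<xi> t. t \<in> {0..T} \<Longrightarrow> Im (mu \<xi> t) \<le> M"
    using Im_mu_le by blast
  note cf = C_sobolev_fourier_continuous[OF f]
  define E where "E = exp (M * T)"
  \<comment> \<open>Initial value, equation and bound are bundled so that one choice over all \<xi>
    yields the whole family \<open>V\<close>.\<close>
  define sol where "sol \<xi> v \<longleftrightarrow> v 0 = fourier g \<xi> \<and>
      (\<forall>t\<in>{0..T}. (v has_vector_derivative (- \<i> * mu \<xi> t) * v t + \<i> * fourier (f t) \<xi>) (at t within {0..T})) \<and>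
      (\<forall>t\<in>{0..T}. norm (v t) \<le> E * (norm (fourier g \<xi>) + integral {0..T} (\<lambda>s. norm (\<i> * fourier (f s) \<xi>))))" for \<xi> v
  have "\<exists>v. sol \<xi> v" for \<xi>
  proof -
    have c: "continuous_on {0..T} (\<lambda>t. - \<i> * mu \<xi> t)" "continuous_on {0..T} (\<lambda>t. \<i> * fourier (f t) \<xi>)"
      by (intro continuous_intros continuous_mu cf)+
    have Re: "Re (- \<i> * mu \<xi> t) \<le> M" if "t \<in> {0..T}" for t
      using M(2)[OF that] by simp
    show ?thesis
    proof (rule scalar_ode_solution[OF T c M(1) Re, where g = "fourier g \<xi>"])
      fix v assume "v 0 = fourier g \<xi>"
        "\<And>t. t \<in> {0..T} \<Longrightarrow> (v has_vector_derivative (- \<i> * mu \<xi> t) * v t + \<i> * fourier (f t) \<xi>) (at t within {0..T})"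
        "\<And>t. t \<in> {0..T} \<Longrightarrow> norm (v t) \<le> exp (M * T) * (norm (fourier g \<xi>) + integral {0..T} (\<lambda>s. norm (\<i> * fourier (f s) \<xi>)))"
      then show ?thesis
        unfolding sol_def E_def by (intro exI[of _ v] conjI ballI)
    qed
  qed
  then obtain V where sol: "\<And>\<xi>. sol \<xi> (V \<xi>)"
    by metis
  have V0: "V \<xi> 0 = fourier g \<xi>"
    and V: "t \<in> {0..T} \<Longrightarrow> (V \<xi> has_vector_derivative (- \<i> * mu \<xi> t) * V \<xi> t + \<i> * fourier (f t) \<xi>) (at t within {0..T})"
    and Vb: "t \<in> {0..T} \<Longrightarrow> norm (V \<xi> t) \<le> E * (norm (fourier g \<xi>) + integral {0..T} (\<lambda>s. norm (\<i> * fourier (f s) \<xi>)))"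
    for \<xi> t
    using sol[of \<xi>] unfolding sol_def by blast+
  \<comment> \<open>The factor 2 comes from squaring the sum of the two data terms, and
    \<open>T\<close> from Cauchy-Schwarz in time.\<close>
  define b where "b \<xi> = 2 * E\<^sup>2 * (weighted_sq r (fourier g) \<xi> + T * integral {0..T} (\<lambda>s. weighted_sq r (fourier (f s)) \<xi>))" for \<xi>
  have b: "b summable_on UNIV"
    unfolding b_def using g
    by (intro summable_on_cmult_right summable_on_add weighted_integral_summable f) (simp add: sobolev_iff)
  have bound: "weighted_sq r (\<lambda>\<xi>. V \<xi> t) \<xi> \<le> b \<xi>" if t: "t \<in> {0..T}" for \<xi> t
  proof -
    define W where "W = (1 + norm (freq \<xi>)) powr (2 * r)"
    define I where "I = integral {0..T} (\<lambda>s. norm (fourier (f s) \<xi>))"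
    have I0: "0 \<le> I"
      unfolding I_def by (intro integral_nonneg integrable_continuous_interval continuous_intros cf) simp
    have "norm (V \<xi> t) \<le> E * (norm (fourier g \<xi>) + I)"
      using Vb[OF t, of \<xi>] by (simp add: norm_mult I_def)
    then have "(norm (V \<xi> t))\<^sup>2 \<le> (E * (norm (fourier g \<xi>) + I))\<^sup>2"
      by (rule power_mono) simp
    also have "\<dots> = E\<^sup>2 * (norm (fourier g \<xi>) + I)\<^sup>2"
      by (simp add: power_mult_distrib)
    also have "\<dots> \<le> E\<^sup>2 * (2 * (norm (fourier g \<xi>))\<^sup>2 + 2 * I\<^sup>2)"
      using sum_squares_bound[of "norm (fourier g \<xi>)" I] by (intro mult_left_mono) (simp_all add: power2_sum)
    also have "\<dots> \<le> E\<^sup>2 * (2 * (norm (fourier g \<xi>))\<^sup>2 + 2 * (T * integral {0..T} (\<lambda>s. (norm (fourier (f s) \<xi>))\<^sup>2)))"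
      unfolding I_def by (intro mult_left_mono add_left_mono integral_norm_sq_le T cf) simp_all
    finally have "(norm (V \<xi> t))\<^sup>2 * W \<le>
        E\<^sup>2 * (2 * (norm (fourier g \<xi>))\<^sup>2 + 2 * (T * integral {0..T} (\<lambda>s. (norm (fourier (f s) \<xi>))\<^sup>2))) * W"
      by (rule mult_right_mono) (simp add: W_def)
    also have "\<dots> = b \<xi>"
      unfolding b_def weighted_sq_def W_def[symmetric] integral_mult_left by (simp add: algebra_simps)
    finally show ?thesis
      by (simp add: weighted_sq_def W_def)
  qed
  have cV: "continuous_on {0..T} (V \<xi>)" for \<xi>
    by (rule has_vector_derivative_imp_continuous_on[OF V])
  define u where "u t = synthesis (\<lambda>\<xi>. V \<xi> t)" for t
  have u: "u \<in> C_sobolev T r"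
    unfolding u_def by (rule C_sobolev_synthesis[OF cV b bound])
  have "g \<in> distributions"
    using g by (simp add: sobolev_iff)
  then have "u 0 = g"
    using synthesis_fourier[of g] by (simp add: u_def V0)
  then have "solves_Cauchy T a2 a1 a0 f g u"
    using V unfolding solves_iff[OF u f] by (simp add: u_def fourier_synthesis)
  with u show ?thesis by (rule that)
qed

end

theorem theorem6p4:
  fixes T :: real
    and a2 :: "real \<Rightarrow> complex"
    and a1 :: "'n::finite \<Rightarrow> real \<Rightarrow> complex"
    and a0 :: "real \<Rightarrow> complex"
  assumes "T > 0"
    and "continuous_on {0..T} a2"
    and "\<And>j. continuous_on {0..T} (a1 j)"
    and "continuous_on {0..T} a0"
    and "\<And>t. t \<in> {0..T} \<Longrightarrow> Im (a2 t) \<le> 0"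
    and "\<And>j t. t \<in> {0..T} \<Longrightarrow> Im (a1 j t) = 0"
  shows "well_posed_Hr T a2 a1 a0"
proof -
  interpret cauchy_problem T a2 a1 a0
    by unfold_locales (use assms in auto)
  show ?thesis
    unfolding well_posed_Hr_def
  proof (intro allI ballI)
    fix r and f :: "real \<Rightarrow> 'n functional" and g :: "'n functional"
    assume f: "f \<in> C_sobolev T r" and g: "g \<in> sobolev r"
    obtain u where u: "u \<in> C_sobolev T r" "solves_Cauchy T a2 a1 a0 f g u"
      using existence[OF f g] .
    then show "\<exists>u\<in>C_sobolev T r. solves_Cauchy T a2 a1 a0 f g u \<and>
        (\<forall>v\<in>C_sobolev T r. solves_Cauchy T a2 a1 a0 f g v \<longrightarrow> (\<forall>t\<in>{0..T}. v t = u t))"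
      using unique[OF u(1) _ f u(2)] by blast
  qed
qed

end
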